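(* Let $X^N=(X_0^N,\dots,X_d^N)$ be the Markov process described in the context, with initial state $X^N(0)=(0,\dots,0,F_N)$, and let $\rho=\lambda/\mu$. For $\delta\in(0,1)$ let $$T_N(\delta)=\inf\left\{t\geq0:\frac{X_0^N(t)}{N}\geq\delta\beta\right\}.$$ Then, under the condition $\lambda>d\beta\mu$, the relation $$\lim_{N\to+\infty}\frac{T_N(\delta)}{N^{d-1}}=\frac{\rho^{d-1}}{\lambda(d-1)!}\left(-\frac{\rho}{d}\log(1-\delta)-\beta\delta\right)$$ holds for the convergence in distribution.
   Context: Model. Fix real numbers $\lambda,\mu>0$ and an integer $d\ge 2$. For each integer $N\ge1$ let $F_N\in\mathbb{N}$, and assume there are $\beta>0$ and $\gamma\ge 0$ with $\lim_{N\to\infty}(F_N-N\beta)/\sqrt N=\gamma$. The process $X^N(t)=(X^N_0(t),\dots,X^N_d(t))$ is the continuous-time Markov jump process on $\{x=(x_0,\dots,x_d)\in\mathbb{N}^{d+1}:\sum_i x_i=F_N\}$ with the following transitions ($e_0,\dots,e_d$ are the unit vectors): (loss) for $1\le k\le d$, $x\to x-e_k+e_{k-1}$ at rate $\mu k x_k$; (duplication) for $1\le k\le d-1$, $x\to x-e_k+e_{k+1}$ at rate $\lambda N$ if $x_k>0$ and $x_i=0$ for all $1\le i<k$, and at rate $0$ otherwise. *)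

theory Defs
  imports "HOL-Probability.Probability"
begin

section \<open>Markov jump processes on a finite state space\<close>

text \<open>
  \<open>q x y\<close> is the jump rate from \<open>x\<close> to \<open>y\<close>; only its values for \<open>x \<noteq> y\<close> matter, since a
  diagonal value cancels in the equation below. The function \<open>p\<close> solves Kolmogorov's forward
  equation \<open>p' = p Q\<close>, where \<open>Q\<close> is the matrix with off-diagonal entries \<open>q\<close> and row sums \<open>0\<close>.
  On a finite \<open>S\<close> the solution is unique, namely \<open>p t = exp (t Q)\<close>.
\<close>

definition transition_function ::
  "'s set \<Rightarrow> ('s \<Rightarrow> 's \<Rightarrow> real) \<Rightarrow> (real \<Rightarrow> 's \<Rightarrow> 's \<Rightarrow> real) \<Rightarrow> bool" where
  "transition_function S q p \<longleftrightarrow>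
     (\<forall>x\<in>S. \<forall>y\<in>S. p 0 x y = (if x = y then 1 else 0)) \<and>
     (\<forall>x\<in>S. \<forall>y\<in>S. \<forall>t\<ge>0.
        ((\<lambda>s. p s x y) has_real_derivative
           (\<Sum>z\<in>S. p t x z * q z y) - p t x y * (\<Sum>z\<in>S. q y z)) (at t within {0..}))"

text \<open>
  The two conditions on the paths say that they are right-continuous with left limits for the
  discrete topology on the states. The last condition is the Markov property with transition
  function \<open>p\<close>, written for the finite-dimensional distributions without dividing by the
  probability of the conditioning event.
\<close>

definition markov_jump_process ::
  "'w measure \<Rightarrow> 's set \<Rightarrow> ('s \<Rightarrow> 's \<Rightarrow> real) \<Rightarrow> 's \<Rightarrow> (real \<Rightarrow> 'w \<Rightarrow> 's) \<Rightarrow> bool" where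
  "markov_jump_process M S q x0 X \<longleftrightarrow>
     prob_space M \<and> finite S \<and>
     (\<forall>t\<ge>0. X t \<in> M \<rightarrow>\<^sub>M count_space S) \<and>
     (AE \<omega> in M. X 0 \<omega> = x0) \<and>
     (\<forall>\<omega>\<in>space M. \<forall>t\<ge>0. \<forall>\<^sub>F s in at_right t. X s \<omega> = X t \<omega>) \<and>
     (\<forall>\<omega>\<in>space M. \<forall>t>0. \<exists>x. \<forall>\<^sub>F s in at_left t. X s \<omega> = x) \<and>
     (\<exists>p. transition_function S q p \<and>
       (\<forall>(n::nat) (t::nat \<Rightarrow> real) (x::nat \<Rightarrow> 's).
          0 \<le> t 0 \<longrightarrow> (\<forall>i\<le>n. t i \<le> t (Suc i)) \<longrightarrow> (\<forall>i\<le>Suc n. x i \<in> S) \<longrightarrow>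
          measure M {\<omega>\<in>space M. \<forall>i\<le>Suc n. X (t i) \<omega> = x i} =
          measure M {\<omega>\<in>space M. \<forall>i\<le>n. X (t i) \<omega> = x i} *
            p (t (Suc n) - t n) (x n) (x (Suc n))))"

section \<open>The duplication and loss model\<close>

text \<open>A state \<open>(x\<^sub>0, \<dots>, x\<^sub>d)\<close> is a function on \<^typ>\<open>nat\<close> that vanishes beyond \<open>d\<close>.\<close>

definition states :: "nat \<Rightarrow> nat \<Rightarrow> (nat \<Rightarrow> nat) set" where
  "states d F = {x. (\<forall>i>d. x i = 0) \<and> (\<Sum>i\<le>d. x i) = F}"

text \<open>\<open>move k l x\<close> is \<open>x - e\<^sub>k + e\<^sub>l\<close>; it is only used for \<open>k \<noteq> l\<close> and \<open>x k > 0\<close>.\<close>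

definition move :: "nat \<Rightarrow> nat \<Rightarrow> (nat \<Rightarrow> nat) \<Rightarrow> (nat \<Rightarrow> nat)" where
  "move k l x = x(k := x k - 1, l := x l + 1)"

definition jump_rate ::
  "real \<Rightarrow> real \<Rightarrow> nat \<Rightarrow> nat \<Rightarrow> (nat \<Rightarrow> nat) \<Rightarrow> (nat \<Rightarrow> nat) \<Rightarrow> real" where
  "jump_rate lambda \<mu> d N x y =
     (\<Sum>k\<in>{1..d}. if x k > 0 \<and> y = move k (k - 1) x then \<mu> * real k * real (x k) else 0) +
     (\<Sum>k\<in>{1..d - 1}. if x k > 0 \<and> (\<forall>i\<in>{1..<k}. x i = 0) \<and> y = move k (k + 1) x
                       then lambda * real N else 0)"

definition initial_state :: "nat \<Rightarrow> nat \<Rightarrow> (nat \<Rightarrow> nat)" where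
  "initial_state d F = (\<lambda>i. if i = d then F else 0)"

text \<open>The infimum is taken in the extended reals: it is \<open>\<infinity>\<close> if the level is never reached.\<close>

definition loss_time ::
  "real \<Rightarrow> real \<Rightarrow> nat \<Rightarrow> (real \<Rightarrow> 'w \<Rightarrow> nat \<Rightarrow> nat) \<Rightarrow> 'w \<Rightarrow> ereal" where
  "loss_time \<delta> \<beta> N X \<omega> = Inf {ereal t | t. t \<ge> 0 \<and> real (X t \<omega> 0) / real N \<ge> \<delta> * \<beta>}"

section \<open>Convergence in distribution\<close>

text \<open>
  Weak convergence of measures through bounded continuous test functions. It is used for laws on
  \<^typ>\<open>ereal\<close>, which \<^const>\<open>weak_conv_m\<close>, restricted to \<^typ>\<open>real\<close>, does not cover.
\<close>

definition weak_convergence ::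
  "(nat \<Rightarrow> 'a::topological_space measure) \<Rightarrow> 'a measure \<Rightarrow> bool" where
  "weak_convergence L L' \<longleftrightarrow>
     (\<forall>f::'a \<Rightarrow> real. continuous_on UNIV f \<longrightarrow> bounded (range f) \<longrightarrow>
        (\<lambda>n. integral\<^sup>L (L n) f) \<longlonglongrightarrow> integral\<^sup>L L' f)"

end

theory Submission
  imports Defs "HOL-Real_Asymp.Real_Asymp"
begin

text \<open>
  The number \<open>x\<^sub>0\<close> of lost files never decreases, so up to null sets the event that the level has
  been reached by time \<open>t\<close> only depends on the law of the process at the single time \<open>t\<close>, and
  Kolmogorov's equation gives the derivative of \<open>E f(X(t))\<close> as \<open>E (Q f)(X(t))\<close>.

  Exponential Lyapunov functions of the weighted counts \<open>\<Sum>\<^sub>i\<^sub>\<le>\<^sub>k (k + 1 - i) x\<^sub>i\<close> show that, uniformly in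
  time, level \<open>k\<close> is occupied by order \<open>N\<close> to the power \<open>-(d - 1 - k)\<close> files on average
  for \<open>1 \<le> k < d\<close>; for \<open>k < d - 1\<close> an occupied level almost always holds a single file, which is
  being duplicated. Explicit correctors then express \<open>N\<^sup>d\<^sup>-\<^sup>2 x\<^sub>1\<close>, level by level,
  through \<open>x\<^sub>d\<^sub>-\<^sub>1\<close>, which behaves like an M/M/1 queue with arrival rate \<open>a = d mu (F - x\<^sub>0) / N\<close>
  and service rate \<open>lam\<close>, of mean \<open>a / (lam - a)\<close>. On the time scale \<open>N\<^sup>d\<^sup>-\<^sup>1\<close> the fraction \<open>x\<^sub>0 / N\<close> thus has
  an asymptotic drift that is a decreasing function of the fraction itself. Its distance to the
  solution of the limiting equation, parametrised by the value \<open>\<theta>\<close> of that solution, is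
  therefore controlled in mean square without Gronwall's inequality.
\<close>

section \<open>Markov jump processes and their generators\<close>

text \<open>The time scale shapes the estimates: over times of order \<open>N^(d-1)\<close> no
  moment bound may deteriorate with \<open>t\<close>. Each comes from a Lyapunov function that
  relaxes at a rate of order \<open>N\<close> and vanishes initially, since all files start on level
  \<open>d\<close>. The priority rule is the second obstacle: \<open>lam N x_k\<close> is the
  duplication rate of level \<open>k\<close> only if its occupation is at most one served file.
  Below level \<open>d - 1\<close>, the failure of this is smaller in mean than the bound on the
  occupation by a factor \<open>N^(-1/2)\<close>, which is what lets the correctors close; the half
  power comes from splitting the top queue at size \<open>sqrt N\<close>. A mean square needs the
  drifts of both \<open>x_0 / N\<close> and its square. The averaging step therefore carries a
  weight \<phi> depending on \<open>x_0\<close>, which is taken to be 1 and then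
  \<open>(2 x_0 + 1) / N\<close>. In the parameter \<theta> the target moves at unit speed, and the
  generator is multiplied by the reciprocal of the limiting drift. The derivative of the mean square
  is then a term of good sign plus a vanishing error, and it can be integrated directly.\<close>

lemma deriv_le_imp_le:
  fixes f :: "real \<Rightarrow> real"
  assumes "\<And>t. 0 \<le> t \<Longrightarrow> t \<le> b \<Longrightarrow> (f has_real_derivative f' t) (at t within {0..b})"
    and "\<And>t. 0 \<le> t \<Longrightarrow> t \<le> b \<Longrightarrow> f' t \<le> e" and "0 \<le> b"
  shows "f b \<le> f 0 + e * b"
proof -
  have "f b - e * b \<le> f 0 - e * 0"
  proof (rule DERIV_nonpos_imp_decreasing_open[OF \<open>0 \<le> b\<close>])
    fix x :: real assume x: "0 < x" "x < b"
    then have "at x within {0..b} = at x" by (intro at_within_interior) simp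
    then have "((\<lambda>t. f t - e * t) has_real_derivative f' x - e) (at x)"
      using assms(1)[of x] x by (auto intro!: derivative_eq_intros)
    then show "\<exists>y. ((\<lambda>t. f t - e * t) has_real_derivative y) (at x) \<and> y \<le> 0"
      using assms(2)[of x] x by auto
  next
    have "continuous_on {0..b} f" by (rule DERIV_continuous_on) (use assms(1) in auto)
    then show "continuous_on {0..b} (\<lambda>t. f t - e * t)" by (intro continuous_intros)
  qed
  then show ?thesis by simp
qed

lemma nonpos_deriv_imp_le:
  fixes f :: "real \<Rightarrow> real"
  assumes "\<And>t. 0 \<le> t \<Longrightarrow> (f has_real_derivative f' t) (at t within {0..})"
    and "\<And>t. 0 \<le> t \<Longrightarrow> f' t \<le> 0" and "0 \<le> t"
  shows "f t \<le> f 0"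
proof -
  have "f t \<le> f 0 + 0 * t"
  proof (rule deriv_le_imp_le)
    fix u :: real assume u: "0 \<le> u"
    show "(f has_real_derivative f' u) (at u within {0..t})"
      by (rule has_field_derivative_subset[OF assms(1)[OF u]]) auto
    show "f' u \<le> 0" by (rule assms(2)[OF u])
  qed (rule assms(3))
  then show ?thesis by simp
qed

text \<open>The integrating factor \<open>exp (\<kappa> * t)\<close> turns the inequality into
  monotonicity. A start below the equilibrium value \<open>c / \<kappa>\<close> never crosses it, so
  the bound contains no time.\<close>

lemma linear_decay_bound:
  fixes f :: "real \<Rightarrow> real"
  assumes deriv: "\<And>t. 0 \<le> t \<Longrightarrow> (f has_real_derivative f' t) (at t within {0..})"
    and le: "\<And>t. 0 \<le> t \<Longrightarrow> f' t \<le> c - \<kappa> * f t"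
    and "0 < \<kappa>" "f 0 \<le> c / \<kappa>" "0 \<le> t"
  shows "f t \<le> c / \<kappa>"
proof -
  define g where "g t = exp (\<kappa> * t) * (f t - c / \<kappa>)" for t
  have "g t \<le> g 0"
  proof (rule nonpos_deriv_imp_le)
    fix t :: real assume t: "0 \<le> t"
    show "(g has_real_derivative exp (\<kappa> * t) * (f' t - (c - \<kappa> * f t))) (at t within {0..})"
      unfolding g_def using \<open>0 < \<kappa>\<close>
      by (auto intro!: derivative_eq_intros deriv[OF t] simp: field_simps)
    show "exp (\<kappa> * t) * (f' t - (c - \<kappa> * f t)) \<le> 0"
      using le[OF t] by (simp add: mult_nonneg_nonpos)
  qed (rule assms)
  then have "exp (\<kappa> * t) * (f t - c / \<kappa>) \<le> 0"
    using assms by (simp add: g_def)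
  then show ?thesis by (simp add: mult_le_0_iff)
qed

section \<open>Generators and Kolmogorov's equation for expectations\<close>

definition generator :: "'s set \<Rightarrow> ('s \<Rightarrow> 's \<Rightarrow> real) \<Rightarrow> ('s \<Rightarrow> real) \<Rightarrow> 's \<Rightarrow> real" where
  "generator S q f x = (\<Sum>y\<in>S. q x y * (f y - f x))"

text \<open>An interchange of finite sums moves the operator from the law to the test function.
  Keeping the family \<open>m\<close> arbitrary serves twice: for the law of the process and for a
  row of the transition function.\<close>

lemma forward_equation_expectation:
  assumes "finite S"
    and "\<And>y. y \<in> S \<Longrightarrow> ((\<lambda>s. m s y) has_real_derivative
           (\<Sum>z\<in>S. m t z * q z y) - m t y * (\<Sum>z\<in>S. q y z)) (at t within A)"
  shows "((\<lambda>s. \<Sum>y\<in>S. m s y * f y) has_real_derivative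
           (\<Sum>x\<in>S. m t x * generator S q f x)) (at t within A)"
proof -
  have "(\<Sum>x\<in>S. m t x * generator S q f x) =
      (\<Sum>x\<in>S. \<Sum>y\<in>S. m t x * q x y * f y) - (\<Sum>x\<in>S. \<Sum>y\<in>S. m t x * q x y * f x)"
    by (simp add: generator_def sum_distrib_left sum_subtractf algebra_simps)
  also have "(\<Sum>x\<in>S. \<Sum>y\<in>S. m t x * q x y * f y) = (\<Sum>y\<in>S. (\<Sum>x\<in>S. m t x * q x y) * f y)"
    by (subst sum.swap) (simp add: sum_distrib_right)
  also have "(\<Sum>x\<in>S. \<Sum>y\<in>S. m t x * q x y * f x) = (\<Sum>x\<in>S. m t x * (\<Sum>y\<in>S. q x y) * f x)"
    by (simp add: sum_distrib_left sum_distrib_right)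
  finally have eq: "(\<Sum>x\<in>S. m t x * generator S q f x) =
      (\<Sum>y\<in>S. ((\<Sum>z\<in>S. m t z * q z y) - m t y * (\<Sum>z\<in>S. q y z)) * f y)"
    by (simp add: sum_subtractf left_diff_distrib)
  show ?thesis unfolding eq
    by (intro DERIV_sum DERIV_cmult_right assms)
qed

section \<open>The generator of the duplication and loss model\<close>

definition linear_form :: "nat \<Rightarrow> (nat \<Rightarrow> nat) \<Rightarrow> (nat \<Rightarrow> nat) \<Rightarrow> nat" where
  "linear_form d w x = (\<Sum>i\<le>d. w i * x i)"

text \<open>The two weights stand on opposite sides so that no truncated subtraction occurs.
  Instances of \<open>w\<close> give the conservation of the number of files and the changes of the
  deficits and the low counts.\<close>

lemma linear_form_move:
  assumes "k \<le> d" "l \<le> d" "k \<noteq> l" "0 < x k"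
  shows "linear_form d w (move k l x) + w k = linear_form d w x + w l"
proof -
  define R where "R = (\<Sum>i\<in>{..d} - {k} - {l}. w i * x i)"
  have split: "linear_form d w z = w k * z k + (w l * z l + (\<Sum>i\<in>{..d} - {k} - {l}. w i * z i))" for z
    using assms unfolding linear_form_def
    by (subst sum.remove[of _ k]; (subst sum.remove[of _ l])?) auto
  have R: "(\<Sum>i\<in>{..d} - {k} - {l}. w i * move k l x i) = R"
    unfolding R_def by (intro sum.cong) (auto simp: move_def)
  obtain n where "x k = Suc n" using assms(4) gr0_implies_Suc by blast
  then show ?thesis
    using assms unfolding split R by (simp add: move_def R_def)
qed

lemma move_in_states:
  assumes "x \<in> states d F" "k \<le> d" "l \<le> d" "k \<noteq> l" "0 < x k"
  shows "move k l x \<in> states d F"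
  using linear_form_move[where x = x and w = "\<lambda>_. 1", OF assms(2-5)] assms
  by (auto simp: states_def linear_form_def move_def)

lemma finite_states: "finite (states d F)"
proof (rule finite_subset)
  show "states d F \<subseteq> {x. \<forall>i. (i \<in> {..d} \<longrightarrow> x i \<in> {..F}) \<and> (i \<notin> {..d} \<longrightarrow> x i = 0)}"
    by (auto simp: states_def intro: member_le_sum)
  show "finite {x. \<forall>i. (i \<in> {..d} \<longrightarrow> x i \<in> {..F}) \<and> (i \<notin> {..d} \<longrightarrow> x i = (0::nat))}"
    by (rule finite_set_of_finite_funs) auto
qed

lemma initial_state_in_states: "initial_state d F \<in> states d F"
  by (auto simp: initial_state_def states_def)

definition served :: "nat \<Rightarrow> (nat \<Rightarrow> nat) \<Rightarrow> bool" where
  "served k x \<longleftrightarrow> 0 < x k \<and> (\<forall>i\<in>{1..<k}. x i = 0)"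

text \<open>Each summand of \<open>jump_rate\<close> is supported on a single target state, which
  the inner sum over \<open>y\<close> picks out. Where \<open>x k = 0\<close> the state
  \<open>move k (k - 1) x\<close> is meaningless, but the factor \<open>real (x k)\<close> removes
  it.\<close>

lemma generator_jump_rate:
  assumes x: "x \<in> states d F"
  shows "generator (states d F) (jump_rate lam mu d N) f x =
     (\<Sum>k\<in>{1..d}. mu * real k * real (x k) * (f (move k (k - 1) x) - f x)) +
     (\<Sum>k\<in>{1..d - 1}. of_bool (served k x) * (lam * real N) * (f (move k (k + 1) x) - f x))"
proof -
  let ?S = "states d F"
  have pick: "(\<Sum>y\<in>?S. (if P \<and> y = z then a else 0) * (f y - f x)) = (if P then a * (f z - f x) else 0)"
    if "P \<Longrightarrow> z \<in> ?S" for P z and a :: real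
  proof (cases P)
    case True
    with that have "z \<in> ?S" by simp
    have "(\<Sum>y\<in>?S. (if P \<and> y = z then a else 0) * (f y - f x)) =
        (\<Sum>y\<in>?S. if y = z then a * (f z - f x) else 0)"
      using True by (intro sum.cong) auto
    with True \<open>z \<in> ?S\<close> show ?thesis by (simp add: finite_states)
  qed simp
  have "generator ?S (jump_rate lam mu d N) f x =
     (\<Sum>k\<in>{1..d}. \<Sum>y\<in>?S. (if 0 < x k \<and> y = move k (k - 1) x then mu * real k * real (x k) else 0) * (f y - f x)) +
     (\<Sum>k\<in>{1..d - 1}. \<Sum>y\<in>?S. (if served k x \<and> y = move k (k + 1) x then lam * real N else 0) * (f y - f x))"
    unfolding generator_def jump_rate_def served_def
    by (simp add: distrib_right sum.distrib sum_distrib_right conj_assoc)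
      (subst sum.swap, subst (2) sum.swap, rule refl)
  also have "(\<Sum>k\<in>{1..d}. \<Sum>y\<in>?S. (if 0 < x k \<and> y = move k (k - 1) x then mu * real k * real (x k) else 0) * (f y - f x)) =
      (\<Sum>k\<in>{1..d}. mu * real k * real (x k) * (f (move k (k - 1) x) - f x))"
    using x by (intro sum.cong refl, subst pick) (auto intro!: move_in_states)
  also have "(\<Sum>k\<in>{1..d - 1}. \<Sum>y\<in>?S. (if served k x \<and> y = move k (k + 1) x then lam * real N else 0) * (f y - f x)) =
     (\<Sum>k\<in>{1..d - 1}. of_bool (served k x) * (lam * real N) * (f (move k (k + 1) x) - f x))"
    using x by (intro sum.cong refl, subst pick) (auto intro!: move_in_states simp: served_def)
  finally show ?thesis .
qed

text \<open>The number of copies that the files on levels \<open>1, \<dots>, k\<close> lack to reach level \<open>k + 1\<close>.\<close>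

definition deficit :: "nat \<Rightarrow> nat \<Rightarrow> (nat \<Rightarrow> nat) \<Rightarrow> nat" where
  "deficit d k = linear_form d (\<lambda>i. if i = 0 then 0 else k + 1 - i)"

definition low_count :: "nat \<Rightarrow> nat \<Rightarrow> (nat \<Rightarrow> nat) \<Rightarrow> nat" where
  "low_count d k = linear_form d (\<lambda>i. of_bool (1 \<le> i \<and> i \<le> k))"

text \<open>The exponential Lyapunov function, flattened to zero on \<open>{..m}\<close>. With
  \<open>m = 0\<close> it measures the occupation of the levels; with \<open>m = 1\<close> it
  ignores deficit one, a single file on level \<open>k\<close>, and sees only the rarer
  configurations in which at least two copies are missing.\<close>

definition excess :: "real \<Rightarrow> nat \<Rightarrow> nat \<Rightarrow> real" where
  "excess r m n = r ^ max n m - r ^ m"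

lemma excess_mono: "1 \<le> r \<Longrightarrow> n \<le> n' \<Longrightarrow> excess r m n \<le> excess r m n'"
  by (simp add: excess_def power_increasing max.coboundedI1 max.mono)

lemma excess_eq_0: "n \<le> m \<Longrightarrow> excess r m n = 0"
  by (simp add: excess_def max_def)

lemma excess_nonneg: "1 \<le> r \<Longrightarrow> 0 \<le> excess r m n"
  by (simp add: excess_def power_increasing)

lemma excess_Suc_diff:
  "excess r m (Suc n) - excess r m n = (if n < m then 0 else (r - 1) * r ^ n)"
  by (auto simp: excess_def max_def algebra_simps le_Suc_eq)

section \<open>Relations between occupations, low counts and deficits\<close>

lemma weighted_le_linear_form: "i \<le> d \<Longrightarrow> w i * x i \<le> linear_form d w x"
  unfolding linear_form_def by (intro member_le_sum) auto

lemma le_deficit: "1 \<le> i \<Longrightarrow> i \<le> k \<Longrightarrow> k \<le> d \<Longrightarrow> x i \<le> deficit d k x"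
  using weighted_le_linear_form[of i d "\<lambda>i. if i = 0 then 0 else k + 1 - i" x]
  unfolding deficit_def by (cases "k + 1 - i") auto

lemma le_low_count: "1 \<le> i \<Longrightarrow> i \<le> k \<Longrightarrow> k \<le> d \<Longrightarrow> x i \<le> low_count d k x"
  using weighted_le_linear_form[of i d "\<lambda>i. of_bool (1 \<le> i \<and> i \<le> k)" x]
  unfolding low_count_def by auto

lemma low_count_le_deficit: "low_count d k x \<le> deficit d k x"
  unfolding low_count_def deficit_def linear_form_def by (intro sum_mono) auto

lemma deficit_Suc: "k < d \<Longrightarrow> deficit d (Suc k) x = deficit d k x + low_count d (Suc k) x"
  unfolding low_count_def deficit_def linear_form_def sum.distrib[symmetric]
  by (intro sum.cong) (auto simp: Suc_diff_le)

lemma low_count_Suc: 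
  assumes "k < d" shows "low_count d (Suc k) x = low_count d k x + x (Suc k)"
proof -
  have "x (Suc k) = (\<Sum>i\<le>d. if i = Suc k then x i else 0)"
    using assms by simp
  then show ?thesis
    unfolding low_count_def linear_form_def 
    by (simp only: sum.distrib[symmetric]) (intro sum.cong, auto simp: le_Suc_eq)
qed

lemma low_count_0 [simp]: "low_count d 0 x = 0"
  by (simp add: low_count_def linear_form_def)

lemma low_count_le_total: "x \<in> states d F \<Longrightarrow> low_count d k x \<le> F"
  unfolding low_count_def linear_form_def states_def by (auto intro!: sum_mono2)

lemma states_total:
  assumes "x \<in> states d F" "2 \<le> d"
  shows "x 0 + low_count d (d - 1) x + x d = F"
proof -
  obtain e where d: "d = Suc e" using assms(2) by (cases d) auto
  have "low_count d (d - 1) x + x d = low_count d d x"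
    using low_count_Suc[of e d x] by (simp add: d)
  moreover have "x 0 + low_count d d x = (\<Sum>i\<le>d. x i)"
  proof -
    have "(\<Sum>i\<le>d. x i) = x 0 + (\<Sum>i<d. x (Suc i))"
      by (subst sum.atMost_shift) simp
    moreover have "low_count d d x = (\<Sum>i<d. x (Suc i))"
      unfolding low_count_def linear_form_def by (subst sum.atMost_shift) simp
    ultimately show ?thesis by simp
  qed
  ultimately show ?thesis using assms by (simp add: states_def)
qed

lemma low_count_pos_served:
  assumes "0 < low_count d k x" "k \<le> d"
  obtains j where "1 \<le> j" "j \<le> k" "served j x"
proof -
  have "\<exists>i. 1 \<le> i \<and> i \<le> k \<and> 0 < x i"
  proof (rule ccontr)
    assume "\<not> ?thesis"
    then have "low_count d k x = 0"
      unfolding low_count_def linear_form_def by (intro sum.neutral) auto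
    then show False using assms by simp
  qed
  then obtain i where i: "1 \<le> i \<and> i \<le> k \<and> 0 < x i" by blast
  define j where "j = (LEAST i. 1 \<le> i \<and> i \<le> k \<and> 0 < x i)"
  have j: "1 \<le> j \<and> j \<le> k \<and> 0 < x j" unfolding j_def using i by (rule LeastI)
  moreover have "x l = 0" if "1 \<le> l" "l < j" for l
    using not_less_Least[of l "\<lambda>i. 1 \<le> i \<and> i \<le> k \<and> 0 < x i"] that j
    unfolding j_def[symmetric] by auto
  ultimately show ?thesis using that[of j] by (auto simp: served_def)
qed

lemma deficit_pos_low_count: "0 < deficit d k x \<Longrightarrow> 0 < low_count d k x"
proof -
  assume pos: "0 < deficit d k x"
  have "deficit d k x \<le> k * low_count d k x"
    unfolding deficit_def low_count_def linear_form_def sum_distrib_left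
    by (intro sum_mono) auto
  then show ?thesis using pos by (cases "low_count d k x") auto
qed

text \<open>A loss from level 1 raises nothing, because level 0 has weight 0 and the lost file takes
  its missing copies away with it. Only losses that land on levels \<open>1\<close> to
  \<open>k\<close> cost one further copy.\<close>

lemma deficit_loss:
  assumes "1 \<le> j" "j \<le> d" "0 < x j"
  shows "deficit d k (move j (j - 1) x) \<le> deficit d k x + of_bool (2 \<le> j \<and> j \<le> k + 1)"
proof -
  obtain i where j: "j = Suc i" using assms by (cases j) auto
  show ?thesis
    using linear_form_move[of j d i x "\<lambda>i. if i = 0 then 0 else k + 1 - i"] assms
    unfolding deficit_def[symmetric] j by (auto split: if_splits)
qed

lemma deficit_served:
  assumes "1 \<le> j" "j < d" "0 < x j"
  shows "deficit d k (move j (j + 1) x) + of_bool (j \<le> k) = deficit d k x"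
  using linear_form_move[of j d "j + 1" x "\<lambda>i. if i = 0 then 0 else k + 1 - i"] assms
  unfolding deficit_def[symmetric] by (auto split: if_splits)

lemma total_loss_rate:
  assumes "x \<in> states d F" "0 \<le> mu"
  shows "(\<Sum>j=1..d. mu * real j * real (x j)) \<le> mu * real d * real F"
proof -
  have "(\<Sum>j=1..d. mu * real j * real (x j)) \<le> (\<Sum>j=1..d. mu * real d * real (x j))"
    using assms(2) by (intro sum_mono mult_right_mono mult_left_mono) auto
  also have "\<dots> = mu * real d * real (\<Sum>j=1..d. x j)"
    by (simp add: sum_distrib_left)
  also have "\<dots> \<le> mu * real d * real F"
  proof -
    have "(\<Sum>j=1..d. x j) \<le> (\<Sum>j\<le>d. x j)" by (intro sum_mono2) auto
    also have "\<dots> = F" using assms(1) by (simp add: states_def)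
    finally have "real (\<Sum>j=1..d. x j) \<le> real F" by (simp only: of_nat_le_iff)
    then show ?thesis using assms(2) by (intro mult_left_mono) auto
  qed
  finally show ?thesis .
qed

text \<open>A positive deficit increases at rate at most \<open>L N\<close> and is lowered by duplications at the
  larger rate \<open>lam N\<close>, like the length of a subcritical queue.\<close>

lemma generator_excess:
  fixes r lam mu L :: real
  assumes x: "x \<in> states d F" and k: "1 \<le> k" "k < d" and r: "1 < r"
    and lam: "0 < lam" and mu: "0 \<le> mu" and L: "r * L \<le> lam"
    and load: "mu * real d * real F \<le> L * real N"
  defines "n \<equiv> deficit d k x"
  shows "generator (states d F) (jump_rate lam mu d N) (\<lambda>x. excess r m (deficit d k x)) x
     \<le> - ((r - 1) * (lam / r - L) * real N) * excess r m n
       + (if n = m then r ^ m * (r - 1) * (mu * real d) * (real m + real (x (k + 1))) else 0)"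
proof -
  let ?v = "excess r m"
  let ?D = "?v (Suc n) - ?v n"
  let ?loss = "\<lambda>j. mu * real j * real (x j) * (?v (deficit d k (move j (j - 1) x)) - ?v n)"
  let ?srv = "\<lambda>j. of_bool (served j x) * (lam * real N) * (?v (deficit d k (move j (j + 1) x)) - ?v n)"
  have D0: "0 \<le> ?D" using excess_mono[of r n "Suc n" m] r by simp
  have gen: "generator (states d F) (jump_rate lam mu d N) (\<lambda>x. ?v (deficit d k x)) x
      = (\<Sum>j=1..d. ?loss j) + (\<Sum>j=1..d-1. ?srv j)"
    unfolding generator_jump_rate[OF x] n_def by simp
  have loss_le: "?loss j \<le> mu * real j * real (x j) * (of_bool (2 \<le> j \<and> j \<le> k + 1) * ?D)"
    if "j \<in> {1..d}" for j
  proof (cases "x j = 0")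
    case False
    then have "deficit d k (move j (j - 1) x) \<le> n + of_bool (2 \<le> j \<and> j \<le> k + 1)"
      unfolding n_def using that by (intro deficit_loss) auto
    from excess_mono[OF _ this, of r m] r
    have "?v (deficit d k (move j (j - 1) x)) - ?v n \<le> of_bool (2 \<le> j \<and> j \<le> k + 1) * ?D"
      by (auto split: if_splits)
    then show ?thesis using mu by (intro mult_left_mono) auto
  qed simp
  have srv_le: "?srv j \<le> 0" if "j \<in> {1..d - 1}" for j
  proof (cases "served j x")
    case True
    then have "deficit d k (move j (j + 1) x) \<le> n"
      using deficit_served[of j d x k] that k True unfolding served_def n_def by fastforce
    then have "?v (deficit d k (move j (j + 1) x)) \<le> ?v n" using r by (intro excess_mono) auto
    then show ?thesis using lam by (intro mult_nonneg_nonpos) auto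
  qed simp
  have loss_sum: "(\<Sum>j=1..d. ?loss j) \<le> (\<Sum>j=1..d. mu * real j * real (x j) * of_bool (2 \<le> j \<and> j \<le> k + 1)) * ?D"
    unfolding sum_distrib_right using loss_le by (intro sum_mono) (simp add: mult.assoc)
  have srv_sum: "(\<Sum>j=1..d-1. ?srv j) \<le> 0" by (intro sum_nonpos srv_le)
  \<comment> \<open>Below the threshold the function stays at zero; at the threshold it can only
    grow; above it the comparison with a queue applies.\<close>
  consider "n < m" | "n = m" | "m < n" by linarith
  then show ?thesis
  proof cases
    case 1
    then have "?D = 0" "?v n = 0" by (simp_all add: excess_Suc_diff excess_eq_0)
    then show ?thesis using loss_sum srv_sum 1 unfolding gen by simp
  next
    case 2
    have D: "?D = (r - 1) * r ^ m" using 2 by (simp add: excess_Suc_diff)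
    have v: "?v n = 0" using 2 by (simp add: excess_eq_0)
    \<comment> \<open>At the threshold the levels \<open>1\<close> to \<open>k\<close> hold at most
      \<open>m\<close> files, since each contributes at least one to the deficit. Level
      \<open>k + 1\<close> is thus the only source without a fixed bound.\<close>
    have "(\<Sum>j=1..d. mu * real j * real (x j) * of_bool (2 \<le> j \<and> j \<le> k + 1))
        \<le> (\<Sum>j=1..d. mu * real d * (real (of_bool (1 \<le> j \<and> j \<le> k) * x j) + (if j = k + 1 then real (x j) else 0)))"
    proof (intro sum_mono)
      fix j assume j: "j \<in> {1..d}"
      have "mu * real j * real (x j) \<le> mu * real d * real (x j)"
        using mu j by (intro mult_right_mono mult_left_mono) auto
      then show "mu * real j * real (x j) * of_bool (2 \<le> j \<and> j \<le> k + 1)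
         \<le> mu * real d * (real (of_bool (1 \<le> j \<and> j \<le> k) * x j) + (if j = k + 1 then real (x j) else 0))"
        using mu j by auto
    qed
    also have "\<dots> = mu * real d * ((\<Sum>j=1..d. real (of_bool (1 \<le> j \<and> j \<le> k) * x j)) + real (x (k + 1)))"
      using k by (simp only: sum_distrib_left[symmetric] sum.distrib) simp
    also have "(\<Sum>j=1..d. real (of_bool (1 \<le> j \<and> j \<le> k) * x j)) = real (low_count d k x)"
      unfolding low_count_def linear_form_def of_nat_sum[symmetric]
      by (intro arg_cong[of _ _ real] sum.mono_neutral_left) auto
    also have "mu * real d * (real (low_count d k x) + real (x (k + 1))) \<le> mu * real d * (real m + real (x (k + 1)))"
      using mu low_count_le_deficit[of d k x] 2 by (intro mult_left_mono) (auto simp: n_def)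
    finally have "(\<Sum>j=1..d. mu * real j * real (x j) * of_bool (2 \<le> j \<and> j \<le> k + 1)) * ?D
        \<le> mu * real d * (real m + real (x (k + 1))) * ?D"
      using D0 by (rule mult_right_mono)
    then show ?thesis using loss_sum srv_sum 2 v unfolding gen D by (simp add: mult_ac)
  next
    case 3
    obtain n' where n': "n = Suc n'" using 3 by (cases n) auto
    have D: "?D = (r - 1) * r ^ n" using 3 by (simp add: excess_Suc_diff)
    have "(\<Sum>j=1..d. mu * real j * real (x j) * of_bool (2 \<le> j \<and> j \<le> k + 1))
       \<le> (\<Sum>j=1..d. mu * real j * real (x j))"
      using mu by (intro sum_mono) auto
    also have "\<dots> \<le> L * real N" using total_loss_rate[OF x mu] load by simp
    finally have "(\<Sum>j=1..d. mu * real j * real (x j) * of_bool (2 \<le> j \<and> j \<le> k + 1)) * ?D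
       \<le> L * real N * ?D" using D0 by (rule mult_right_mono)
    then have A: "(\<Sum>j=1..d. ?loss j) \<le> L * real N * ((r - 1) * r ^ n)"
      using loss_sum D by simp
    have "0 < deficit d k x" using n' by (simp add: n_def)
    \<comment> \<open>The lowest occupied level is served, and its duplication lowers the deficit by
      exactly one.\<close>
    from low_count_pos_served[OF deficit_pos_low_count[OF this]] k
    obtain j where j: "1 \<le> j" "j \<le> k" "served j x" by auto
    have "deficit d k (move j (j + 1) x) = n'"
      using deficit_served[of j d x k] j k n' by (auto simp: served_def n_def)
    moreover have "?v n' - ?v n = - ((r - 1) * r ^ n')"
      using excess_Suc_diff[of r m n'] 3 n' by auto
    ultimately have "?srv j = - (lam * real N * ((r - 1) * r ^ n'))" using j by simp
    moreover have "(\<Sum>j=1..d-1. ?srv j) \<le> ?srv j"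
    proof -
      have "(\<Sum>j=1..d-1. ?srv j) = ?srv j + (\<Sum>i\<in>{1..d-1} - {j}. ?srv i)"
        using j k by (intro sum.remove) auto
      moreover have "(\<Sum>i\<in>{1..d-1} - {j}. ?srv i) \<le> 0"
        by (intro sum_nonpos srv_le) auto
      ultimately show ?thesis by linarith
    qed
    ultimately have B: "(\<Sum>j=1..d-1. ?srv j) \<le> - (lam * real N * ((r - 1) * r ^ n'))" by linarith
    \<comment> \<open>Up to the factor \<open>r - 1\<close>, an upward step adds
      \<open>r ^ n\<close> while a downward step removes only \<open>r ^ (n - 1)\<close>. Hence
      \<open>lam / r\<close> competes with \<open>L\<close>, and \<open>r * L \<le> lam\<close>
      makes the balance nonpositive.\<close>
    have "L * real N * ((r - 1) * r ^ n) - (lam * real N * ((r - 1) * r ^ n')) = 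
        - ((r - 1) * (lam / r - L) * real N) * r ^ n"
      using r n' by (simp add: field_simps)
    also have "\<dots> \<le> - ((r - 1) * (lam / r - L) * real N) * ?v n"
    proof (rule mult_left_mono_neg)
      show "?v n \<le> r ^ n" using 3 r by (simp add: excess_def)
      show "- ((r - 1) * (lam / r - L) * real N) \<le> 0"
      proof -
        have "L \<le> lam / r" using r L by (simp add: field_simps)
        then show ?thesis using r by simp
      qed
    qed
    finally show ?thesis using A B 3 unfolding gen by simp
  qed
qed

lemma sum_two:
  assumes "finite A" "a \<in> A" "b \<in> A" "a \<noteq> b" "\<And>i. i \<in> A \<Longrightarrow> i \<noteq> a \<Longrightarrow> i \<noteq> b \<Longrightarrow> f i = 0"
  shows "sum f A = f a + (f b :: real)"
proof -
  have "sum f A = sum f {a, b}" using assms by (intro sum.mono_neutral_right) auto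
  then show ?thesis using assms by simp
qed

text \<open>The count changes only at its ends: by a loss from level 1, a loss arriving from level
  \<open>k + 1\<close>, or a duplication out of level \<open>k\<close>. Only the first of these also
  moves \<open>x 0\<close>, so the weight \<phi> jumps there alone. The truncated
  \<open>n - 1\<close> is harmless, as the factors in front of it vanish when
  \<open>n = 0\<close>.\<close>

lemma generator_low_count:
  fixes \<phi> g :: "nat \<Rightarrow> real"
  assumes x: "x \<in> states d F" and k: "1 \<le> k" "k < d"
  defines "n \<equiv> low_count d k x"
  shows "generator (states d F) (jump_rate lam mu d N) (\<lambda>x. \<phi> (x 0) * g (low_count d k x)) x =
      mu * real (x 1) * (\<phi> (x 0 + 1) * g (n - 1) - \<phi> (x 0) * g n)
    + mu * real (k + 1) * real (x (k + 1)) * (\<phi> (x 0) * (g (n + 1) - g n))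
    + of_bool (served k x) * (lam * real N) * (\<phi> (x 0) * (g (n - 1) - g n))"
proof -
  let ?f = "\<lambda>x. \<phi> (x 0) * g (low_count d k x)"
  have lc: "low_count d k (move i l x) + of_bool (1 \<le> i \<and> i \<le> k) = n + of_bool (1 \<le> l \<and> l \<le> k)"
    if "i \<le> d" "l \<le> d" "i \<noteq> l" "0 < x i" for i l
    using linear_form_move[where x = x and w = "\<lambda>i. of_bool (1 \<le> i \<and> i \<le> k)", OF that]
    unfolding low_count_def n_def by simp
  have "(\<Sum>j=1..d. mu * real j * real (x j) * (?f (move j (j - 1) x) - ?f x)) =
     mu * real 1 * real (x 1) * (?f (move 1 (1 - 1) x) - ?f x)
     + mu * real (k + 1) * real (x (k + 1)) * (?f (move (k + 1) (k + 1 - 1) x) - ?f x)"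
  proof (rule sum_two)
    fix j assume j: "j \<in> {1..d}" "j \<noteq> 1" "j \<noteq> k + 1"
    show "mu * real j * real (x j) * (?f (move j (j - 1) x) - ?f x) = 0"
    proof (cases "x j = 0")
      case False
      obtain i where "j = Suc i" using j by (cases j) auto
      with False have "low_count d k (move j (j - 1) x) = n"
        using lc[of j i] j by (cases "i \<le> k") auto
      moreover have "move j (j - 1) x 0 = x 0" using j by (auto simp: move_def)
      ultimately show ?thesis by (simp add: n_def)
    qed simp
  qed (use k in auto)
  also have "mu * real 1 * real (x 1) * (?f (move 1 (1 - 1) x) - ?f x) =
     mu * real (x 1) * (\<phi> (x 0 + 1) * g (n - 1) - \<phi> (x 0) * g n)"
  proof (cases "x 1 = 0")
    case False
    then have "low_count d k (move 1 (1 - 1) x) = n - 1" using lc[of 1 0] k by simp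
    moreover have "move 1 (1 - 1) x 0 = x 0 + 1" by (simp add: move_def)
    ultimately show ?thesis by (simp add: n_def)
  qed simp
  also have "mu * real (k + 1) * real (x (k + 1)) * (?f (move (k + 1) (k + 1 - 1) x) - ?f x) =
     mu * real (k + 1) * real (x (k + 1)) * (\<phi> (x 0) * (g (n + 1) - g n))"
  proof (cases "x (k + 1) = 0")
    case False
    then have "low_count d k (move (k + 1) (k + 1 - 1) x) = n + 1" using lc[of "k + 1" k] k by simp
    moreover have "move (k + 1) (k + 1 - 1) x 0 = x 0" using k by (simp add: move_def)
    ultimately show ?thesis by (simp add: n_def algebra_simps)
  qed simp
  finally have loss: "(\<Sum>j=1..d. mu * real j * real (x j) * (?f (move j (j - 1) x) - ?f x)) =
      mu * real (x 1) * (\<phi> (x 0 + 1) * g (n - 1) - \<phi> (x 0) * g n)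
    + mu * real (k + 1) * real (x (k + 1)) * (\<phi> (x 0) * (g (n + 1) - g n))" .
  have srv: "of_bool (served j x) * (lam * real N) * (?f (move j (j + 1) x) - ?f x) =
      (if j = k then of_bool (served k x) * (lam * real N) * (\<phi> (x 0) * (g (n - 1) - g n)) else 0)"
    if j: "j \<in> {1..d - 1}" for j
  proof (cases "served j x")
    case True
    moreover have "Suc j \<le> d" using j k by auto
    ultimately have "low_count d k (move j (j + 1) x) = n - of_bool (j = k)"
      using lc[of j "j + 1"] j by (cases "j < k") (auto simp: served_def)
    moreover have "move j (j + 1) x 0 = x 0" using j by (simp add: move_def)
    ultimately show ?thesis using True by (auto simp: n_def algebra_simps)
  qed auto
  have "(\<Sum>j=1..d-1. of_bool (served j x) * (lam * real N) * (?f (move j (j + 1) x) - ?f x)) =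
     of_bool (served k x) * (lam * real N) * (\<phi> (x 0) * (g (n - 1) - g n))"
    using k by (subst sum.cong[OF refl srv]) auto
  then show ?thesis unfolding generator_jump_rate[OF x] loss by simp
qed

section \<open>Moment bounds uniform in time\<close>

lemma linear_le_excess:
  fixes r :: real
  assumes "1 < r"
  shows "(r - 1) * real n \<le> excess r 0 n"
proof -
  have "1 + real n * (r - 1) \<le> (1 + (r - 1)) ^ n"
    using assms by (intro Bernoulli_inequality) auto
  then show ?thesis by (simp add: excess_def mult.commute)
qed

text \<open>Bernoulli's inequality for \<open>sqrt r\<close>, squared; the nonnegative cross term is
  dropped.\<close>

lemma square_le_excess:
  fixes r :: real
  assumes "1 < r"
  shows "(sqrt r - 1)\<^sup>2 * (real n)\<^sup>2 \<le> excess r 0 n"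
proof -
  have s: "0 \<le> sqrt r - 1" using assms by simp
  have "1 + real n * (sqrt r - 1) \<le> (1 + (sqrt r - 1)) ^ n"
    using s by (intro Bernoulli_inequality) auto
  then have "(1 + real n * (sqrt r - 1))\<^sup>2 \<le> (sqrt r ^ n)\<^sup>2"
    using s by (intro power_mono) auto
  also have "(sqrt r ^ n)\<^sup>2 = r ^ n"
    using assms by (simp add: power_mult[symmetric] mult.commute[of n]) (simp add: power_mult)
  finally have "(1 + real n * (sqrt r - 1))\<^sup>2 \<le> r ^ n" .
  moreover have "(1 + real n * (sqrt r - 1))\<^sup>2
      = 1 + 2 * (real n * (sqrt r - 1)) + (sqrt r - 1)\<^sup>2 * (real n)\<^sup>2"
    by (simp add: power2_sum power_mult_distrib)
  moreover have "0 \<le> real n * (sqrt r - 1)" using s by simp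
  ultimately show ?thesis by (simp add: excess_def)
qed

text \<open>For \<open>n \<ge> 2\<close> the truncation at 1 is a shift,
  \<open>excess r 1 n = r * excess r 0 (n - 1)\<close>, and the factor 1/2 pays for
  \<open>n \<le> 2 * (n - 1)\<close>.\<close>

lemma linear_le_excess_1:
  fixes r :: real
  assumes "1 < r" "2 \<le> n"
  shows "(r - 1) / 2 * real n \<le> excess r 1 n"
proof -
  obtain k where k: "n = Suc k" "1 \<le> k" using assms by (cases n) auto
  have "(r - 1) / 2 * real n \<le> (r - 1) * real k"
  proof -
    have "(r - 1) * (real n / 2) \<le> (r - 1) * real k"
      using k assms by (intro mult_left_mono) auto
    then show ?thesis by simp
  qed
  also have "\<dots> \<le> excess r 0 k" by (rule linear_le_excess[OF assms(1)])
  also have "\<dots> \<le> r * excess r 0 k"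
    using excess_nonneg[of r 0 k] assms by (simp add: mult_le_cancel_right1)
  also have "\<dots> = excess r 1 n"
    using k by (simp add: excess_def max_def algebra_simps)
  finally show ?thesis .
qed

text \<open>\<open>m N t\<close> is the law at time \<open>t\<close> of the process with index \<open>N\<close>.\<close>

locale duplication_loss =
  fixes lam mu r L :: real and d N0 :: nat and F :: "nat \<Rightarrow> nat"
    and m :: "nat \<Rightarrow> real \<Rightarrow> (nat \<Rightarrow> nat) \<Rightarrow> real"
  assumes lam: "0 < lam" and mu: "0 < mu" and d: "2 \<le> d" and N0: "1 \<le> N0"
    and r: "1 < r" and L: "r * L < lam"
    and load: "\<And>N. N0 \<le> N \<Longrightarrow> mu * real d * real (F N) \<le> L * real N"
    and m_nonneg: "\<And>N t y. N0 \<le> N \<Longrightarrow> 0 \<le> t \<Longrightarrow> y \<in> states d (F N) \<Longrightarrow> 0 \<le> m N t y"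
    and m_0: "\<And>N y. N0 \<le> N \<Longrightarrow> y \<in> states d (F N) \<Longrightarrow>
      m N 0 y = of_bool (y = initial_state d (F N))"
    and m_deriv: "\<And>N t y. N0 \<le> N \<Longrightarrow> 0 \<le> t \<Longrightarrow> y \<in> states d (F N) \<Longrightarrow>
      ((\<lambda>s. m N s y) has_real_derivative
        (\<Sum>z\<in>states d (F N). m N t z * jump_rate lam mu d N z y)
        - m N t y * (\<Sum>z\<in>states d (F N). jump_rate lam mu d N y z)) (at t within {0..})"
begin

section \<open>Expectations and orders of magnitude uniform in time\<close>

abbreviation "S N \<equiv> states d (F N)"
abbreviation "gen N \<equiv> generator (S N) (jump_rate lam mu d N)"

definition mean :: "nat \<Rightarrow> real \<Rightarrow> ((nat \<Rightarrow> nat) \<Rightarrow> real) \<Rightarrow> real" where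
  "mean N t f = (\<Sum>y\<in>S N. m N t y * f y)"

text \<open>An upper bound only: absolute values are put inside \<open>R\<close> where a two-sided
  estimate is meant. The exponent is real because half powers of \<open>N\<close> occur.\<close>

definition mean_bigo :: "(nat \<Rightarrow> (nat \<Rightarrow> nat) \<Rightarrow> real) \<Rightarrow> real \<Rightarrow> bool" where
  "mean_bigo R e \<longleftrightarrow> (\<exists>C\<ge>0. \<forall>N\<ge>N0. \<forall>t\<ge>0. mean N t (R N) \<le> C * real N powr e)"

lemma N_pos: "N0 \<le> N \<Longrightarrow> 0 < real N" using N0 by simp

lemma L_less: "L < lam"
proof (cases "L \<le> 0")
  case False
  then have "L < r * L" using r by (simp add: mult_less_cancel_right1)
  then show ?thesis using L by simp
qed (use lam in auto)

lemma L_nonneg: "0 \<le> L"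
proof -
  have "0 \<le> mu * real d * real (F N0)" using mu by simp
  also have "\<dots> \<le> L * real N0" by (rule load) simp
  finally show ?thesis using N0 by (simp add: zero_le_mult_iff)
qed

lemma mean_mono: 
  "N0 \<le> N \<Longrightarrow> 0 \<le> t \<Longrightarrow> (\<And>x. x \<in> S N \<Longrightarrow> f x \<le> g x) \<Longrightarrow> mean N t f \<le> mean N t g"
  unfolding mean_def by (intro sum_mono mult_left_mono m_nonneg)

lemma mean_cong: "(\<And>x. x \<in> S N \<Longrightarrow> f x = g x) \<Longrightarrow> mean N t f = mean N t g"
  unfolding mean_def by (intro sum.cong) auto

lemma mean_add: "mean N t (\<lambda>x. f x + g x) = mean N t f + mean N t g"
  by (simp add: mean_def sum.distrib algebra_simps)

lemma mean_diff: "mean N t (\<lambda>x. f x - g x) = mean N t f - mean N t g"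
  by (simp add: mean_def sum_subtractf algebra_simps)

lemma mean_cmult: "mean N t (\<lambda>x. c * f x) = c * mean N t f"
  by (simp add: mean_def sum_distrib_left mult_ac)

lemma mean_0: "N0 \<le> N \<Longrightarrow> mean N 0 f = f (initial_state d (F N))"
proof -
  assume N: "N0 \<le> N"
  have "mean N 0 f = (\<Sum>y\<in>S N. if y = initial_state d (F N) then f y else 0)"
    unfolding mean_def using m_0[OF N] by (intro sum.cong) auto
  then show ?thesis by (simp add: finite_states initial_state_in_states)
qed

lemma mean_deriv:
  "N0 \<le> N \<Longrightarrow> 0 \<le> t \<Longrightarrow>
    ((\<lambda>s. mean N s f) has_real_derivative mean N t (gen N f)) (at t within {0..})"
  unfolding mean_def by (intro forward_equation_expectation finite_states m_deriv)

text \<open>Conservation of mass: the generator kills constants, and the monotonicity argument is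
  applied to \<open>c\<close> and to \<open>- c\<close>.\<close>

lemma mean_const: 
  assumes N: "N0 \<le> N" and t: "0 \<le> t"
  shows "mean N t (\<lambda>_. c) = c"
proof -
  have gen: "mean N s (gen N (\<lambda>_. a)) = 0" for s a by (simp add: generator_def mean_def)
  have le: "mean N t (\<lambda>_. a) \<le> a" for a
    using nonpos_deriv_imp_le[OF mean_deriv[OF N, of _ "\<lambda>_. a"] _ t]
    by (simp add: gen mean_0[OF N])
  have "mean N t (\<lambda>_. - c) = - mean N t (\<lambda>_. c)" by (simp add: mean_def sum_negf)
  with le[of c] le[of "-c"] show ?thesis by simp
qed

lemma mean_bigo_mono:
  assumes "mean_bigo R e" "0 \<le> C" "\<And>N x. N0 \<le> N \<Longrightarrow> x \<in> S N \<Longrightarrow> R' N x \<le> C * R N x"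
  shows "mean_bigo R' e"
proof -
  obtain B where B: "0 \<le> B" "\<And>N t. N0 \<le> N \<Longrightarrow> 0 \<le> t \<Longrightarrow> mean N t (R N) \<le> B * real N powr e"
    using assms(1) unfolding mean_bigo_def by auto
  have "mean N t (R' N) \<le> (C * B) * real N powr e" if "N0 \<le> N" "0 \<le> t" for N t
  proof -
    have "mean N t (R' N) \<le> mean N t (\<lambda>x. C * R N x)" using that assms(3) by (intro mean_mono) auto
    also have "\<dots> \<le> C * (B * real N powr e)"
      unfolding mean_cmult using B(2)[OF that] assms(2) by (rule mult_left_mono)
    finally show ?thesis by simp
  qed
  then show ?thesis unfolding mean_bigo_def using assms(2) B(1) by (intro exI[of _ "C * B"]) auto
qed

lemma mean_bigo_add:
  assumes "mean_bigo R e" "mean_bigo R' e"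
  shows "mean_bigo (\<lambda>N x. R N x + R' N x) e"
proof -
  obtain B where B: "0 \<le> B" "\<And>N t. N0 \<le> N \<Longrightarrow> 0 \<le> t \<Longrightarrow> mean N t (R N) \<le> B * real N powr e"
    using assms(1) unfolding mean_bigo_def by auto
  obtain B' where B': "0 \<le> B'" "\<And>N t. N0 \<le> N \<Longrightarrow> 0 \<le> t \<Longrightarrow> mean N t (R' N) \<le> B' * real N powr e"
    using assms(2) unfolding mean_bigo_def by auto
  show ?thesis unfolding mean_bigo_def
    using B B' by (intro exI[of _ "B + B'"]) (auto simp: mean_add distrib_right intro!: add_mono)
qed

lemma mean_bigo_weaken: 
  assumes "mean_bigo R e" "e \<le> e'"
  shows "mean_bigo R e'"
proof -
  obtain B where B: "0 \<le> B" "\<And>N t. N0 \<le> N \<Longrightarrow> 0 \<le> t \<Longrightarrow> mean N t (R N) \<le> B * real N powr e"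
    using assms(1) unfolding mean_bigo_def by auto
  have "mean N t (R N) \<le> B * real N powr e'" if "N0 \<le> N" "0 \<le> t" for N t
    using B(2)[OF that] mult_left_mono[OF powr_mono[OF assms(2), of "real N"] B(1)] N_pos[OF that(1)]
    by (auto simp: Suc_le_eq)
  then show ?thesis unfolding mean_bigo_def using B(1) by auto
qed

lemma mean_bigo_scale: 
  assumes "mean_bigo R e" "e + a = e'"
  shows "mean_bigo (\<lambda>N x. real N powr a * R N x) e'"
proof -
  obtain B where B: "0 \<le> B" "\<And>N t. N0 \<le> N \<Longrightarrow> 0 \<le> t \<Longrightarrow> mean N t (R N) \<le> B * real N powr e"
    using assms(1) unfolding mean_bigo_def by auto
  have "mean N t (\<lambda>x. real N powr a * R N x) \<le> B * real N powr e'" if "N0 \<le> N" "0 \<le> t" for N t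
    using mult_left_mono[OF B(2)[OF that], of "real N powr a"]
    unfolding mean_cmult by (simp add: assms(2)[symmetric] powr_add mult_ac)
  then show ?thesis unfolding mean_bigo_def using B(1) by auto
qed

lemma mean_bigo_const: "mean_bigo (\<lambda>N x. c) 0"
  unfolding mean_bigo_def using N0 by (intro exI[of _ "\<bar>c\<bar>"]) (auto simp: mean_const)

text \<open>Relaxation at rate \<open>\<kappa> * real N\<close> divides the source by one power of
  \<open>N\<close>. The initial value lies below the resulting equilibrium, so there is no transient
  and one constant serves all times.\<close>

lemma mean_bigo_lyapunov:
  assumes R: "mean_bigo R e" and \<kappa>: "0 < \<kappa>"
    and gen: "\<And>N x. N0 \<le> N \<Longrightarrow> x \<in> S N \<Longrightarrow> gen N (V N) x \<le> - (\<kappa> * real N) * V N x + R N x"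
    and init: "\<And>N. N0 \<le> N \<Longrightarrow> V N (initial_state d (F N)) \<le> 0"
  shows "mean_bigo V (e - 1)"
proof -
  obtain B where B: "0 \<le> B" "\<And>N t. N0 \<le> N \<Longrightarrow> 0 \<le> t \<Longrightarrow> mean N t (R N) \<le> B * real N powr e"
    using R unfolding mean_bigo_def by auto
  have "mean N t (V N) \<le> (B / \<kappa>) * real N powr (e - 1)" if N: "N0 \<le> N" and t: "0 \<le> t" for N t
  proof -
    have "mean N t (V N) \<le> (B * real N powr e) / (\<kappa> * real N)"
    proof (rule linear_decay_bound[OF mean_deriv[OF N]])
      fix s :: real assume s: "0 \<le> s"
      have "mean N s (gen N (V N)) \<le> mean N s (\<lambda>x. (- (\<kappa> * real N)) * V N x + R N x)"
        using N s gen by (intro mean_mono) auto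
      also have "\<dots> = - (\<kappa> * real N) * mean N s (V N) + mean N s (R N)"
        by (simp only: mean_add mean_cmult)
      finally show "mean N s (gen N (V N)) \<le> B * real N powr e - \<kappa> * real N * mean N s (V N)"
        using B(2)[OF N s] by simp
    next
      have "0 \<le> B * real N powr e / (\<kappa> * real N)" using B(1) \<kappa> by simp
      then show "mean N 0 (V N) \<le> B * real N powr e / (\<kappa> * real N)"
        using init[OF N] by (simp add: mean_0[OF N])
    qed (use N_pos[OF N] \<kappa> t in auto)
    then show ?thesis using N_pos[OF N] by (simp add: powr_diff)
  qed
  then show ?thesis unfolding mean_bigo_def using B(1) \<kappa> by (intro exI[of _ "B / \<kappa>"]) auto
qed

section \<open>Occupation of the levels\<close>

definition \<kappa> :: real where "\<kappa> = (r - 1) * (lam / r - L)"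

lemma \<kappa>: "0 < \<kappa>"
proof -
  have "L < lam / r" using L r by (simp add: field_simps)
  then show ?thesis using r by (simp add: \<kappa>_def)
qed

lemma gen_excess:
  assumes "N0 \<le> N" "x \<in> S N" "1 \<le> k" "k < d"
  shows "gen N (\<lambda>x. excess r i (deficit d k x)) x \<le> - (\<kappa> * real N) * excess r i (deficit d k x)
      + (if deficit d k x = i then r ^ i * (r - 1) * (mu * real d) * (real i + real (x (k + 1))) else 0)"
  using generator_excess[OF assms(2,3,4) r lam, of mu L N i] mu L load[OF assms(1)]
  by (simp add: \<kappa>_def)

lemma deficit_initial: "k < d \<Longrightarrow> deficit d k (initial_state d (F N)) = 0"
  unfolding deficit_def linear_form_def initial_state_def by (intro sum.neutral) auto

lemma low_count_initial: "k < d \<Longrightarrow> low_count d k (initial_state d (F N)) = 0"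
  using low_count_le_deficit[of d k] deficit_initial[of k] by (metis le_zero_eq)

lemma le_excess_0: "real n \<le> 1 / (r - 1) * excess r 0 n"
  using linear_le_excess[OF r, of n] r by (simp add: field_simps)

text \<open>Induction from the top level downwards. The deficit up to level \<open>d - 1\<close> is
  fed by losses from level \<open>d\<close>, at a rate of order \<open>N\<close>, and so stays of
  order one. The deficit up to a lower level \<open>k\<close> leaves zero only by a loss from level
  \<open>k + 1\<close>, whose occupation is already bounded, and each such step gains a factor
  \<open>1 / N\<close>.\<close>

lemma mean_excess_0_aux:
  "j \<le> d - 2 \<Longrightarrow> mean_bigo (\<lambda>N x. excess r 0 (deficit d (d - 1 - j) x)) (- real j)"
proof (induction j)
  case 0
  have "mean_bigo (\<lambda>N x. excess r 0 (deficit d (d - 1) x)) (1 - 1)"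
  proof (rule mean_bigo_lyapunov[OF _ \<kappa>])
    show "mean_bigo (\<lambda>N x. real N powr 1 * ((r - 1) * L)) 1"
      by (rule mean_bigo_scale[OF mean_bigo_const]) simp
  next
    fix N x assume N: "N0 \<le> N" and x: "x \<in> S N"
    have "x d \<le> F N" using states_total[OF x d] by simp
    then have "mu * real d * real (x d) \<le> mu * real d * real (F N)" using mu by (intro mult_left_mono) auto
    also have "\<dots> \<le> L * real N" by (rule load[OF N])
    finally have *: "(r - 1) * (mu * real d * real (x d)) \<le> (r - 1) * (L * real N)"
      using r by (intro mult_left_mono) auto
    show "gen N (\<lambda>x. excess r 0 (deficit d (d - 1) x)) x
      \<le> - (\<kappa> * real N) * excess r 0 (deficit d (d - 1) x) + real N powr 1 * ((r - 1) * L)"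
    proof -
      have k: "d - 1 + 1 = d" "1 \<le> d - 1" "d - 1 < d" using d by auto
      have "0 \<le> (r - 1) * (L * real N)" using r L_nonneg by simp
      with gen_excess[OF N x k(2,3), of 0] * show ?thesis
        unfolding k(1) by (auto simp: mult_ac split: if_splits)
    qed
  qed (use d in \<open>simp add: deficit_initial excess_eq_0\<close>)
  then show ?case by simp
next
  case (Suc j)
  define k where "k = d - 1 - Suc j"
  have k: "1 \<le> k" "k < d" "d - 1 - j = Suc k" using Suc.prems d by (auto simp: k_def)
  have "mean_bigo (\<lambda>N x. excess r 0 (deficit d k x)) (- real j - 1)"
  proof (rule mean_bigo_lyapunov[OF _ \<kappa>])
    show "mean_bigo (\<lambda>N x. (r - 1) * (mu * real d) * (1 / (r - 1) * excess r 0 (deficit d (Suc k) x))) (- real j)"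
      by (rule mean_bigo_mono[where C = "mu * real d" and R = "\<lambda>N x. excess r 0 (deficit d (Suc k) x)"])
        (use Suc.IH Suc.prems k(3) r mu in \<open>auto simp: excess_nonneg\<close>)
  next
    fix N x assume N: "N0 \<le> N" and x: "x \<in> S N"
    have "real (x (k + 1)) \<le> real (deficit d (Suc k) x)"
      using le_deficit[of "k + 1" "Suc k" d x] k by auto
    also have "\<dots> \<le> 1 / (r - 1) * excess r 0 (deficit d (Suc k) x)" by (rule le_excess_0)
    finally have "(r - 1) * (mu * real d) * real (x (k + 1))
      \<le> (r - 1) * (mu * real d) * (1 / (r - 1) * excess r 0 (deficit d (Suc k) x))"
      using r mu by (intro mult_left_mono) auto
    moreover have "0 \<le> (r - 1) * (mu * real d) * (1 / (r - 1) * excess r 0 (deficit d (Suc k) x))"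
      using r mu by (simp add: excess_nonneg)
    ultimately show "gen N (\<lambda>x. excess r 0 (deficit d k x)) x
      \<le> - (\<kappa> * real N) * excess r 0 (deficit d k x)
        + (r - 1) * (mu * real d) * (1 / (r - 1) * excess r 0 (deficit d (Suc k) x))"
      using gen_excess[OF N x, of k 0] k by (auto split: if_splits)
  qed (use k in \<open>simp add: deficit_initial excess_eq_0\<close>)
  moreover have "- real j - 1 = - real (Suc j)" by simp
  ultimately show ?case by (simp only: k_def)
qed

lemma mean_excess_0:
  assumes "1 \<le> k" "k < d"
  shows "mean_bigo (\<lambda>N x. excess r 0 (deficit d k x)) (- real (d - 1 - k))"
  using mean_excess_0_aux[of "d - 1 - k"] assms by simp

lemma mean_deficit:
  assumes "1 \<le> k" "k < d"
  shows "mean_bigo (\<lambda>N x. real (deficit d k x)) (- real (d - 1 - k))"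
  using le_excess_0 r
  by (intro mean_bigo_mono[OF mean_excess_0[OF assms], where C = "1 / (r - 1)"]) auto

lemma mean_deficit_square: "mean_bigo (\<lambda>N x. (real (deficit d (d - 1) x))\<^sup>2) 0"
proof -
  have s: "0 < (sqrt r - 1)\<^sup>2" using r by simp
  have "mean_bigo (\<lambda>N x. excess r 0 (deficit d (d - 1) x)) 0"
    using mean_excess_0[of "d - 1"] d by simp
  then show ?thesis
  proof (rule mean_bigo_mono)
    fix x :: "nat \<Rightarrow> nat"
    show "(real (deficit d (d - 1) x))\<^sup>2 \<le> 1 / (sqrt r - 1)\<^sup>2 * excess r 0 (deficit d (d - 1) x)"
      using square_le_excess[OF r, of "deficit d (d - 1) x"] s
      by (simp add: pos_le_divide_eq mult.commute)
  qed simp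
qed

text \<open>A quantity bounded in mean square meets an event of probability of order at most
  \<open>1 / N\<close>. The splitting \<open>w \<le> w^2 / s + s\<close> with
  \<open>s = sqrt N\<close> gives the order that Cauchy-Schwarz would give.\<close>

lemma mean_deficit_indicator:
  "mean_bigo (\<lambda>N x. real (deficit d (d - 1) x) * of_bool (0 < low_count d (d - 2) x)) (- 1 / 2)"
proof (cases "d = 2")
  case True
  \<comment> \<open>For \<open>d = 2\<close> there is no level strictly between 0 and
    \<open>d - 1\<close>, so the indicator is identically zero.\<close>
  have "mean_bigo (\<lambda>N x. 0) (- 1 / 2)"
    unfolding mean_bigo_def mean_def by (intro exI[of _ 0]) simp
  then show ?thesis using True by simp
next
  case False
  with d have k: "1 \<le> d - 2" "d - 2 < d" "d - 1 - (d - 2) = 1" by auto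
  have A: "mean_bigo (\<lambda>N x. real N powr (- 1 / 2) * (real (deficit d (d - 1) x))\<^sup>2) (- 1 / 2)"
    by (rule mean_bigo_scale[OF mean_deficit_square]) simp
  have B: "mean_bigo (\<lambda>N x. real N powr (1 / 2) * real (deficit d (d - 2) x)) (- 1 / 2)"
    by (rule mean_bigo_scale[where e = "-1"]) (use mean_deficit[OF k(1,2)] k(3) in auto)
  show ?thesis
  proof (rule mean_bigo_mono[OF mean_bigo_add[OF A B], where C = 1])
    fix N and x :: "nat \<Rightarrow> nat" assume N: "N0 \<le> N"
    define w s where "w = real (deficit d (d - 1) x)" and "s = real N powr (1 / 2)"
    have s: "0 < s" "real N powr (- 1 / 2) = 1 / s"
      using N_pos[OF N] by (simp_all add: s_def powr_minus_divide)
    have "w * of_bool (0 < low_count d (d - 2) x) \<le> 1 / s * w\<^sup>2 + s * real (deficit d (d - 2) x)"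
    proof (cases "0 < low_count d (d - 2) x")
      case True
      then have "1 \<le> real (deficit d (d - 2) x)" using low_count_le_deficit[of d "d - 2" x] by simp
      then have "s * 1 \<le> s * real (deficit d (d - 2) x)" using s(1) by (intro mult_left_mono) auto
      moreover have "w \<le> 1 / s * w\<^sup>2 + s"
      proof (cases "w \<le> s")
        case False
        then have "w * s \<le> w * w" using s by (intro mult_left_mono) auto
        then show ?thesis using s by (simp add: field_simps power2_eq_square)
          (smt (verit) mult_nonneg_nonneg)
      qed (use s in \<open>auto intro: add_increasing\<close>)
      ultimately show ?thesis using True by simp
    qed (use s in auto)
    then show "real (deficit d (d - 1) x) * of_bool (0 < low_count d (d - 2) x)
      \<le> 1 * (real N powr (- 1 / 2) * (real (deficit d (d - 1) x))\<^sup>2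
         + real N powr (1 / 2) * real (deficit d (d - 2) x))"
      unfolding s(2) by (simp add: w_def s_def)
  qed simp
qed

text \<open>With threshold 1 the source requires deficit one: a single file on level
  \<open>k\<close> and nothing on the positive levels below. For \<open>k = d - 2\<close> the files
  then waiting on level \<open>d - 1\<close> are of order \<open>N^(-1/2)\<close> in mean by the
  indicator bound. For smaller \<open>k\<close>, a file on level \<open>k + 1\<close> makes the
  deficit up to that level at least 2, so the induction hypothesis controls it. The half power
  gained at the start survives every step.\<close>

lemma mean_excess_1_aux:
  "j + 3 \<le> d \<Longrightarrow> mean_bigo (\<lambda>N x. excess r 1 (deficit d (d - 2 - j) x)) (- real (j + 1) - 1 / 2)"
proof (induction j)
  case 0
  define k where "k = d - 2"
  have k: "1 \<le> k" "k < d" "k + 1 = d - 1" "d - 1 - k = 1" using 0 by (auto simp: k_def)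
  let ?R = "\<lambda>N x. real (deficit d k x) + real (deficit d (d - 1) x) * of_bool (0 < low_count d (d - 2) x)"
  have R: "mean_bigo ?R (- 1 / 2)"
    using mean_bigo_weaken[OF mean_deficit[OF k(1,2)], of "- 1 / 2"] k(4)
    by (intro mean_bigo_add[OF _ mean_deficit_indicator]) auto
  have "mean_bigo (\<lambda>N x. excess r 1 (deficit d k x)) (- 1 / 2 - 1)"
  proof (rule mean_bigo_lyapunov[OF _ \<kappa>])
    show "mean_bigo (\<lambda>N x. r * (r - 1) * (mu * real d) * ?R N x) (- 1 / 2)"
      by (rule mean_bigo_mono[OF R, where C = "r * (r - 1) * (mu * real d)"]) (use r mu in auto)
  next
    fix N x assume N: "N0 \<le> N" and x: "x \<in> S N"
    have c: "0 \<le> r * (r - 1) * (mu * real d)" using r mu by simp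
    have "(if deficit d k x = 1 then 1 + real (x (k + 1)) else 0) \<le> ?R N x"
      using deficit_pos_low_count[of d k x] le_deficit[of "d - 1" "d - 1" d x] k by (auto simp: k_def)
    from mult_left_mono[OF this c]
    show "gen N (\<lambda>x. excess r 1 (deficit d k x)) x
      \<le> - (\<kappa> * real N) * excess r 1 (deficit d k x) + r * (r - 1) * (mu * real d) * ?R N x"
      using gen_excess[OF N x, of k 1] k by (auto split: if_splits)
  qed (use k in \<open>simp add: deficit_initial excess_eq_0\<close>)
  then show ?case by (simp add: k_def)
next
  case (Suc j)
  define k where "k = d - 2 - Suc j"
  have k: "1 \<le> k" "k < d" "d - 2 - j = Suc k" "d - 1 - k = j + 2" using Suc.prems by (auto simp: k_def)
  let ?R = "\<lambda>N x. real (deficit d k x) + 2 / (r - 1) * excess r 1 (deficit d (Suc k) x)"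
  have ex: "mean_bigo (\<lambda>N x. 2 / (r - 1) * excess r 1 (deficit d (Suc k) x)) (- real (j + 1) - 1 / 2)"
    by (rule mean_bigo_mono[where C = "2 / (r - 1)" and R = "\<lambda>N x. excess r 1 (deficit d (Suc k) x)"])
      (use Suc.IH Suc.prems k(3) r in auto)
  have R: "mean_bigo ?R (- real (j + 1) - 1 / 2)"
    using mean_bigo_weaken[OF mean_deficit[OF k(1,2)], of "- real (j + 1) - 1 / 2"] k(4)
    by (intro mean_bigo_add[OF _ ex]) auto
  have "mean_bigo (\<lambda>N x. excess r 1 (deficit d k x)) (- real (j + 1) - 1 / 2 - 1)"
  proof (rule mean_bigo_lyapunov[OF _ \<kappa>])
    show "mean_bigo (\<lambda>N x. r * (r - 1) * (mu * real d) * ?R N x) (- real (j + 1) - 1 / 2)"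
      by (rule mean_bigo_mono[OF R, where C = "r * (r - 1) * (mu * real d)"]) (use r mu in auto)
  next
    fix N x assume N: "N0 \<le> N" and x: "x \<in> S N"
    have c: "0 \<le> r * (r - 1) * (mu * real d)" using r mu by simp
    have nonneg: "0 \<le> 2 / (r - 1) * excess r 1 (deficit d (Suc k) x)"
      using r by (simp add: excess_nonneg)
    have "real (x (k + 1)) \<le> 2 / (r - 1) * excess r 1 (deficit d (Suc k) x)" if "deficit d k x = 1"
    proof (cases "x (k + 1) = 0")
      case False
      have "x (Suc k) \<le> low_count d (Suc k) x" using le_low_count[of "Suc k" "Suc k" d x] k by auto
      then have n: "2 \<le> deficit d (Suc k) x" "x (Suc k) \<le> deficit d (Suc k) x"
        using deficit_Suc[of k d x] that False k by auto
      then have "real (x (k + 1)) \<le> real (deficit d (Suc k) x)" by simp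
      also have "\<dots> \<le> 2 / (r - 1) * excess r 1 (deficit d (Suc k) x)"
        using linear_le_excess_1[OF r n(1)] r by (simp add: field_simps)
      finally show ?thesis .
    qed (use nonneg in simp)
    with nonneg have "(if deficit d k x = 1 then 1 + real (x (k + 1)) else 0) \<le> ?R N x" by auto
    from mult_left_mono[OF this c]
    show "gen N (\<lambda>x. excess r 1 (deficit d k x)) x
      \<le> - (\<kappa> * real N) * excess r 1 (deficit d k x) + r * (r - 1) * (mu * real d) * ?R N x"
      using gen_excess[OF N x, of k 1] k by (auto split: if_splits)
  qed (use k in \<open>simp add: deficit_initial excess_eq_0\<close>)
  moreover have "- real (j + 1) - 1 / 2 - 1 = - real (Suc j + 1) - 1 / 2" by simp
  ultimately show ?case by (simp only: k_def)
qed

text \<open>If the difference is positive, level \<open>k\<close> holds two files or a positive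
  level below it is occupied. In both cases the deficit is at least 2, where
  \<open>excess r 1\<close> dominates it up to a constant.\<close>

lemma mean_idle:
  assumes "1 \<le> k" "k + 2 \<le> d"
  shows "mean_bigo (\<lambda>N x. real (x k) - of_bool (served k x)) (- real (d - 1 - k) - 1 / 2)"
proof -
  have "mean_bigo (\<lambda>N x. excess r 1 (deficit d k x)) (- real (d - 1 - k) - 1 / 2)"
    using mean_excess_1_aux[of "d - 2 - k"] assms by (simp add: Suc_diff_Suc numeral_2_eq_2)
  then show ?thesis
  proof (rule mean_bigo_mono[where C = "2 / (r - 1)"])
    fix x :: "nat \<Rightarrow> nat"
    have nonneg: "0 \<le> 2 / (r - 1) * excess r 1 (deficit d k x)" using r by (simp add: excess_nonneg)
    show "real (x k) - of_bool (served k x) \<le> 2 / (r - 1) * excess r 1 (deficit d k x)"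
    proof (cases "real (x k) - of_bool (served k x) \<le> 0")
      case False
      have "2 \<le> deficit d k x"
      proof (cases "served k x")
        case True
        then have "2 \<le> x k" using False by (simp add: served_def)
        then show ?thesis using le_deficit[of k k d x] assms by auto
      next
        case False': False
        then obtain i where i: "1 \<le> i" "i < k" "0 < x i" using False by (auto simp: served_def)
        have "(k + 1 - i) * x i \<le> deficit d k x"
          using weighted_le_linear_form[of i d "\<lambda>i. if i = 0 then 0 else k + 1 - i" x] i assms
          unfolding deficit_def by auto
        moreover have "2 * 1 \<le> (k + 1 - i) * x i" using i by (intro mult_le_mono) auto
        ultimately show ?thesis by simp
      qed
      from linear_le_excess_1[OF r this]
      have "real (deficit d k x) \<le> 2 / (r - 1) * excess r 1 (deficit d k x)"
        using r by (simp add: field_simps)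
      moreover have "x k \<le> deficit d k x" using le_deficit[of k k d x] assms by auto
      ultimately show ?thesis by (simp add: of_bool_def split: if_splits)
    qed (use nonneg in linarith)
  qed (use r in auto)
qed

end

section \<open>Averaging\<close>

lemma generator_add:
  "generator S q (\<lambda>x. f x + g x) x = generator S q f x + generator S q g x"
  by (simp add: generator_def sum.distrib[symmetric] algebra_simps)

lemma generator_cmult: "generator S q (\<lambda>x. c * f x) x = c * generator S q f x"
  by (simp add: generator_def sum_distrib_left algebra_simps)

context duplication_loss
begin

text \<open>The constant in \<open>mu N^(d-2) x_1 ~ coef k N^(d-1-k) x_k\<close>, read off the
  balance \<open>lam N x_k ~ mu (k+1) x_(k+1)\<close> between duplications out of level
  \<open>k\<close> and losses into it.\<close>

definition coef :: "nat \<Rightarrow> real" where "coef k = fact k * mu ^ k / lam ^ (k - 1)"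

lemma coef_1: "coef 1 = mu" by (simp add: coef_def)

lemma coef_Suc: "1 \<le> k \<Longrightarrow> coef (Suc k) = coef k * mu * real (Suc k) / lam"
  using lam by (cases k) (auto simp: coef_def field_simps)

lemma coef_pos: "0 < coef k" using lam mu by (simp add: coef_def)

text \<open>The loss rate out of level \<open>d\<close>, per unit of \<open>N\<close>, if all
  surviving files sat there. It depends on the slow variable \<open>x 0\<close> alone; the few files
  on levels \<open>1\<close> to \<open>d - 1\<close> are treated as an error in
  \<open>top_level_step\<close>.\<close>

definition inflow :: "nat \<Rightarrow> nat \<Rightarrow> real" where
  "inflow N n = mu * real d * (real (F N) - real n) / real N"

lemma inflow_le: "N0 \<le> N \<Longrightarrow> inflow N n \<le> L"
proof -
  assume N: "N0 \<le> N"
  have "mu * real d * (real (F N) - real n) \<le> mu * real d * real (F N)"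
    using mu by (intro mult_left_mono) auto
  also have "\<dots> \<le> L * real N" by (rule load[OF N])
  finally show ?thesis using N_pos[OF N] by (simp add: inflow_def field_simps)
qed

definition f0 :: real where "f0 = L / (mu * real d)"

lemma f0: "0 \<le> f0" "N0 \<le> N \<Longrightarrow> real (F N) \<le> f0 * real N"
  using load[of N] mu d L_nonneg by (auto simp: f0_def field_simps)

text \<open>Lipschitz in the fraction \<open>n / N\<close>: one lost file changes \<phi> by order
  \<open>1 / N\<close>, and multiplied by a low count of order at most \<open>N\<close> such a
  change stays bounded.\<close>

definition slowly_varying :: "(nat \<Rightarrow> nat \<Rightarrow> real) \<Rightarrow> real \<Rightarrow> bool" where
  "slowly_varying \<phi> A \<longleftrightarrow> (\<forall>N\<ge>N0. (\<forall>n\<le>F N. \<bar>\<phi> N n\<bar> \<le> A) \<and>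
     (\<forall>n<F N. \<bar>\<phi> N (Suc n) - \<phi> N n\<bar> \<le> A / real N))"

lemma slowly_varyingD:
  assumes "slowly_varying \<phi> A" "N0 \<le> N"
  shows "n \<le> F N \<Longrightarrow> \<bar>\<phi> N n\<bar> \<le> A" "n < F N \<Longrightarrow> \<bar>\<phi> N (Suc n) - \<phi> N n\<bar> \<le> A / real N" "0 \<le> A"
proof -
  show *: "n \<le> F N \<Longrightarrow> \<bar>\<phi> N n\<bar> \<le> A" for n using assms by (simp add: slowly_varying_def)
  show "n < F N \<Longrightarrow> \<bar>\<phi> N (Suc n) - \<phi> N n\<bar> \<le> A / real N" using assms by (simp add: slowly_varying_def)
  show "0 \<le> A" using *[of 0] by simp
qed

lemma states_bounds:
  assumes "x \<in> S N"
  shows "x 0 \<le> F N" "0 < x 1 \<Longrightarrow> x 0 < F N"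
proof -
  show "x 0 \<le> F N" using states_total[OF assms d] by simp
  show "x 0 < F N" if "0 < x 1"
  proof -
    have "x 1 \<le> low_count d (d - 1) x" using d by (intro le_low_count) auto
    then show ?thesis using states_total[OF assms d] that by linarith
  qed
qed

text \<open>The count up to level \<open>k\<close> gains by losses from level \<open>k + 1\<close>
  and is drained by duplications on level \<open>k\<close>. The two errors are the losses out of
  level 1, which change the weight and the count together, and the unserved part of
  \<open>x k\<close>.\<close>

lemma level_step:
  assumes \<phi>: "slowly_varying \<phi> A" and N: "N0 \<le> N" and x: "x \<in> S N" and k: "1 \<le> k" "k < d"
  shows "\<bar>gen N (\<lambda>x. \<phi> N (x 0) * real (low_count d k x)) x
      + lam * real N * (\<phi> N (x 0) * real (x k)) - mu * real (k + 1) * (\<phi> N (x 0) * real (x (k + 1)))\<bar>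
    \<le> A * mu * (1 + f0) * real (x 1) + lam * A * (real N * (real (x k) - of_bool (served k x)))"
proof -
  note \<phi>D = slowly_varyingD[OF \<phi> N]
  define Y where "Y = low_count d k x"
  define a where "a = mu * real (x 1) * (\<phi> N (x 0 + 1) * real (Y - 1) - \<phi> N (x 0) * real Y)"
  define b where "b = lam * real N * (\<phi> N (x 0) * (real (x k) - of_bool (served k x)))"
  have served: "of_bool (served k x) * (real (Y - 1) - real Y) = - (of_bool (served k x) :: real)"
    using le_low_count[of k k d x] k by (auto simp: served_def Y_def of_nat_diff)
  have gen: "gen N (\<lambda>x. \<phi> N (x 0) * real (low_count d k x)) x =
      a + mu * real (k + 1) * real (x (k + 1)) * (\<phi> N (x 0) * (real (Y + 1) - real Y))
      + lam * real N * \<phi> N (x 0) * (of_bool (served k x) * (real (Y - 1) - real Y))"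
    unfolding generator_low_count[OF x k, of lam mu N "\<phi> N" real] Y_def a_def by (simp add: mult_ac)
  have eq: "gen N (\<lambda>x. \<phi> N (x 0) * real (low_count d k x)) x
      + lam * real N * (\<phi> N (x 0) * real (x k)) - mu * real (k + 1) * (\<phi> N (x 0) * real (x (k + 1)))
     = a + b" unfolding gen served b_def by (simp add: algebra_simps)
  have "\<bar>a\<bar> \<le> mu * real (x 1) * (A * (1 + f0))"
  proof (cases "x 1 = 0")
    case False
    then have Y: "1 \<le> Y" using le_low_count[of 1 k d x] k by (simp add: Y_def)
    have "\<phi> N (x 0 + 1) * real (Y - 1) - \<phi> N (x 0) * real Y =
        (\<phi> N (Suc (x 0)) - \<phi> N (x 0)) * real (Y - 1) - \<phi> N (x 0)"
      using Y by (simp add: of_nat_diff algebra_simps)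
    also have "\<bar>\<dots>\<bar> \<le> A / real N * (f0 * real N) + A"
    proof -
      have "real (Y - 1) \<le> real (F N)"
        using low_count_le_total[OF x, of k] by (simp add: Y_def)
      also have "\<dots> \<le> f0 * real N" using f0(2)[OF N] .
      finally have "\<bar>(\<phi> N (Suc (x 0)) - \<phi> N (x 0)) * real (Y - 1)\<bar> \<le> A / real N * (f0 * real N)"
        unfolding abs_mult using \<phi>D(2)[of "x 0"] states_bounds[OF x] False \<phi>D(3) N_pos[OF N]
        by (intro mult_mono) auto
      moreover have "\<bar>\<phi> N (x 0)\<bar> \<le> A" using \<phi>D(1) states_bounds[OF x] by simp
      ultimately show ?thesis by linarith
    qed
    also have "\<dots> = A * (1 + f0)" using N_pos[OF N] by (simp add: algebra_simps)
    finally show ?thesis unfolding a_def abs_mult using mu by (simp add: mult_left_mono)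
  qed (simp add: a_def)
  moreover have "\<bar>b\<bar> \<le> lam * real N * (A * (real (x k) - of_bool (served k x)))"
  proof -
    have "0 \<le> real (x k) - of_bool (served k x)" by (auto simp: served_def Suc_le_eq)
    then show ?thesis
      unfolding b_def abs_mult using \<phi>D(1)[of "x 0"] states_bounds[OF x] lam
      by (simp add: mult_left_mono mult_right_mono)
  qed
  ultimately show ?thesis unfolding eq by (simp add: mult_ac)
qed

text \<open>Each level contributes a corrector that trades the occupation of level \<open>k\<close> for that of
  level \<open>k + 1\<close>, at the price of one power of \<open>N\<close>.\<close>

lemma corrector_chain:
  assumes \<phi>: "slowly_varying \<phi> A" and k: "1 \<le> k" "k < d"
  shows "\<exists>K. mean_bigo (\<lambda>N x. \<bar>gen N (K N) x + mu * real N ^ (d - 2) * (\<phi> N (x 0) * real (x 1))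
        - coef k * real N ^ (d - 1 - k) * (\<phi> N (x 0) * real (x k))\<bar>) (- 1 / 2)
    \<and> mean_bigo (\<lambda>N x. \<bar>K N x\<bar>) (- 1) \<and> (\<forall>N\<ge>N0. K N (initial_state d (F N)) = 0)"
  using k
proof (induction k rule: dec_induct)
  case base
  have "mean_bigo (\<lambda>N x. 0) e" for e unfolding mean_bigo_def mean_def by (intro exI[of _ 0]) simp
  moreover have "d - 1 - 1 = d - 2" by simp
  ultimately show ?case
    by (intro exI[of _ "\<lambda>N x. 0"]) (simp add: generator_def coef_1[simplified])
next
  case (step k)
  then obtain K where K1: "mean_bigo (\<lambda>N x. \<bar>gen N (K N) x + mu * real N ^ (d - 2) * (\<phi> N (x 0) * real (x 1))
        - coef k * real N ^ (d - 1 - k) * (\<phi> N (x 0) * real (x k))\<bar>) (- 1 / 2)"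
    and K2: "mean_bigo (\<lambda>N x. \<bar>K N x\<bar>) (- 1)" and K3: "\<And>N. N0 \<le> N \<Longrightarrow> K N (initial_state d (F N)) = 0"
    by auto
  have k: "1 \<le> k" "k < d" "k + 2 \<le> d" using step by auto
  have A: "0 \<le> A" using slowly_varyingD(3)[OF \<phi> order_refl] .
  \<comment> \<open>Chosen so that \<open>c N * lam * N\<close> is the coefficient of the current
    level-\<open>k\<close> term. The generator then leaves \<open>c N * mu * (k + 1)\<close>, the
    coefficient wanted on the next level.\<close>
  define c where "c N = coef k / lam * real N ^ (d - 2 - k)" for N
  define K' where "K' N x = K N x + c N * (\<phi> N (x 0) * real (low_count d k x))" for N x
  have c0: "0 \<le> c N" for N using coef_pos[of k] lam by (simp add: c_def)
  have powr: "real N ^ n = real N powr real n" if "N0 \<le> N" for N n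
    using N_pos[OF that] by (simp add: powr_realpow)
  \<comment> \<open>The factor \<open>c N\<close> has order \<open>N^(d-2-k)\<close>. Against it,
    \<open>x 1\<close> is of order \<open>N^(-(d-2))\<close> and the low count of order
    \<open>N^(-(d-1-k))\<close> at most. The unserved part, of order \<open>N^(-(d-1-k)-1/2)\<close>
    and carrying a further factor \<open>N\<close>, sets the final order
    \<open>N^(-1/2)\<close>.\<close>
  have E1: "mean_bigo (\<lambda>N x. c N * real (x 1)) (- 1 / 2)"
  proof (rule mean_bigo_mono)
    show "mean_bigo (\<lambda>N x. real N powr real (d - 2 - k) * real (deficit d 1 x)) (- 1 / 2)"
      by (rule mean_bigo_scale[where e = "- real (d - 2 - k) - 1 / 2"],
          rule mean_bigo_weaken[OF mean_deficit[of 1]]) (use k d in auto)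
    show "0 \<le> coef k / lam" using coef_pos[of k] lam by simp
    fix N and x :: "nat \<Rightarrow> nat" assume N: "N0 \<le> N"
    have "x 1 \<le> deficit d 1 x" using le_deficit[of 1 1 d x] d by simp
    then have "c N * real (x 1) \<le> c N * real (deficit d 1 x)"
      using c0[of N] by (intro mult_left_mono) auto
    then show "c N * real (x 1) \<le> coef k / lam * (real N powr real (d - 2 - k) * real (deficit d 1 x))"
      by (simp add: c_def powr[OF N, symmetric])
  qed
  have E2: "mean_bigo (\<lambda>N x. c N * (real N * (real (x k) - of_bool (served k x)))) (- 1 / 2)"
  proof (rule mean_bigo_mono)
    show "mean_bigo (\<lambda>N x. real N powr real (d - 1 - k) * (real (x k) - of_bool (served k x))) (- 1 / 2)"
      by (rule mean_bigo_scale[OF mean_idle[OF k(1,3)]]) simp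
    show "0 \<le> coef k / lam" using coef_pos[of k] lam by simp
    fix N and x :: "nat \<Rightarrow> nat" assume N: "N0 \<le> N"
    have e: "d - 1 - k = Suc (d - 2 - k)" using k by simp
    show "c N * (real N * (real (x k) - of_bool (served k x)))
      \<le> coef k / lam * (real N powr real (d - 1 - k) * (real (x k) - of_bool (served k x)))"
      unfolding c_def powr[OF N, symmetric] e by (simp add: mult_ac)
  qed
  have E3: "mean_bigo (\<lambda>N x. c N * real (low_count d k x)) (- 1)"
  proof (rule mean_bigo_mono)
    show "mean_bigo (\<lambda>N x. real N powr real (d - 2 - k) * real (deficit d k x)) (- 1)"
      by (rule mean_bigo_scale[OF mean_deficit[OF k(1,2)]]) (use k in auto)
    show "0 \<le> coef k / lam" using coef_pos[of k] lam by simp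
    fix N and x :: "nat \<Rightarrow> nat" assume N: "N0 \<le> N"
    have "c N * real (low_count d k x) \<le> c N * real (deficit d k x)"
      using c0[of N] low_count_le_deficit[of d k x] by (intro mult_left_mono) auto
    then show "c N * real (low_count d k x) \<le> coef k / lam * (real N powr real (d - 2 - k) * real (deficit d k x))"
      by (simp add: c_def powr[OF N, symmetric])
  qed
  have sum12: "mean_bigo (\<lambda>N x. A * mu * (1 + f0) * (c N * real (x 1))
       + lam * A * (c N * (real N * (real (x k) - of_bool (served k x))))) (- 1 / 2)"
    by (rule mean_bigo_add; rule mean_bigo_mono[OF E1 _ order_refl] mean_bigo_mono[OF E2 _ order_refl])
      (use A mu lam f0(1) in auto)
  show ?case
  proof (intro exI[of _ K'] conjI allI impI)
    show "mean_bigo (\<lambda>N x. \<bar>gen N (K' N) x + mu * real N ^ (d - 2) * (\<phi> N (x 0) * real (x 1))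
        - coef (Suc k) * real N ^ (d - 1 - Suc k) * (\<phi> N (x 0) * real (x (Suc k)))\<bar>) (- 1 / 2)"
    proof (rule mean_bigo_mono[OF mean_bigo_add[OF K1 sum12], of 1])
      fix N x assume N: "N0 \<le> N" and x: "x \<in> S N"
      define p where "p = gen N (K N) x + mu * real N ^ (d - 2) * (\<phi> N (x 0) * real (x 1))
        - coef k * real N ^ (d - 1 - k) * (\<phi> N (x 0) * real (x k))"
      define q where "q = gen N (\<lambda>x. \<phi> N (x 0) * real (low_count d k x)) x
      + lam * real N * (\<phi> N (x 0) * real (x k)) - mu * real (k + 1) * (\<phi> N (x 0) * real (x (k + 1)))"
      have gen': "gen N (K' N) x = gen N (K N) x + c N * gen N (\<lambda>x. \<phi> N (x 0) * real (low_count d k x)) x"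
        unfolding K'_def generator_add generator_cmult ..
      have e: "d - 1 - k = Suc (d - 2 - k)" "d - 1 - Suc k = d - 2 - k" using k by auto
      have c1: "coef (Suc k) * real N ^ (d - 1 - Suc k) = c N * (mu * real (k + 1))"
        unfolding coef_Suc[OF k(1)] e c_def by simp
      have c2: "coef k * real N ^ (d - 1 - k) = c N * (lam * real N)"
        unfolding e c_def using lam by simp
      have "gen N (K' N) x + mu * real N ^ (d - 2) * (\<phi> N (x 0) * real (x 1))
        - coef (Suc k) * real N ^ (d - 1 - Suc k) * (\<phi> N (x 0) * real (x (Suc k))) = p + c N * q"
        unfolding gen' p_def q_def c1 c2 by (simp add: algebra_simps)
      also have "\<bar>\<dots>\<bar> \<le> \<bar>p\<bar> + c N * \<bar>q\<bar>"
        using abs_triangle_ineq[of p "c N * q"] c0[of N] by (simp add: abs_mult)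
      also have "c N * \<bar>q\<bar> \<le> c N * (A * mu * (1 + f0) * real (x 1)
          + lam * A * (real N * (real (x k) - of_bool (served k x))))"
        using level_step[OF \<phi> N x k(1,2)] c0[of N] unfolding q_def by (rule mult_left_mono)
      finally show "\<bar>gen N (K' N) x + mu * real N ^ (d - 2) * (\<phi> N (x 0) * real (x 1))
        - coef (Suc k) * real N ^ (d - 1 - Suc k) * (\<phi> N (x 0) * real (x (Suc k)))\<bar>
       \<le> 1 * (\<bar>gen N (K N) x + mu * real N ^ (d - 2) * (\<phi> N (x 0) * real (x 1))
            - coef k * real N ^ (d - 1 - k) * (\<phi> N (x 0) * real (x k))\<bar>
          + (A * mu * (1 + f0) * (c N * real (x 1))
            + lam * A * (c N * (real N * (real (x k) - of_bool (served k x))))))"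
        unfolding p_def by (simp add: algebra_simps)
    qed simp
    show "mean_bigo (\<lambda>N x. \<bar>K' N x\<bar>) (- 1)"
    proof (rule mean_bigo_mono[OF mean_bigo_add[OF K2 mean_bigo_mono[OF E3 A order_refl]], of 1])
      fix N x assume N: "N0 \<le> N" and x: "x \<in> S N"
      have "\<bar>\<phi> N (x 0)\<bar> \<le> A" using slowly_varyingD(1)[OF \<phi> N] states_bounds[OF x] by simp
      then have "c N * (\<bar>\<phi> N (x 0)\<bar> * real (low_count d k x)) \<le> c N * (A * real (low_count d k x))"
        using c0[of N] by (intro mult_left_mono mult_right_mono) auto
      moreover have "\<bar>K' N x\<bar> \<le> \<bar>K N x\<bar> + c N * (\<bar>\<phi> N (x 0)\<bar> * real (low_count d k x))"
        unfolding K'_def using c0[of N] by (intro order_trans[OF abs_triangle_ineq]) (simp add: abs_mult)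
      ultimately show "\<bar>K' N x\<bar> \<le> 1 * (\<bar>K N x\<bar> + A * (c N * real (low_count d k x)))"
        by (simp add: mult_ac)
    qed simp
    fix N assume N: "N0 \<le> N"
    show "K' N (initial_state d (F N)) = 0"
      using K3[OF N] k by (simp add: K'_def low_count_initial)
  qed
qed

text \<open>The load bound keeps the denominator above \<open>lam - L\<close>, and the denominator
  is affine in \<open>n\<close> with slope of order \<open>1 / N\<close>.\<close>

lemma slowly_varying_div:
  assumes \<phi>: "slowly_varying \<phi> A"
  shows "\<exists>B. slowly_varying (\<lambda>N n. \<phi> N n / (lam - inflow N n)) B"
proof -
  define e where "e = lam - L"
  have e: "0 < e" "N0 \<le> N \<Longrightarrow> e \<le> lam - inflow N n" for N n
    using L_less inflow_le[of N n] by (auto simp: e_def)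
  have A: "0 \<le> A" using slowly_varyingD(3)[OF \<phi> order_refl] .
  define B where "B = A / e + A * (mu * real d) / e\<^sup>2"
  show ?thesis unfolding slowly_varying_def
  proof (intro exI[of _ B] allI impI conjI)
    fix N n assume N: "N0 \<le> N" and n: "n \<le> F N"
    have "\<bar>\<phi> N n / (lam - inflow N n)\<bar> \<le> A / e"
      unfolding abs_divide using e(1) e(2)[OF N, of n] slowly_varyingD(1)[OF \<phi> N n] A
      by (intro frac_le) auto
    also have "\<dots> \<le> B" using A mu e by (simp add: B_def)
    finally show "\<bar>\<phi> N n / (lam - inflow N n)\<bar> \<le> B" .
  next
    fix N n assume N: "N0 \<le> N" and n: "n < F N"
    define u v where "u = lam - inflow N n" and "v = lam - inflow N (Suc n)"
    have uv: "e \<le> u" "e \<le> v" "v = u + mu * real d / real N"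
    proof -
      show "e \<le> u" "e \<le> v" using e(2)[OF N] unfolding u_def v_def by blast+
      show "v = u + mu * real d / real N"
        using N_pos[OF N] by (simp add: u_def v_def inflow_def field_simps)
    qed
    have "\<phi> N (Suc n) / v - \<phi> N n / u = (\<phi> N (Suc n) - \<phi> N n) / v - \<phi> N n * (mu * real d / real N) / (u * v)"
      using uv e(1) unfolding uv(3)[symmetric] by (simp add: field_simps) (simp add: uv(3) algebra_simps)
    also have "\<bar>\<dots>\<bar> \<le> \<bar>(\<phi> N (Suc n) - \<phi> N n) / v\<bar> + \<bar>\<phi> N n * (mu * real d / real N) / (u * v)\<bar>"
      by (rule abs_triangle_ineq4)
    also have "\<dots> \<le> (A / real N) / e + A * (mu * real d / real N) / (e * e)"
      unfolding abs_divide abs_mult using uv(1,2) e(1) A mu N_pos[OF N]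
        slowly_varyingD(1)[OF \<phi> N, of n] slowly_varyingD(2)[OF \<phi> N n] n
      by (intro add_mono frac_le mult_mono) auto
    also have "\<dots> = B / real N" using e(1) N_pos[OF N] by (simp add: B_def field_simps power2_eq_square)
    finally show "\<bar>\<phi> N (Suc n) / (lam - inflow N (Suc n)) - \<phi> N n / (lam - inflow N n)\<bar> \<le> B / real N"
      by (simp add: u_def v_def)
  qed
qed

text \<open>The function \<open>n (n + 1) / 2\<close> has drift
  \<open>a (n + 1) - lam n = a - (lam - a) n\<close> under the M/M/1 queue. This is exact at the
  empty queue too, because the service increment \<open>- n\<close> vanishes there. The errors come
  from losses out of level 1, from the files missing on level \<open>d\<close>, and from periods in
  which a level below \<open>d - 1\<close> has priority.\<close>

lemma top_level_step:
  assumes \<psi>: "slowly_varying \<psi> B" and N: "N0 \<le> N" and x: "x \<in> S N"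
  defines "Y \<equiv> low_count d (d - 1) x"
  shows "\<bar>gen N (\<lambda>x. \<psi> N (x 0) * (real (low_count d (d - 1) x) * (real (low_count d (d - 1) x) + 1) / 2)) x
      - real N * (\<psi> N (x 0) * (inflow N (x 0) - (lam - inflow N (x 0)) * real Y))\<bar>
    \<le> (mu * B * (1 + f0) + 2 * mu * real d * B) * (real Y)\<^sup>2
      + lam * B * real N * (real Y * of_bool (0 < low_count d (d - 2) x))"
proof -
  note \<psi>D = slowly_varyingD[OF \<psi> N]
  define g :: "nat \<Rightarrow> real" where "g n = real n * (real n + 1) / 2" for n
  have k: "1 \<le> d - 1" "d - 1 < d" "d - 1 + 1 = d" using d by auto
  define a where "a = mu * real (x 1) * (\<psi> N (x 0 + 1) * g (Y - 1) - \<psi> N (x 0) * g Y)"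
  define b where "b = mu * real d * (\<psi> N (x 0) * (real Y * (real Y + 1)))"
  define c where "c = lam * real N * (\<psi> N (x 0) * (real Y * (1 - of_bool (served (d - 1) x))))"
  have \<psi>0: "\<bar>\<psi> N (x 0)\<bar> \<le> B" using \<psi>D(1) states_bounds[OF x] by simp
  have gd: "g (Y + 1) - g Y = real Y + 1" "g (Y - 1) - g Y = - real Y"
    by (cases Y; simp add: g_def field_simps)+
  have xd: "mu * real d * real (x d) = real N * inflow N (x 0) - mu * real d * real Y"
  proof -
    have "real (F N) = real (x 0) + real Y + real (x d)"
      unfolding Y_def states_total[OF x d, symmetric] by simp
    moreover have "real N * inflow N (x 0) = mu * real d * (real (F N) - real (x 0))"
      using N_pos[OF N] by (simp add: inflow_def)
    ultimately show ?thesis by (simp add: algebra_simps)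
  qed
  have gen: "gen N (\<lambda>x. \<psi> N (x 0) * g (low_count d (d - 1) x)) x =
      a + mu * real d * real (x d) * (\<psi> N (x 0) * (g (Y + 1) - g Y))
      + of_bool (served (d - 1) x) * (lam * real N) * (\<psi> N (x 0) * (g (Y - 1) - g Y))"
    unfolding generator_low_count[OF x k(1,2), of lam mu N "\<psi> N" g] k(3) Y_def a_def ..
  have eq: "gen N (\<lambda>x. \<psi> N (x 0) * g (low_count d (d - 1) x)) x
      - real N * (\<psi> N (x 0) * (inflow N (x 0) - (lam - inflow N (x 0)) * real Y)) = a - b + c"
    unfolding gen xd gd b_def c_def by (simp add: algebra_simps)
  have "\<bar>a\<bar> \<le> mu * B * (1 + f0) * (real Y)\<^sup>2"
  proof (cases "x 1 = 0")
    case False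
    have x1: "real (x 1) \<le> real Y" using le_low_count[of 1 "d - 1" d x] k by (simp add: Y_def)
    have "\<psi> N (x 0 + 1) * g (Y - 1) - \<psi> N (x 0) * g Y =
        (\<psi> N (Suc (x 0)) - \<psi> N (x 0)) * g (Y - 1) - \<psi> N (x 0) * real Y"
    proof -
      have gY: "g (Y - 1) = g Y - real Y" using gd(2) by simp
      show ?thesis unfolding gY by (simp add: algebra_simps)
    qed
    also have "\<bar>\<dots>\<bar> \<le> B / real N * (real Y * (f0 * real N)) + B * real Y"
    proof -
      have "real Y \<le> real (F N)" using low_count_le_total[OF x, of "d - 1"] by (simp add: Y_def)
      also have "\<dots> \<le> f0 * real N" using f0(2)[OF N] .
      finally have YF: "real Y \<le> f0 * real N" .
      have "g (Y - 1) \<le> real Y * real Y"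
        by (cases Y) (auto simp: g_def field_simps)
      also have "\<dots> \<le> real Y * (f0 * real N)" using YF by (intro mult_left_mono) auto
      finally have "\<bar>(\<psi> N (Suc (x 0)) - \<psi> N (x 0)) * g (Y - 1)\<bar> \<le> B / real N * (real Y * (f0 * real N))"
        unfolding abs_mult using \<psi>D(2)[of "x 0"] states_bounds[OF x] False \<psi>D(3) N_pos[OF N]
        by (intro mult_mono) (auto simp: g_def)
      moreover have "\<bar>\<psi> N (x 0) * real Y\<bar> \<le> B * real Y"
        unfolding abs_mult using \<psi>0 by (simp add: mult_right_mono)
      ultimately show ?thesis by linarith
    qed
    also have "\<dots> = B * (1 + f0) * real Y" using N_pos[OF N] by (simp add: algebra_simps)
    finally have "\<bar>a\<bar> \<le> mu * real (x 1) * (B * (1 + f0) * real Y)"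
      unfolding a_def abs_mult using mu by (simp add: mult_left_mono)
    also have "\<dots> \<le> mu * real Y * (B * (1 + f0) * real Y)"
      using x1 mu \<psi>D(3) f0(1) by (intro mult_right_mono mult_left_mono) auto
    finally show ?thesis by (simp add: power2_eq_square mult_ac)
  qed (use mu \<psi>D(3) f0(1) in \<open>simp add: a_def\<close>)
  moreover have "\<bar>b\<bar> \<le> 2 * mu * real d * B * (real Y)\<^sup>2"
  proof -
    have "real Y * (real Y + 1) \<le> 2 * (real Y)\<^sup>2" by (cases Y) (auto simp: power2_eq_square field_simps)
    then have "\<bar>\<psi> N (x 0)\<bar> * (real Y * (real Y + 1)) \<le> B * (2 * (real Y)\<^sup>2)"
      by (rule mult_mono[OF \<psi>0]) (use \<psi>D(3) in auto)
    then have "mu * real d * (\<bar>\<psi> N (x 0)\<bar> * (real Y * (real Y + 1))) \<le> mu * real d * (B * (2 * (real Y)\<^sup>2))"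
      using mu by (intro mult_left_mono) auto
    then show ?thesis using mu by (simp add: b_def abs_mult mult_ac)
  qed
  moreover have "\<bar>c\<bar> \<le> lam * B * real N * (real Y * of_bool (0 < low_count d (d - 2) x))"
  proof -
    \<comment> \<open>If the lower levels are empty then \<open>Y = x (d - 1)\<close>, so a nonempty
      queue is served.\<close>
    have "real Y * (1 - of_bool (served (d - 1) x)) \<le> real Y * of_bool (0 < low_count d (d - 2) x)"
    proof (cases "0 < low_count d (d - 2) x \<or> Y = 0")
      case False
      have "Suc (d - 2) = d - 1" using d by simp
      with low_count_Suc[of "d - 2" d x] False d have "0 < x (d - 1)" by (auto simp: Y_def)
      moreover have "x i = 0" if "i \<in> {1..<d - 1}" for i
        using le_low_count[of i "d - 2" d x] that False by auto
      ultimately have "served (d - 1) x" by (auto simp: served_def)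
      then show ?thesis by simp
    qed (auto simp: of_bool_def)
    then have "lam * real N * (\<bar>\<psi> N (x 0)\<bar> * (real Y * (1 - of_bool (served (d - 1) x))))
      \<le> lam * real N * (B * (real Y * of_bool (0 < low_count d (d - 2) x)))"
      by (rule mult_left_mono[OF mult_mono[OF \<psi>0]]) (use lam \<psi>D(3) in \<open>auto simp: of_bool_def\<close>)
    then show ?thesis using lam by (simp add: c_def abs_mult mult_ac)
  qed
  ultimately show ?thesis unfolding eq[unfolded g_def] by (simp add: algebra_simps)
qed

text \<open>The chain up to level \<open>d - 1\<close> is completed by the quadratic function of the
  top queue. Dividing the weight by \<open>lam - a\<close> turns the drift
  \<open>a - (lam - a) Y\<close> into \<open>a / (lam - a) - Y\<close>. The difference between
  \<open>Y\<close> and \<open>x (d - 1)\<close> is the occupation of the levels below, one more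
  negligible term.\<close>

lemma averaging:
  assumes \<phi>: "slowly_varying \<phi> A"
  obtains K where
    "mean_bigo (\<lambda>N x. \<bar>gen N (K N) x + mu * real N ^ (d - 2) * (\<phi> N (x 0) * real (x 1))
        - coef (d - 1) * (\<phi> N (x 0) * (inflow N (x 0) / (lam - inflow N (x 0))))\<bar>) (- 1 / 2)"
    "mean_bigo (\<lambda>N x. \<bar>K N x\<bar>) (- 1)"
    "\<And>N. N0 \<le> N \<Longrightarrow> K N (initial_state d (F N)) = 0"
proof -
  define \<psi> where "\<psi> N n = \<phi> N n / (lam - inflow N n)" for N n
  obtain B where \<psi>: "slowly_varying \<psi> B" using slowly_varying_div[OF \<phi>] unfolding \<psi>_def by auto
  have k: "1 \<le> d - 1" "d - 1 < d" "d - 1 - (d - 1) = 0" "Suc (d - 2) = d - 1" using d by auto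
  obtain K where K1: "mean_bigo (\<lambda>N x. \<bar>gen N (K N) x + mu * real N ^ (d - 2) * (\<phi> N (x 0) * real (x 1))
        - coef (d - 1) * real N ^ (d - 1 - (d - 1)) * (\<phi> N (x 0) * real (x (d - 1)))\<bar>) (- 1 / 2)"
    and K2: "mean_bigo (\<lambda>N x. \<bar>K N x\<bar>) (- 1)" and K3: "\<And>N. N0 \<le> N \<Longrightarrow> K N (initial_state d (F N)) = 0"
    using corrector_chain[OF \<phi> k(1,2)] by auto
  define G where "G N x = \<psi> N (x 0) * (real (low_count d (d - 1) x) * (real (low_count d (d - 1) x) + 1) / 2)" for N x
  define K' where "K' N x = K N x + coef (d - 1) / real N * G N x" for N x
  define Y where "Y x = real (low_count d (d - 1) x)" for x
  define Z where "Z x = real (deficit d (d - 1) x)" for x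
  define I where "I x = (of_bool (0 < low_count d (d - 2) x) :: real)" for x
  have A: "0 \<le> A" using slowly_varyingD(3)[OF \<phi> order_refl] .
  have B: "0 \<le> B" using slowly_varyingD(3)[OF \<psi> order_refl] .
  have YZ: "0 \<le> Y x" "Y x \<le> Z x" for x using low_count_le_deficit[of d "d - 1" x] by (auto simp: Y_def Z_def)
  have sq: "mean_bigo (\<lambda>N x. real N powr (- 1) * (Z x)\<^sup>2) (- 1)"
    unfolding Z_def by (rule mean_bigo_scale[OF mean_deficit_square]) simp
  have ind: "mean_bigo (\<lambda>N x. Z x * I x) (- 1 / 2)"
    using mean_deficit_indicator by (simp only: Z_def I_def)
  define c1 c2 where "c1 = coef (d - 1) * (mu * B * (1 + f0) + 2 * mu * real d * B)"
    and "c2 = coef (d - 1) * (lam * B + A)"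
  have c: "0 \<le> c1" "0 \<le> c2" using coef_pos[of "d - 1"] A B mu lam f0(1) by (auto simp: c1_def c2_def)
  have err: "mean_bigo (\<lambda>N x. c1 * (real N powr (- 1) * (Z x)\<^sup>2) + c2 * (Z x * I x)) (- 1 / 2)"
    by (rule mean_bigo_add; rule mean_bigo_mono[OF mean_bigo_weaken[OF sq] _ order_refl] 
        mean_bigo_mono[OF ind _ order_refl]) (use c in auto)
  show ?thesis
  proof (rule that[of K'])
    show "mean_bigo (\<lambda>N x. \<bar>gen N (K' N) x + mu * real N ^ (d - 2) * (\<phi> N (x 0) * real (x 1))
        - coef (d - 1) * (\<phi> N (x 0) * (inflow N (x 0) / (lam - inflow N (x 0))))\<bar>) (- 1 / 2)"
    proof (rule mean_bigo_mono[OF mean_bigo_add[OF K1 err], of 1])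
      fix N x assume N: "N0 \<le> N" and x: "x \<in> S N"
      define a where "a = inflow N (x 0)"
      define p where "p = gen N (K N) x + mu * real N ^ (d - 2) * (\<phi> N (x 0) * real (x 1))
        - coef (d - 1) * real N ^ (d - 1 - (d - 1)) * (\<phi> N (x 0) * real (x (d - 1)))"
      define q where "q = gen N (G N) x - real N * (\<psi> N (x 0) * (a - (lam - a) * Y x))"
      have la: "lam - a \<noteq> 0" using inflow_le[OF N, of "x 0"] L_less by (simp add: a_def)
      have gen': "gen N (K' N) x = gen N (K N) x + coef (d - 1) / real N * gen N (G N) x"
        unfolding K'_def generator_add generator_cmult ..
      have Yx: "Y x = real (low_count d (d - 2) x) + real (x (d - 1))"
        using low_count_Suc[of "d - 2" d x] k d unfolding Y_def by simp
      have \<psi>x: "\<psi> N (x 0) * (a - (lam - a) * Y x) = \<phi> N (x 0) * (a / (lam - a)) - \<phi> N (x 0) * Y x"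
        using la by (simp add: \<psi>_def a_def field_simps)
      have "gen N (K' N) x + mu * real N ^ (d - 2) * (\<phi> N (x 0) * real (x 1))
        - coef (d - 1) * (\<phi> N (x 0) * (a / (lam - a)))
        = p + coef (d - 1) * (q / real N - \<phi> N (x 0) * real (low_count d (d - 2) x))"
        unfolding gen' p_def q_def \<psi>x k(3) using N_pos[OF N] by (simp add: Yx field_simps)
      also have "\<bar>\<dots>\<bar> \<le> \<bar>p\<bar> + coef (d - 1) * (\<bar>q\<bar> / real N + \<bar>\<phi> N (x 0) * real (low_count d (d - 2) x)\<bar>)"
      proof -
        have "\<bar>q / real N - \<phi> N (x 0) * real (low_count d (d - 2) x)\<bar>
           \<le> \<bar>q\<bar> / real N + \<bar>\<phi> N (x 0) * real (low_count d (d - 2) x)\<bar>"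
          using abs_triangle_ineq4[of "q / real N" "\<phi> N (x 0) * real (low_count d (d - 2) x)"] by simp
        then have "\<bar>coef (d - 1) * (q / real N - \<phi> N (x 0) * real (low_count d (d - 2) x))\<bar>
          \<le> coef (d - 1) * (\<bar>q\<bar> / real N + \<bar>\<phi> N (x 0) * real (low_count d (d - 2) x)\<bar>)"
          using coef_pos[of "d - 1"] by (simp add: abs_mult)
        then show ?thesis by linarith
      qed
      also have "coef (d - 1) * (\<bar>q\<bar> / real N + \<bar>\<phi> N (x 0) * real (low_count d (d - 2) x)\<bar>)
         \<le> c1 * (real N powr (- 1) * (Z x)\<^sup>2) + c2 * (Z x * I x)"
      proof -
        have "\<bar>q\<bar> \<le> (mu * B * (1 + f0) + 2 * mu * real d * B) * (Y x)\<^sup>2 + lam * B * real N * (Y x * I x)"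
          using top_level_step[OF \<psi> N x] unfolding q_def G_def a_def Y_def I_def by simp
        also have "\<dots> \<le> (mu * B * (1 + f0) + 2 * mu * real d * B) * (Z x)\<^sup>2 + lam * B * real N * (Z x * I x)"
          using YZ[of x] mu lam B f0(1)
          by (intro add_mono mult_left_mono mult_right_mono power_mono) (auto simp: I_def)
        finally have "\<bar>q\<bar> / real N \<le> ((mu * B * (1 + f0) + 2 * mu * real d * B) * (Z x)\<^sup>2 + lam * B * real N * (Z x * I x)) / real N"
          using N_pos[OF N] by (intro divide_right_mono) auto
        also have "\<dots> = (mu * B * (1 + f0) + 2 * mu * real d * B) * (real N powr (- 1) * (Z x)\<^sup>2) + lam * B * (Z x * I x)"
          using N_pos[OF N] by (simp add: powr_minus_divide field_simps)
        finally have 1: "\<bar>q\<bar> / real N \<le> \<dots>" .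
        have "real (low_count d (d - 2) x) \<le> Z x * I x"
          using Yx YZ[of x] by (auto simp: I_def)
        then have 2: "\<bar>\<phi> N (x 0) * real (low_count d (d - 2) x)\<bar> \<le> A * (Z x * I x)"
          unfolding abs_mult using A slowly_varyingD(1)[OF \<phi> N] states_bounds[OF x]
          by (intro mult_mono) auto
        have "coef (d - 1) * (\<bar>q\<bar> / real N + \<bar>\<phi> N (x 0) * real (low_count d (d - 2) x)\<bar>)
          \<le> coef (d - 1) * ((mu * B * (1 + f0) + 2 * mu * real d * B) * (real N powr (- 1) * (Z x)\<^sup>2)
            + lam * B * (Z x * I x) + A * (Z x * I x))"
          using coef_pos[of "d - 1"] 1 2 by (intro mult_left_mono add_mono) auto
        then show ?thesis by (simp add: c1_def c2_def algebra_simps)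
      qed
      finally show "\<bar>gen N (K' N) x + mu * real N ^ (d - 2) * (\<phi> N (x 0) * real (x 1))
        - coef (d - 1) * (\<phi> N (x 0) * (inflow N (x 0) / (lam - inflow N (x 0))))\<bar>
        \<le> 1 * (\<bar>gen N (K N) x + mu * real N ^ (d - 2) * (\<phi> N (x 0) * real (x 1))
        - coef (d - 1) * real N ^ (d - 1 - (d - 1)) * (\<phi> N (x 0) * real (x (d - 1)))\<bar>
         + (c1 * (real N powr (- 1) * (Z x)\<^sup>2) + c2 * (Z x * I x)))"
        unfolding p_def a_def by simp
    qed simp
    show "mean_bigo (\<lambda>N x. \<bar>K' N x\<bar>) (- 1)"
    proof (rule mean_bigo_mono[OF mean_bigo_add[OF K2 mean_bigo_mono[OF sq _ order_refl]], of _ 1])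
      show "0 \<le> coef (d - 1) * B" using coef_pos[of "d - 1"] B by simp
      fix N x assume N: "N0 \<le> N" and x: "x \<in> S N"
      have "\<bar>\<psi> N (x 0)\<bar> \<le> B" using slowly_varyingD(1)[OF \<psi> N] states_bounds[OF x] by simp
      moreover have "Y x * (Y x + 1) / 2 \<le> (Y x)\<^sup>2"
        unfolding Y_def by (cases "low_count d (d - 1) x") (auto simp: power2_eq_square field_simps)
      moreover have "(Y x)\<^sup>2 \<le> (Z x)\<^sup>2" using YZ[of x] by (intro power_mono) auto
      ultimately have "\<bar>G N x\<bar> \<le> B * (Z x)\<^sup>2"
        unfolding G_def Y_def[symmetric] abs_mult using B YZ(1)[of x] by (intro mult_mono) auto
      then have "coef (d - 1) / real N * \<bar>G N x\<bar> \<le> coef (d - 1) / real N * (B * (Z x)\<^sup>2)"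
        using coef_pos[of "d - 1"] by (intro mult_left_mono) auto
      moreover have "\<bar>K' N x\<bar> \<le> \<bar>K N x\<bar> + coef (d - 1) / real N * \<bar>G N x\<bar>"
        unfolding K'_def using coef_pos[of "d - 1"]
        by (intro order_trans[OF abs_triangle_ineq]) (simp add: abs_mult)
      moreover have "coef (d - 1) / real N * (B * (Z x)\<^sup>2) = coef (d - 1) * B * (real N powr (- 1) * (Z x)\<^sup>2)"
        using N_pos[OF N] by (simp add: powr_minus_divide)
      ultimately show "\<bar>K' N x\<bar> \<le> 1 * (\<bar>K N x\<bar> + coef (d - 1) * B * (real N powr (- 1) * (Z x)\<^sup>2))"
        unfolding mult_1_left by (auto intro: order_trans)
    qed simp
    fix N assume N: "N0 \<le> N"
    show "K' N (initial_state d (F N)) = 0"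
      using K3[OF N] low_count_initial[of "d - 1" N] d by (simp add: K'_def G_def)
  qed
qed

end

section \<open>Concentration of the fraction of lost files\<close>

locale duplication_loss_limit = duplication_loss +
  fixes \<beta> :: real
  assumes \<beta>: "0 < \<beta>" and F_lim: "(\<lambda>N. real (F N) / real N) \<longlonglongrightarrow> \<beta>"
begin

lemma \<beta>_le: "\<beta> \<le> f0"
proof (rule LIMSEQ_le_const2[OF F_lim], intro exI[of _ N0] allI impI)
  fix N assume "N0 \<le> N"
  with f0(2) N_pos show "real (F N) / real N \<le> f0" by (simp add: divide_le_eq)
qed

lemma f0_eq: "mu * real d * f0 = L"
  using mu d by (simp add: f0_def)

text \<open>The time, in units of \<open>N\<^sup>d\<^sup>-\<^sup>1\<close>, at which the limiting fraction of lost files equals \<open>\<theta>\<close>.\<close>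

definition clock :: "real \<Rightarrow> real" where
  "clock \<theta> = (- (lam / (mu * real d)) * ln (1 - \<theta> / \<beta>) - \<theta>) / coef (d - 1)"

text \<open>The reciprocal of the limiting drift \<open>coef (d - 1) * a / (lam - a)\<close> at
  \<open>a = mu d (\<beta> - \<theta>)\<close>; the clock is the limiting equation solved by
  separation of variables.\<close>

definition clock_rate :: "real \<Rightarrow> real" where
  "clock_rate \<theta> = (lam - mu * real d * (\<beta> - \<theta>)) / (coef (d - 1) * (mu * real d * (\<beta> - \<theta>)))"

lemma clock_0: "clock 0 = 0" by (simp add: clock_def)

lemma clock_deriv:
  assumes "\<theta> < \<beta>"
  shows "(clock has_real_derivative clock_rate \<theta>) (at \<theta> within A)"
  unfolding clock_def clock_rate_def using assms \<beta> mu d coef_pos[of "d - 1"]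
  by (auto intro!: derivative_eq_intros simp: field_simps)

lemma service_gap:
  assumes "0 \<le> \<theta>"
  shows "lam - L \<le> lam - mu * real d * (\<beta> - \<theta>)"
proof -
  have "mu * real d * (\<beta> - \<theta>) \<le> mu * real d * f0"
    using assms \<beta>_le mu by (intro mult_left_mono) auto
  then show ?thesis by (simp add: f0_eq)
qed

lemma clock_rate_nonneg:
  assumes "0 \<le> \<theta>" "\<theta> < \<beta>"
  shows "0 \<le> clock_rate \<theta>"
  unfolding clock_rate_def
  using service_gap[OF assms(1)] L_less assms mu coef_pos[of "d - 1"]
  by (intro divide_nonneg_nonneg mult_nonneg_nonneg) auto

lemma clock_rate_le:
  assumes "0 \<le> \<theta>" "\<theta> \<le> \<theta>1" "\<theta>1 < \<beta>"
  shows "clock_rate \<theta> \<le> lam / (coef (d - 1) * (mu * real d * (\<beta> - \<theta>1)))"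
  unfolding clock_rate_def
  using assms mu lam d coef_pos[of "d - 1"]
  by (intro frac_le mult_left_mono) auto

lemma clock_mono:
  assumes "0 \<le> a" "a \<le> b" "b < \<beta>"
  shows "clock a \<le> clock b"
proof (rule DERIV_nonneg_imp_nondecreasing[OF assms(2)])
  fix x assume "a \<le> x" "x \<le> b"
  then show "\<exists>y. (clock has_real_derivative y) (at x) \<and> 0 \<le> y"
    using clock_deriv[of x UNIV] clock_rate_nonneg[of x] assms by auto
qed

lemma clock_nonneg: "0 \<le> a \<Longrightarrow> a < \<beta> \<Longrightarrow> 0 \<le> clock a"
  using clock_mono[of 0 a] by (simp add: clock_0)

text \<open>The averaged drift is decreasing in the fraction of lost files, so it never pushes
  the fraction away from \<open>\<theta>\<close>.\<close>

lemma drift_le: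
  assumes N: "N0 \<le> N" and x: "x \<in> S N" and \<theta>: "0 \<le> \<theta>" "\<theta> \<le> \<theta>1" "\<theta>1 < \<beta>"
  defines "a \<equiv> inflow N (x 0)"
  shows "clock_rate \<theta> * (coef (d - 1) * ((2 * real (x 0) + 1) / real N * (a / (lam - a))
        - 2 * \<theta> * (a / (lam - a)))) + 2 * (\<theta> - real (x 0) / real N)
    \<le> lam / (coef (d - 1) * (mu * real d * (\<beta> - \<theta>1))) *
       (2 * coef (d - 1) * (lam * (mu * real d) * f0 * \<bar>real (F N) / real N - \<beta>\<bar> / (lam - L)\<^sup>2)
        + coef (d - 1) * L / (lam - L) / real N)"
proof -
  define c where "c = coef (d - 1)"
  define \<psi> where "\<psi> = real (x 0) / real N"
  define b where "b = mu * real d * (\<beta> - \<theta>)"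
  define w where "w = a / (lam - a)"
  define e where "e = lam - L"
  have c: "0 < c" using coef_pos by (simp add: c_def)
  have e: "0 < e" "e \<le> lam - a" "e \<le> lam - b"
    using L_less inflow_le[OF N] service_gap[OF \<theta>(1)] by (auto simp: e_def a_def b_def)
  have b: "0 < b" using mu d \<theta> by (simp add: b_def)
  \<comment> \<open>Clock rate times limiting drift is one. Multiplying the motion of the target,
    \<open>2 * (\<theta> - \<psi>)\<close>, by this one gives both parts the common factor
    \<open>clock_rate \<theta>\<close> and leaves the difference
    \<open>w - b / (lam - b)\<close>.\<close>
  have rate: "clock_rate \<theta> * c * (b / (lam - b)) = 1"
    unfolding clock_rate_def c_def[symmetric] b_def[symmetric] using e c b by simp
  have F: "real (F N) / real N \<le> f0" using f0(2)[OF N] N_pos[OF N] by (simp add: divide_le_eq)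
  have x0: "real (x 0) \<le> real (F N)" using states_bounds[OF x] by simp
  then have \<psi>F: "\<psi> \<le> real (F N) / real N" unfolding \<psi>_def by (simp add: divide_right_mono)
  have \<psi>: "0 \<le> \<psi>" "\<psi> \<le> f0" using \<psi>F F by (auto simp: \<psi>_def)
  have a_eq: "a = mu * real d * (real (F N) / real N - \<psi>)"
    unfolding a_def inflow_def \<psi>_def by (simp flip: diff_divide_distrib)
  have a0: "0 \<le> a" unfolding a_eq using mu \<psi>F by simp
  have w: "0 \<le> w" "w \<le> L / e"
    unfolding w_def using a0 e inflow_le[OF N, of "x 0"] L_nonneg
    by (auto simp: a_def[symmetric] intro!: frac_le)
  \<comment> \<open>Up to the discrepancy between \<open>F N / N\<close> and \<beta>,
    \<open>a - b\<close> is a negative multiple of \<open>\<psi> - \<theta>\<close>. The product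
    thus contains a negative square, which is discarded.\<close>
  have "(\<psi> - \<theta>) * (w - b / (lam - b)) = (\<psi> - \<theta>) * (lam * (a - b)) / ((lam - a) * (lam - b))"
    using e by (simp add: w_def field_simps)
  also have "\<dots> = (lam * (mu * real d)) * ((\<psi> - \<theta>) * (real (F N) / real N - \<beta>) - (\<psi> - \<theta>)\<^sup>2) / ((lam - a) * (lam - b))"
    by (simp add: a_eq b_def power2_eq_square algebra_simps)
  also have "\<dots> \<le> (lam * (mu * real d)) * (f0 * \<bar>real (F N) / real N - \<beta>\<bar>) / (e * e)"
  proof (rule frac_le)
    have "\<bar>\<psi> - \<theta>\<bar> \<le> f0" using \<psi> \<theta> \<beta>_le by auto
    then have "\<bar>(\<psi> - \<theta>) * (real (F N) / real N - \<beta>)\<bar> \<le> f0 * \<bar>real (F N) / real N - \<beta>\<bar>"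
      unfolding abs_mult by (rule mult_right_mono) simp
    then have "(\<psi> - \<theta>) * (real (F N) / real N - \<beta>) - (\<psi> - \<theta>)\<^sup>2 \<le> f0 * \<bar>real (F N) / real N - \<beta>\<bar>"
      using zero_le_power2[of "\<psi> - \<theta>"] by linarith
    then show "(lam * (mu * real d)) * ((\<psi> - \<theta>) * (real (F N) / real N - \<beta>) - (\<psi> - \<theta>)\<^sup>2)
        \<le> (lam * (mu * real d)) * (f0 * \<bar>real (F N) / real N - \<beta>\<bar>)"
      using lam mu by (intro mult_left_mono) auto
    show "0 \<le> (lam * (mu * real d)) * (f0 * \<bar>real (F N) / real N - \<beta>\<bar>)" using lam mu f0(1) by simp
    show "0 < e * e" using e by simp
    show "e * e \<le> (lam - a) * (lam - b)" using e by (intro mult_mono) auto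
  qed
  finally have key: "(\<psi> - \<theta>) * (w - b / (lam - b)) \<le> lam * (mu * real d) * f0 * \<bar>real (F N) / real N - \<beta>\<bar> / e\<^sup>2"
    by (simp add: power2_eq_square mult_ac)
  have "clock_rate \<theta> * (c * ((2 * real (x 0) + 1) / real N * w - 2 * \<theta> * w)) + 2 * (\<theta> - \<psi>)
     = clock_rate \<theta> * (c * ((2 * \<psi> + 1 / real N) * w - 2 * \<theta> * w))
       + 2 * (\<theta> - \<psi>) * (clock_rate \<theta> * c * (b / (lam - b)))"
    unfolding rate by (simp add: \<psi>_def add_divide_distrib)
  also have "\<dots> = clock_rate \<theta> * (2 * c * ((\<psi> - \<theta>) * (w - b / (lam - b))) + c * w / real N)"
  proof -
    have "u * (c * ((2 * \<psi> + i) * w - 2 * \<theta> * w)) + 2 * (\<theta> - \<psi>) * (u * c * v)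
       = u * (2 * c * ((\<psi> - \<theta>) * (w - v)) + c * w * i)" for u v i
      by (simp add: algebra_simps)
    from this[of "clock_rate \<theta>" "1 / real N" "b / (lam - b)"] show ?thesis by simp
  qed
  also have "\<dots> \<le> clock_rate \<theta> * (2 * c * (lam * (mu * real d) * f0 * \<bar>real (F N) / real N - \<beta>\<bar> / e\<^sup>2)
      + c * L / e / real N)"
  proof -
    have A: "c * w / real N \<le> c * L / e / real N"
      using w(2) c by (intro divide_right_mono) (auto simp: mult_left_mono simp flip: times_divide_eq_right)
    have B: "2 * c * ((\<psi> - \<theta>) * (w - b / (lam - b)))
       \<le> 2 * c * (lam * (mu * real d) * f0 * \<bar>real (F N) / real N - \<beta>\<bar> / e\<^sup>2)"
      using key c by (intro mult_left_mono) auto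
    show ?thesis
      by (rule mult_left_mono[OF add_mono[OF B A]]) (use clock_rate_nonneg[of \<theta>] \<theta> in auto)
  qed
  also have "\<dots> \<le> lam / (c * (mu * real d * (\<beta> - \<theta>1))) *
    (2 * c * (lam * (mu * real d) * f0 * \<bar>real (F N) / real N - \<beta>\<bar> / e\<^sup>2) + c * L / e / real N)"
    using clock_rate_le[OF \<theta>] c lam mu f0(1) L_nonneg e(1)
    by (intro mult_right_mono) (auto simp: c_def intro!: add_nonneg_nonneg mult_nonneg_nonneg divide_nonneg_nonneg)
  finally show ?thesis by (simp only: c_def w_def e_def \<psi>_def)
qed

section \<open>Mean-square distance to the limiting trajectory\<close>

lemma slowly_varying_1: "slowly_varying (\<lambda>N n. 1) 1"
  by (simp add: slowly_varying_def)

lemma slowly_varying_square: "slowly_varying (\<lambda>N n. (2 * real n + 1) / real N) (2 * f0 + 2)"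
  unfolding slowly_varying_def
proof (intro allI impI conjI)
  fix N n assume N: "N0 \<le> N" and n: "n \<le> F N"
  have "real n \<le> f0 * real N" using f0(2)[OF N] n by linarith
  then have "2 * real n + 1 \<le> (2 * f0 + 2) * real N"
    using N_pos[OF N] by (simp add: algebra_simps)
  then show "\<bar>(2 * real n + 1) / real N\<bar> \<le> 2 * f0 + 2"
    using N_pos[OF N] by (simp add: divide_le_eq)
next
  fix N n assume N: "N0 \<le> N"
  have "(2 * real (Suc n) + 1) / real N - (2 * real n + 1) / real N = 2 / real N"
    by (simp add: diff_divide_distrib[symmetric])
  then show "\<bar>(2 * real (Suc n) + 1) / real N - (2 * real n + 1) / real N\<bar> \<le> (2 * f0 + 2) / real N"
    using N_pos[OF N] f0(1) by (simp add: divide_right_mono)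
qed

lemma gen_lost:
  assumes "x \<in> S N"
  shows "gen N (\<lambda>x. h (x 0)) x = mu * real (x 1) * (h (x 0 + 1) - h (x 0))"
  using generator_low_count[OF assms, of 1 lam mu N h "\<lambda>_. 1"] d by simp

text \<open>The corrector enters with weight \<open>N^(-(d-1))\<close>: on the slow time scale its
  generator replaces \<open>x 1\<close> by the averaged value, while its own size, of order at most
  \<open>1 / N\<close>, is lost in the limit. Prescribing the exact discrete increment of
  \<open>h\<close> leaves no Taylor remainder.\<close>

lemma averaging_lost:
  assumes \<phi>: "slowly_varying \<phi> A"
    and h: "\<And>N n. N0 \<le> N \<Longrightarrow> h N (n + 1) - h N n = \<phi> N n / real N"
    and h0: "\<And>N. h N 0 = 0"
  obtains f C where "0 \<le> C"
    "\<And>N t. N0 \<le> N \<Longrightarrow> 0 \<le> t \<Longrightarrow> mean N t (\<lambda>x. \<bar>real N ^ (d - 1) * gen N (f N) x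
        - coef (d - 1) * (\<phi> N (x 0) * (inflow N (x 0) / (lam - inflow N (x 0))))\<bar>) \<le> C * real N powr (- 1 / 2)"
    "\<And>N t. N0 \<le> N \<Longrightarrow> 0 \<le> t \<Longrightarrow> mean N t (\<lambda>x. \<bar>f N x - h N (x 0)\<bar>) \<le> C * real N powr (- 1)"
    "\<And>N. N0 \<le> N \<Longrightarrow> f N (initial_state d (F N)) = 0"
proof -
  obtain K where K1: "mean_bigo (\<lambda>N x. \<bar>gen N (K N) x + mu * real N ^ (d - 2) * (\<phi> N (x 0) * real (x 1))
        - coef (d - 1) * (\<phi> N (x 0) * (inflow N (x 0) / (lam - inflow N (x 0))))\<bar>) (- 1 / 2)"
    and K2: "mean_bigo (\<lambda>N x. \<bar>K N x\<bar>) (- 1)"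
    and K3: "\<And>N. N0 \<le> N \<Longrightarrow> K N (initial_state d (F N)) = 0"
    using averaging[OF \<phi>] by blast
  define f where "f N x = h N (x 0) + 1 / real N ^ (d - 1) * K N x" for N x
  have e: "d - 1 = Suc (d - 2)" using d by simp
  have gen_f: "real N ^ (d - 1) * gen N (f N) x = gen N (K N) x + mu * real N ^ (d - 2) * (\<phi> N (x 0) * real (x 1))"
    if "N0 \<le> N" "x \<in> S N" for N x
  proof -
    have "gen N (f N) x = mu * real (x 1) * (\<phi> N (x 0) / real N) + 1 / real N ^ (d - 1) * gen N (K N) x"
      unfolding f_def generator_add generator_cmult gen_lost[OF that(2)] using h[OF that(1)] by simp
    then show ?thesis unfolding e using N_pos[OF that(1)] by (simp add: field_simps)
  qed
  obtain C1 where C1: "0 \<le> C1" "\<And>N t. N0 \<le> N \<Longrightarrow> 0 \<le> t \<Longrightarrow> 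
     mean N t (\<lambda>x. \<bar>gen N (K N) x + mu * real N ^ (d - 2) * (\<phi> N (x 0) * real (x 1))
        - coef (d - 1) * (\<phi> N (x 0) * (inflow N (x 0) / (lam - inflow N (x 0))))\<bar>) \<le> C1 * real N powr (- 1 / 2)"
    using K1 unfolding mean_bigo_def by blast
  obtain C2 where C2: "0 \<le> C2" "\<And>N t. N0 \<le> N \<Longrightarrow> 0 \<le> t \<Longrightarrow> 
     mean N t (\<lambda>x. \<bar>K N x\<bar>) \<le> C2 * real N powr (- 1)"
    using K2 unfolding mean_bigo_def by blast
  show ?thesis
  proof (rule that[of "C1 + C2" f])
    fix N :: nat and t :: real assume N: "N0 \<le> N" and t: "0 \<le> t"
    have "mean N t (\<lambda>x. \<bar>real N ^ (d - 1) * gen N (f N) x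
        - coef (d - 1) * (\<phi> N (x 0) * (inflow N (x 0) / (lam - inflow N (x 0))))\<bar>)
      = mean N t (\<lambda>x. \<bar>gen N (K N) x + mu * real N ^ (d - 2) * (\<phi> N (x 0) * real (x 1))
        - coef (d - 1) * (\<phi> N (x 0) * (inflow N (x 0) / (lam - inflow N (x 0))))\<bar>)"
      by (intro mean_cong) (simp only: gen_f[OF N])
    also have "\<dots> \<le> C1 * real N powr (- 1 / 2)" by (rule C1(2)[OF N t])
    also have "\<dots> \<le> (C1 + C2) * real N powr (- 1 / 2)" using C2(1) by (intro mult_right_mono) auto
    finally show "mean N t (\<lambda>x. \<bar>real N ^ (d - 1) * gen N (f N) x
        - coef (d - 1) * (\<phi> N (x 0) * (inflow N (x 0) / (lam - inflow N (x 0))))\<bar>)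
       \<le> (C1 + C2) * real N powr (- 1 / 2)" .
    have "mean N t (\<lambda>x. \<bar>f N x - h N (x 0)\<bar>) \<le> mean N t (\<lambda>x. \<bar>K N x\<bar>)"
    proof (rule mean_mono[OF N t])
      fix x
      have "1 \<le> real N ^ (d - 1)" using N_pos[OF N] by (intro one_le_power) auto
      then show "\<bar>f N x - h N (x 0)\<bar> \<le> \<bar>K N x\<bar>"
        by (simp add: f_def abs_mult divide_le_eq mult_le_cancel_left1)
    qed
    also have "\<dots> \<le> C2 * real N powr (- 1)" by (rule C2(2)[OF N t])
    also have "\<dots> \<le> (C1 + C2) * real N powr (- 1)" using C1(1) by (intro mult_right_mono) auto
    finally show "mean N t (\<lambda>x. \<bar>f N x - h N (x 0)\<bar>) \<le> (C1 + C2) * real N powr (- 1)" .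
  qed (use C1(1) C2(1) K3 h0 d in \<open>auto simp: f_def initial_state_def\<close>)
qed

text \<open>\<open>D N \<theta>\<close> is the mean of \<open>(x 0 / N - \<theta>)^2\<close> with
  its two random terms replaced by their corrected versions. It vanishes at
  \<open>\<theta> = 0\<close>, and its derivative in \<theta> is at most \<open>e N\<close>, which
  tends to 0.\<close>

lemma lost_fraction_concentrates:
  assumes \<theta>1: "0 \<le> \<theta>1" "\<theta>1 < \<beta>"
  shows "(\<lambda>N. mean N (real N ^ (d - 1) * clock \<theta>1) (\<lambda>x. (real (x 0) / real N - \<theta>1)\<^sup>2)) \<longlonglongrightarrow> 0"
proof -
  define w where "w N x = inflow N (x 0) / (lam - inflow N (x 0))" for N and x :: "nat \<Rightarrow> nat"
  define c where "c = coef (d - 1)"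
  obtain f1 C1 where f1: "0 \<le> C1"
    "\<And>N t. N0 \<le> N \<Longrightarrow> 0 \<le> t \<Longrightarrow> mean N t (\<lambda>x. \<bar>real N ^ (d - 1) * gen N (f1 N) x
        - c * (1 * w N x)\<bar>) \<le> C1 * real N powr (- 1 / 2)"
    "\<And>N t. N0 \<le> N \<Longrightarrow> 0 \<le> t \<Longrightarrow> mean N t (\<lambda>x. \<bar>f1 N x - real (x 0) / real N\<bar>) \<le> C1 * real N powr (- 1)"
    "\<And>N. N0 \<le> N \<Longrightarrow> f1 N (initial_state d (F N)) = 0"
    by (rule averaging_lost[OF slowly_varying_1, of "\<lambda>N n. real n / real N"])
      (auto simp: add_divide_distrib w_def c_def)
  \<comment> \<open>This identifies the weight \<phi> for the square; its summand 1 reappears as the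
    error of order \<open>1 / N\<close> in \<open>drift_le\<close>.\<close>
  have square: "(real (n + 1) / real N)\<^sup>2 - (real n / real N)\<^sup>2 = (2 * real n + 1) / real N / real N" for n N
    by (simp add: power2_eq_square diff_divide_distrib[symmetric] algebra_simps)
  obtain f2 C2 where f2: "0 \<le> C2"
    "\<And>N t. N0 \<le> N \<Longrightarrow> 0 \<le> t \<Longrightarrow> mean N t (\<lambda>x. \<bar>real N ^ (d - 1) * gen N (f2 N) x
        - c * ((2 * real (x 0) + 1) / real N * w N x)\<bar>) \<le> C2 * real N powr (- 1 / 2)"
    "\<And>N t. N0 \<le> N \<Longrightarrow> 0 \<le> t \<Longrightarrow> mean N t (\<lambda>x. \<bar>f2 N x - (real (x 0) / real N)\<^sup>2\<bar>) \<le> C2 * real N powr (- 1)"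
    "\<And>N. N0 \<le> N \<Longrightarrow> f2 N (initial_state d (F N)) = 0"
    by (rule averaging_lost[OF slowly_varying_square square]) (auto simp: w_def c_def)
  define m1 where "m1 = lam / (c * (mu * real d * (\<beta> - \<theta>1)))"
  \<comment> \<open>Three errors: the bound of \<open>drift_le\<close>, the averaging errors of
    order \<open>N^(-1/2)\<close> times the bound \<open>m1\<close> on the clock rate, and the
    exchange of \<open>f1\<close> for the fraction. The factor \<beta> bounds \<theta>.\<close>
  define e where "e N = m1 * (2 * c * (lam * (mu * real d) * f0 * \<bar>real (F N) / real N - \<beta>\<bar> / (lam - L)\<^sup>2)
        + c * L / (lam - L) / real N)
      + m1 * ((C2 + 2 * \<beta> * C1) * real N powr (- 1 / 2)) + 2 * C1 * real N powr (- 1)" for N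
  define D where "D N \<theta> = mean N (real N ^ (d - 1) * clock \<theta>) (f2 N)
      - 2 * \<theta> * mean N (real N ^ (d - 1) * clock \<theta>) (f1 N) + \<theta>\<^sup>2" for N \<theta>
  have c: "0 < c" using coef_pos by (simp add: c_def)
  have m1: "0 \<le> m1" using c lam mu \<theta>1 by (simp add: m1_def)
  have D_bound: "D N \<theta>1 \<le> e N * \<theta>1" if N: "N0 \<le> N" for N
  proof -
    have "D N \<theta>1 \<le> D N 0 + e N * \<theta>1"
    proof (rule deriv_le_imp_le[OF _ _ \<theta>1(1)])
      fix \<theta> assume \<theta>: "0 \<le> \<theta>" "\<theta> \<le> \<theta>1"
      define s where "s = real N ^ (d - 1) * clock \<theta>"
      have "0 \<le> clock \<theta>" using clock_nonneg[of \<theta>] \<theta> \<theta>1 by simp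
      then have s: "0 \<le> s" by (simp add: s_def)
      have d_mean: "((\<lambda>\<theta>. mean N (real N ^ (d - 1) * clock \<theta>) f) has_real_derivative
          mean N s (gen N f) * (real N ^ (d - 1) * clock_rate \<theta>)) (at \<theta> within {0..\<theta>1})" for f
      proof -
        define g where "g \<theta> = real N ^ (d - 1) * clock \<theta>" for \<theta>
        \<comment> \<open>The forward equation lives on the half line, with a one-sided derivative
          at 0, so the time change must map into it.\<close>
        have "g ` {0..\<theta>1} \<subseteq> {0..}"
          using clock_nonneg \<theta>1 by (auto simp: g_def)
        from has_field_derivative_subset[OF mean_deriv[OF N s] this]
        have "((\<lambda>s. mean N s f) has_real_derivative mean N s (gen N f)) (at (g \<theta>) within g ` {0..\<theta>1})"
          by (simp add: g_def s_def)
        moreover have "(g has_real_derivative real N ^ (d - 1) * clock_rate \<theta>) (at \<theta> within {0..\<theta>1})"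
          unfolding g_def using clock_deriv[of \<theta>] \<theta> \<theta>1 by (intro DERIV_cmult) auto
        ultimately show ?thesis
          using DERIV_image_chain[of "\<lambda>s. mean N s f" _ g \<theta> "{0..\<theta>1}"] by (auto simp: o_def g_def)
      qed
      show "(D N has_real_derivative (mean N s (gen N (f2 N)) * (real N ^ (d - 1) * clock_rate \<theta>)
           - (2 * mean N s (f1 N) + mean N s (gen N (f1 N)) * (real N ^ (d - 1) * clock_rate \<theta>) * (2 * \<theta>)) + 2 * \<theta>))
           (at \<theta> within {0..\<theta>1})"
        unfolding D_def
        by (rule derivative_eq_intros d_mean refl | simp add: s_def)+
      have R: "mean N s (\<lambda>x. real N ^ (d - 1) * gen N (f2 N) x) - 2 * \<theta> * mean N s (\<lambda>x. real N ^ (d - 1) * gen N (f1 N) x)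
        \<le> mean N s (\<lambda>x. c * ((2 * real (x 0) + 1) / real N * w N x - 2 * \<theta> * w N x)) + (C2 + 2 * \<beta> * C1) * real N powr (- 1 / 2)"
      proof -
        let ?R1 = "\<lambda>x. \<bar>real N ^ (d - 1) * gen N (f1 N) x - c * (1 * w N x)\<bar>"
        let ?R2 = "\<lambda>x. \<bar>real N ^ (d - 1) * gen N (f2 N) x - c * ((2 * real (x 0) + 1) / real N * w N x)\<bar>"
        have "mean N s (\<lambda>x. real N ^ (d - 1) * gen N (f2 N) x - 2 * \<theta> * (real N ^ (d - 1) * gen N (f1 N) x))
          \<le> mean N s (\<lambda>x. (c * ((2 * real (x 0) + 1) / real N * w N x - 2 * \<theta> * w N x) + ?R2 x) + 2 * \<theta> * ?R1 x)"
        proof (rule mean_mono[OF N s])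
          fix x
          have "real N ^ (d - 1) * gen N (f2 N) x \<le> c * ((2 * real (x 0) + 1) / real N * w N x) + ?R2 x"
            by linarith
          moreover have "2 * \<theta> * (c * (1 * w N x) - real N ^ (d - 1) * gen N (f1 N) x) \<le> 2 * \<theta> * ?R1 x"
            using \<theta> by (intro mult_left_mono) auto
          ultimately show "real N ^ (d - 1) * gen N (f2 N) x - 2 * \<theta> * (real N ^ (d - 1) * gen N (f1 N) x)
            \<le> (c * ((2 * real (x 0) + 1) / real N * w N x - 2 * \<theta> * w N x) + ?R2 x) + 2 * \<theta> * ?R1 x"
            by (simp add: algebra_simps)
        qed
        moreover have "2 * \<theta> * mean N s ?R1 \<le> 2 * \<beta> * (C1 * real N powr (- 1 / 2))"
        proof -
          have "2 * \<theta> * mean N s ?R1 \<le> 2 * \<theta> * (C1 * real N powr (- 1 / 2))"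
            using f1(2)[OF N s] \<theta> by (intro mult_left_mono) auto
          also have "\<dots> \<le> 2 * \<beta> * (C1 * real N powr (- 1 / 2))"
            using \<theta> \<theta>1 f1(1) by (intro mult_right_mono) auto
          finally show ?thesis .
        qed
        moreover note f2(2)[OF N s]
        ultimately show ?thesis unfolding mean_add mean_diff mean_cmult by (simp add: algebra_simps)
      qed
      have cr: "0 \<le> clock_rate \<theta>" "clock_rate \<theta> \<le> m1"
        using clock_rate_nonneg[of \<theta>] clock_rate_le[OF \<theta> \<theta>1(2)] \<theta> \<theta>1 by (auto simp: m1_def c_def)
      have f1_low: "- (2 * mean N s (f1 N)) \<le> mean N s (\<lambda>x. - 2 * (real (x 0) / real N)) + 2 * C1 * real N powr (- 1)"
      proof -
        have "mean N s (\<lambda>x. - 2 * f1 N x) \<le> mean N s (\<lambda>x. - 2 * (real (x 0) / real N) + 2 * \<bar>f1 N x - real (x 0) / real N\<bar>)"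
        proof (rule mean_mono[OF N s])
          fix x :: "nat \<Rightarrow> nat"
          show "- 2 * f1 N x \<le> - 2 * (real (x 0) / real N) + 2 * \<bar>f1 N x - real (x 0) / real N\<bar>"
            using mult_left_mono[OF abs_ge_minus_self[of "f1 N x - real (x 0) / real N"], of 2]
            by (simp only: right_diff_distrib mult_minus_left mult_minus_right) simp
        qed
        then show ?thesis using f1(3)[OF N s] unfolding mean_add mean_cmult by simp
      qed
      have drift: "clock_rate \<theta> * mean N s (\<lambda>x. c * ((2 * real (x 0) + 1) / real N * w N x - 2 * \<theta> * w N x))
          + (mean N s (\<lambda>x. - 2 * (real (x 0) / real N)) + 2 * \<theta>)
        \<le> m1 * (2 * c * (lam * (mu * real d) * f0 * \<bar>real (F N) / real N - \<beta>\<bar> / (lam - L)\<^sup>2)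
        + c * L / (lam - L) / real N)" (is "_ \<le> ?B")
      proof -
        have "mean N s (\<lambda>x. clock_rate \<theta> * (c * ((2 * real (x 0) + 1) / real N * w N x - 2 * \<theta> * w N x))
            + (- 2 * (real (x 0) / real N) + 2 * \<theta>)) \<le> mean N s (\<lambda>x. ?B)"
        proof (rule mean_mono[OF N s])
          fix x assume x: "x \<in> S N"
          show "clock_rate \<theta> * (c * ((2 * real (x 0) + 1) / real N * w N x - 2 * \<theta> * w N x))
            + (- 2 * (real (x 0) / real N) + 2 * \<theta>) \<le> ?B"
            using drift_le[OF N x \<theta> \<theta>1(2)] by (simp add: w_def c_def m1_def)
        qed
        then show ?thesis unfolding mean_const[OF N s] mean_add mean_cmult by simp
      qed
      have "mean N s (gen N (f2 N)) * (real N ^ (d - 1) * clock_rate \<theta>)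
           - (2 * mean N s (f1 N) + mean N s (gen N (f1 N)) * (real N ^ (d - 1) * clock_rate \<theta>) * (2 * \<theta>)) + 2 * \<theta>
         = clock_rate \<theta> * (mean N s (\<lambda>x. real N ^ (d - 1) * gen N (f2 N) x) - 2 * \<theta> * mean N s (\<lambda>x. real N ^ (d - 1) * gen N (f1 N) x))
           + - (2 * mean N s (f1 N)) + 2 * \<theta>"
        unfolding mean_cmult by (simp add: algebra_simps)
      also have "\<dots> \<le> (clock_rate \<theta> * mean N s (\<lambda>x. c * ((2 * real (x 0) + 1) / real N * w N x - 2 * \<theta> * w N x))
            + clock_rate \<theta> * ((C2 + 2 * \<beta> * C1) * real N powr (- 1 / 2)))
           + (mean N s (\<lambda>x. - 2 * (real (x 0) / real N)) + 2 * C1 * real N powr (- 1)) + 2 * \<theta>"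
        using mult_left_mono[OF R cr(1)] f1_low unfolding distrib_left[of "clock_rate \<theta>"] by linarith
      also have "\<dots> \<le> e N"
      proof -
        have "clock_rate \<theta> * ((C2 + 2 * \<beta> * C1) * real N powr (- 1 / 2)) \<le> m1 * ((C2 + 2 * \<beta> * C1) * real N powr (- 1 / 2))"
          using cr(2) f1(1) f2(1) \<beta> by (intro mult_right_mono) auto
        then show ?thesis using drift unfolding e_def by linarith
      qed
      finally show "mean N s (gen N (f2 N)) * (real N ^ (d - 1) * clock_rate \<theta>)
           - (2 * mean N s (f1 N) + mean N s (gen N (f1 N)) * (real N ^ (d - 1) * clock_rate \<theta>) * (2 * \<theta>)) + 2 * \<theta> \<le> e N" .
    qed
    moreover have "D N 0 = 0" by (simp add: D_def clock_0 mean_0[OF N] f2(4)[OF N])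
    ultimately show ?thesis by simp
  qed
  have bound: "mean N (real N ^ (d - 1) * clock \<theta>1) (\<lambda>x. (real (x 0) / real N - \<theta>1)\<^sup>2)
      \<le> e N * \<theta>1 + (C2 + 2 * \<theta>1 * C1) * real N powr (- 1)" if N: "N0 \<le> N" for N
  proof -
    define s where "s = real N ^ (d - 1) * clock \<theta>1"
    have "0 \<le> clock \<theta>1" using clock_nonneg[OF \<theta>1] .
    then have s: "0 \<le> s" by (simp add: s_def)
    have "mean N s (\<lambda>x. (real (x 0) / real N - \<theta>1)\<^sup>2)
      \<le> mean N s (\<lambda>x. f2 N x - 2 * \<theta>1 * f1 N x + \<theta>1\<^sup>2 + (\<bar>f2 N x - (real (x 0) / real N)\<^sup>2\<bar> + 2 * \<theta>1 * \<bar>f1 N x - real (x 0) / real N\<bar>))"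
    proof (rule mean_mono[OF N s])
      fix x :: "nat \<Rightarrow> nat"
      define y where "y = real (x 0) / real N"
      have "2 * \<theta>1 * (f1 N x - y) \<le> 2 * \<theta>1 * \<bar>f1 N x - y\<bar>" using \<theta>1 by (intro mult_left_mono) auto
      moreover have "y\<^sup>2 \<le> f2 N x + \<bar>f2 N x - y\<^sup>2\<bar>" by linarith
      ultimately show "(real (x 0) / real N - \<theta>1)\<^sup>2 \<le> f2 N x - 2 * \<theta>1 * f1 N x + \<theta>1\<^sup>2
          + (\<bar>f2 N x - (real (x 0) / real N)\<^sup>2\<bar> + 2 * \<theta>1 * \<bar>f1 N x - real (x 0) / real N\<bar>)"
        unfolding y_def[symmetric] by (simp add: power2_eq_square algebra_simps)
    qed
    also have "\<dots> = D N \<theta>1 + (mean N s (\<lambda>x. \<bar>f2 N x - (real (x 0) / real N)\<^sup>2\<bar>) + 2 * \<theta>1 * mean N s (\<lambda>x. \<bar>f1 N x - real (x 0) / real N\<bar>))"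
      unfolding mean_add mean_diff mean_cmult mean_const[OF N s] D_def s_def[symmetric] by simp
    also have "\<dots> \<le> e N * \<theta>1 + (C2 * real N powr (- 1) + 2 * \<theta>1 * (C1 * real N powr (- 1)))"
      using D_bound[OF N] f2(3)[OF N s] f1(3)[OF N s] \<theta>1 by (intro add_mono mult_left_mono) auto
    finally show ?thesis by (simp add: s_def algebra_simps)
  qed
  have p1: "(\<lambda>N. real N powr (- 1 / 2)) \<longlonglongrightarrow> 0" and p2: "(\<lambda>N. real N powr (- 1)) \<longlonglongrightarrow> 0"
    by real_asymp+
  have "(\<lambda>N. \<bar>real (F N) / real N - \<beta>\<bar>) \<longlonglongrightarrow> \<bar>\<beta> - \<beta>\<bar>" by (intro tendsto_intros F_lim)
  then have F0: "(\<lambda>N. \<bar>real (F N) / real N - \<beta>\<bar>) \<longlonglongrightarrow> 0" by simp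
  have "e \<longlonglongrightarrow> m1 * (2 * c * (lam * (mu * real d) * f0 * 0 / (lam - L)\<^sup>2) + 0) + m1 * ((C2 + 2 * \<beta> * C1) * 0) + 2 * C1 * 0"
    unfolding e_def by (intro tendsto_intros F0 p1 p2 lim_const_over_n) (use L_less in auto)
  then have e0: "e \<longlonglongrightarrow> 0" by simp
  have "(\<lambda>N. e N * \<theta>1 + (C2 + 2 * \<theta>1 * C1) * real N powr (- 1)) \<longlonglongrightarrow> 0 * \<theta>1 + (C2 + 2 * \<theta>1 * C1) * 0"
    by (intro tendsto_intros e0 p2)
  then have lim: "(\<lambda>N. e N * \<theta>1 + (C2 + 2 * \<theta>1 * C1) * real N powr (- 1)) \<longlonglongrightarrow> 0" by simp
  have nonneg: "0 \<le> mean N (real N ^ (d - 1) * clock \<theta>1) (\<lambda>x. (real (x 0) / real N - \<theta>1)\<^sup>2)" if "N0 \<le> N" for N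
    unfolding mean_def using that clock_nonneg[OF \<theta>1] by (intro sum_nonneg mult_nonneg_nonneg m_nonneg) auto
  show ?thesis
    by (rule tendsto_sandwich[OF _ _ tendsto_const lim])
      (use nonneg bound in \<open>auto simp: eventually_sequentially intro!: exI[of _ N0]\<close>)
qed

end

section \<open>From marginals to the hitting time\<close>

lemma markov_two_times:
  assumes mjp: "markov_jump_process M S q x0 X"
  obtains p where "transition_function S q p"
    "\<And>s t x y. 0 \<le> s \<Longrightarrow> s \<le> t \<Longrightarrow> x \<in> S \<Longrightarrow> y \<in> S \<Longrightarrow>
      measure M {\<omega>\<in>space M. X s \<omega> = x \<and> X t \<omega> = y} =
      measure M {\<omega>\<in>space M. X s \<omega> = x} * p (t - s) x y"
proof -
  obtain p where p: "transition_function S q p"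
    and *: "\<And>(n::nat) (t::nat \<Rightarrow> real) x.
          0 \<le> t 0 \<Longrightarrow> (\<forall>i\<le>n. t i \<le> t (Suc i)) \<Longrightarrow> (\<forall>i\<le>Suc n. x i \<in> S) \<Longrightarrow>
          measure M {\<omega>\<in>space M. \<forall>i\<le>Suc n. X (t i) \<omega> = x i} =
          measure M {\<omega>\<in>space M. \<forall>i\<le>n. X (t i) \<omega> = x i} *
            p (t (Suc n) - t n) (x n) (x (Suc n))"
    using mjp unfolding markov_jump_process_def by blast
  show ?thesis
  proof (rule that[OF p])
    fix s t :: real and x y assume st: "0 \<le> s" "s \<le> t" and xy: "x \<in> S" "y \<in> S"
    have all: "(\<forall>i\<le>Suc 0. P i) \<longleftrightarrow> P 0 \<and> P (Suc 0)" for P by (auto simp: le_Suc_eq)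
    show "measure M {\<omega>\<in>space M. X s \<omega> = x \<and> X t \<omega> = y} =
      measure M {\<omega>\<in>space M. X s \<omega> = x} * p (t - s) x y"
      using *[of "\<lambda>i. if i = 0 then s else t" 0 "\<lambda>i. if i = 0 then x else y"] st xy
      unfolding all by simp
  qed
qed

lemma markov_event_sets:
  assumes "markov_jump_process M S q x0 X" "0 \<le> t"
  shows "{\<omega>\<in>space M. P (X t \<omega>)} \<in> sets M"
proof -
  have "X t \<in> M \<rightarrow>\<^sub>M count_space S" using assms by (simp add: markov_jump_process_def)
  then have "X t -` {y \<in> S. P y} \<inter> space M \<in> sets M" by (rule measurable_sets) auto
  also have "X t -` {y \<in> S. P y} \<inter> space M = {\<omega>\<in>space M. P (X t \<omega>)}"
    using measurable_space[OF \<open>X t \<in> M \<rightarrow>\<^sub>M count_space S\<close>] by auto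
  finally show ?thesis .
qed

lemma markov_event_prob:
  assumes mjp: "markov_jump_process M S q x0 X" and t: "0 \<le> t"
  shows "measure M {\<omega>\<in>space M. P (X t \<omega>)} = (\<Sum>y\<in>S. measure M {\<omega>\<in>space M. X t \<omega> = y} * of_bool (P y))"
proof -
  interpret prob_space M using mjp by (simp add: markov_jump_process_def)
  have S: "finite S" and X: "X t \<in> M \<rightarrow>\<^sub>M count_space S" using mjp t by (auto simp: markov_jump_process_def)
  have "{\<omega>\<in>space M. P (X t \<omega>)} = (\<Union>y\<in>{y\<in>S. P y}. {\<omega>\<in>space M. X t \<omega> = y})"
    using measurable_space[OF X] by auto
  also have "measure M \<dots> = (\<Sum>y\<in>{y\<in>S. P y}. measure M {\<omega>\<in>space M. X t \<omega> = y})"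
    using S markov_event_sets[OF mjp t] by (intro finite_measure_finite_Union) (auto simp: disjoint_family_on_def)
  also have "\<dots> = (\<Sum>y\<in>S. measure M {\<omega>\<in>space M. X t \<omega> = y} * of_bool (P y))"
    using S by (intro sum.mono_neutral_cong_left) auto
  finally show ?thesis .
qed

lemma markov_marginal:
  assumes mjp: "markov_jump_process M S q x0 X" and x0: "x0 \<in> S"
  defines "m \<equiv> \<lambda>t y. measure M {\<omega>\<in>space M. X t \<omega> = y}"
  shows "\<And>y. y \<in> S \<Longrightarrow> m 0 y = of_bool (y = x0)"
    and "\<And>t y. 0 \<le> t \<Longrightarrow> y \<in> S \<Longrightarrow> ((\<lambda>s. m s y) has_real_derivative
           (\<Sum>z\<in>S. m t z * q z y) - m t y * (\<Sum>z\<in>S. q y z)) (at t within {0..})"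
proof -
  interpret prob_space M using mjp by (simp add: markov_jump_process_def)
  obtain p where p: "transition_function S q p"
    and *: "\<And>s t x y. 0 \<le> s \<Longrightarrow> s \<le> t \<Longrightarrow> x \<in> S \<Longrightarrow> y \<in> S \<Longrightarrow>
      measure M {\<omega>\<in>space M. X s \<omega> = x \<and> X t \<omega> = y} =
      measure M {\<omega>\<in>space M. X s \<omega> = x} * p (t - s) x y"
    using markov_two_times[OF mjp] by blast
  have AE: "AE \<omega> in M. X 0 \<omega> = x0" using mjp by (simp add: markov_jump_process_def)
  \<comment> \<open>The deterministic start makes the law at time \<open>t\<close> a row of the
    transition function.\<close>
  have mp: "m t y = p t x0 y" if "0 \<le> t" "y \<in> S" for t y
  proof -
    have "measure M {\<omega>\<in>space M. X 0 \<omega> = x0} = 1"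
      using AE markov_event_sets[OF mjp, of 0 "\<lambda>x. x = x0"] by (subst prob_Collect_eq_1) auto
    moreover have "measure M {\<omega>\<in>space M. X 0 \<omega> = x0 \<and> X t \<omega> = y} = m t y"
    proof -
      have "{\<omega>\<in>space M. X 0 \<omega> = x0 \<and> X t \<omega> = y} = {\<omega>\<in>space M. X 0 \<omega> = x0} \<inter> {\<omega>\<in>space M. X t \<omega> = y}"
        by auto
      then show ?thesis unfolding m_def using AE that
          markov_event_sets[OF mjp, of 0 "\<lambda>x. x = x0"] markov_event_sets[OF mjp, of t "\<lambda>x. x = y"]
        by (intro finite_measure_eq_AE) auto
    qed
    ultimately show ?thesis using *[of 0 t x0 y] that x0 by simp
  qed
  show "m 0 y = of_bool (y = x0)" if "y \<in> S" for y
    using p x0 that mp[of 0 y] by (auto simp: transition_function_def)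
  show "((\<lambda>s. m s y) has_real_derivative
           (\<Sum>z\<in>S. m t z * q z y) - m t y * (\<Sum>z\<in>S. q y z)) (at t within {0..})"
    if t: "0 \<le> t" and y: "y \<in> S" for t y
  proof (rule has_field_derivative_transform_within[of _ _ _ _ 1])
    show "((\<lambda>s. p s x0 y) has_real_derivative
           (\<Sum>z\<in>S. m t z * q z y) - m t y * (\<Sum>z\<in>S. q y z)) (at t within {0..})"
      using p x0 t y by (simp add: mp transition_function_def)
  qed (use t y mp in auto)
qed

text \<open>The generator maps the indicator of having fewer than \<open>x 0\<close> lost files to a
  nonpositive function. Started from \<open>x\<close>, the expectation of this indicator is
  initially 0 and cannot rise. There are finitely many pairs of states, so the exceptional events
  together are null.\<close>

lemma lost_files_mono:
  assumes mjp: "markov_jump_process M (states d F) (jump_rate lam mu d N) x0 X"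
    and mu: "0 \<le> mu" and d: "2 \<le> d" and st: "0 \<le> s" "s \<le> t"
  shows "AE \<omega> in M. X s \<omega> 0 \<le> X t \<omega> 0"
proof -
  let ?S = "states d F"
  interpret prob_space M using mjp by (simp add: markov_jump_process_def)
  obtain p where p: "transition_function ?S (jump_rate lam mu d N) p"
    and *: "\<And>s t x y. 0 \<le> s \<Longrightarrow> s \<le> t \<Longrightarrow> x \<in> ?S \<Longrightarrow> y \<in> ?S \<Longrightarrow>
      measure M {\<omega>\<in>space M. X s \<omega> = x \<and> X t \<omega> = y} =
      measure M {\<omega>\<in>space M. X s \<omega> = x} * p (t - s) x y"
    using markov_two_times[OF mjp] by blast
  have null: "measure M {\<omega>\<in>space M. X s \<omega> = x \<and> X t \<omega> = y} = 0"
    if x: "x \<in> ?S" and y: "y \<in> ?S" and less: "y 0 < x 0" for x y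
  proof (cases "measure M {\<omega>\<in>space M. X s \<omega> = x} = 0")
    case False
    then have pos: "0 < measure M {\<omega>\<in>space M. X s \<omega> = x}" by (simp add: zero_less_measure_iff)
    \<comment> \<open>Nonnegativity of \<open>p\<close> is recovered from the process: a joint
      probability equals \<open>p u x z\<close> times the positive probability of
      \<open>x\<close>.\<close>
    have nonneg: "0 \<le> p u x z" if "0 \<le> u" "z \<in> ?S" for u z
    proof -
      have "measure M {\<omega>\<in>space M. X s \<omega> = x} * p u x z
          = measure M {\<omega>\<in>space M. X s \<omega> = x \<and> X (s + u) \<omega> = z}"
        using *[of s "s + u" x z] st that x by simp
      then have "0 \<le> measure M {\<omega>\<in>space M. X s \<omega> = x} * p u x z"
        using measure_nonneg by (rule ssubst)
      then show ?thesis using pos by (simp add: zero_le_mult_iff)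
    qed
    define g where "g n = (of_bool (n < x 0) :: real)" for n :: nat
    define f where "f u = (\<Sum>z\<in>?S. p u x z * g (z 0))" for u
    define f' where "f' u = (\<Sum>z\<in>?S. p u x z * generator ?S (jump_rate lam mu d N) (\<lambda>z. g (z 0)) z)" for u
    have "f (t - s) \<le> f 0"
    proof (rule nonpos_deriv_imp_le)
      fix u :: real assume u: "0 \<le> u"
      show "(f has_real_derivative f' u) (at u within {0..})"
        unfolding f_def f'_def using p x u
        by (intro forward_equation_expectation finite_states) (simp add: transition_function_def)
      show "f' u \<le> 0" unfolding f'_def
      proof (intro sum_nonpos mult_nonneg_nonpos nonneg[OF u])
        fix z assume z: "z \<in> ?S"
        have "generator ?S (jump_rate lam mu d N) (\<lambda>z. g (z 0)) z = mu * real (z 1) * (g (z 0 + 1) - g (z 0))"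
          using generator_low_count[OF z, of 1 lam mu N g "\<lambda>_. 1"] d by simp
        also have "\<dots> \<le> 0" using mu by (intro mult_nonneg_nonpos) (auto simp: g_def)
        finally show "generator ?S (jump_rate lam mu d N) (\<lambda>z. g (z 0)) z \<le> 0" .
      qed
    qed (use st in simp)
    also have "f 0 = 0"
      unfolding f_def using p x by (intro sum.neutral) (auto simp: transition_function_def g_def)
    finally have "f (t - s) \<le> 0" .
    moreover have "p (t - s) x y * g (y 0) \<le> f (t - s)"
      unfolding f_def using y st nonneg finite_states[of d F]
      by (intro member_le_sum) (auto simp: g_def)
    ultimately have "p (t - s) x y = 0" using nonneg[of "t - s" y] st y less by (simp add: g_def)
    then show ?thesis using *[OF st x y] by simp
  next
    case True
    then show ?thesis using *[OF st x y] by simp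
  qed
  have sets: "{\<omega>\<in>space M. X s \<omega> = x \<and> X t \<omega> = y} \<in> sets M" for x y
  proof -
    have "{\<omega>\<in>space M. X s \<omega> = x \<and> X t \<omega> = y} = {\<omega>\<in>space M. X s \<omega> = x} \<inter> {\<omega>\<in>space M. X t \<omega> = y}" by auto
    then show ?thesis
      using markov_event_sets[OF mjp, of s "\<lambda>z. z = x"] markov_event_sets[OF mjp, of t "\<lambda>z. z = y"] st by auto
  qed
  have "AE \<omega> in M. \<forall>x\<in>?S. \<forall>y\<in>?S. y 0 < x 0 \<longrightarrow> \<not> (X s \<omega> = x \<and> X t \<omega> = y)"
  proof (intro AE_finite_allI finite_states)
    fix x y assume xy: "x \<in> ?S" "y \<in> ?S"
    show "AE \<omega> in M. y 0 < x 0 \<longrightarrow> \<not> (X s \<omega> = x \<and> X t \<omega> = y)"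
    proof (cases "y 0 < x 0")
      case True
      then have "AE \<omega> in M. \<not> (X s \<omega> = x \<and> X t \<omega> = y)"
        using null[OF xy] sets by (simp add: prob_Collect_eq_0)
      then show ?thesis by eventually_elim simp
    qed simp
  qed
  moreover have "AE \<omega> in M. X s \<omega> \<in> ?S \<and> X t \<omega> \<in> ?S"
  proof (rule AE_I2)
    fix \<omega> assume \<omega>: "\<omega> \<in> space M"
    have "X s \<in> M \<rightarrow>\<^sub>M count_space ?S" "X t \<in> M \<rightarrow>\<^sub>M count_space ?S"
      using mjp st by (auto simp: markov_jump_process_def)
    from this[THEN measurable_space, OF \<omega>] show "X s \<omega> \<in> ?S \<and> X t \<omega> \<in> ?S" by simp
  qed
  ultimately show ?thesis by eventually_elim (metis leI)
qed

text \<open>By right-continuity a level reached before time \<open>y\<close> is also held at some rational time.\<close>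

lemma loss_time_less_iff:
  assumes mjp: "markov_jump_process M S q x0 X" and \<omega>: "\<omega> \<in> space M"
  shows "loss_time \<delta> \<beta> N X \<omega> < y \<longleftrightarrow>
    (\<exists>u\<in>\<rat>. 0 \<le> u \<and> ereal u < y \<and> \<delta> * \<beta> \<le> real (X u \<omega> 0) / real N)"
proof
  assume "loss_time \<delta> \<beta> N X \<omega> < y"
  then obtain t where t: "0 \<le> t" "\<delta> * \<beta> \<le> real (X t \<omega> 0) / real N" "ereal t < y"
    unfolding loss_time_def Inf_less_iff by auto
  have "\<forall>\<^sub>F s in at_right t. X s \<omega> = X t \<omega>"
    using mjp \<omega> t by (simp add: markov_jump_process_def)
  moreover have "\<forall>\<^sub>F s in at_right t. ereal s < y"
    using t by (intro order_tendstoD(2)[OF tendsto_ereal[OF tendsto_ident_at]])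
  ultimately have "\<forall>\<^sub>F s in at_right t. X s \<omega> = X t \<omega> \<and> ereal s < y" by eventually_elim simp
  then obtain b where b: "t < b" "\<And>s. t < s \<Longrightarrow> s < b \<Longrightarrow> X s \<omega> = X t \<omega> \<and> ereal s < y"
    unfolding eventually_at_right_field by auto
  obtain u where "u \<in> \<rat>" "t < u" "u < b" using Rats_dense_in_real[OF b(1)] by auto
  with b(2)[of u] t show "\<exists>u\<in>\<rat>. 0 \<le> u \<and> ereal u < y \<and> \<delta> * \<beta> \<le> real (X u \<omega> 0) / real N"
    by (intro bexI[of _ u]) auto
next
  assume "\<exists>u\<in>\<rat>. 0 \<le> u \<and> ereal u < y \<and> \<delta> * \<beta> \<le> real (X u \<omega> 0) / real N"
  then show "loss_time \<delta> \<beta> N X \<omega> < y" unfolding loss_time_def Inf_less_iff by auto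
qed

section \<open>Measurability and law of the hitting time\<close>

lemma loss_time_measurable:
  assumes mjp: "markov_jump_process M S q x0 X"
  shows "loss_time \<delta> \<beta> N X \<in> borel_measurable M"
proof (rule borel_measurableI_less)
  fix y :: ereal
  have "{\<omega>\<in>space M. loss_time \<delta> \<beta> N X \<omega> < y} =
     (\<Union>u\<in>{u\<in>\<rat>. 0 \<le> u \<and> ereal u < y}. {\<omega>\<in>space M. \<delta> * \<beta> \<le> real (X u \<omega> 0) / real N})"
    using loss_time_less_iff[OF mjp] by auto
  also have "\<dots> \<in> sets M"
  proof (intro sets.countable_UN')
    show "countable {u\<in>\<rat>. 0 \<le> u \<and> ereal u < y}" by (rule countable_subset[OF _ countable_rat]) auto
  qed (use markov_event_sets[OF mjp] in auto)
  finally show "{\<omega>\<in>space M. loss_time \<delta> \<beta> N X \<omega> < y} \<in> sets M" .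
qed

text \<open>A level reached strictly before \<open>t\<close> is witnessed at one of countably many
  rational times, so the almost sure monotonicity for each fixed pair of times suffices.\<close>

lemma loss_time_less_imp_level:
  assumes mjp: "markov_jump_process M (states d F) (jump_rate lam mu d N) x0 X"
    and mu: "0 \<le> mu" and d: "2 \<le> d" and t: "0 \<le> t"
  shows "AE \<omega> in M. loss_time \<delta> \<beta> N X \<omega> < ereal t \<longrightarrow> \<delta> * \<beta> \<le> real (X t \<omega> 0) / real N"
proof -
  have "AE \<omega> in M. \<forall>u\<in>{u\<in>\<rat>. 0 \<le> u \<and> u \<le> t}. X u \<omega> 0 \<le> X t \<omega> 0"
  proof (subst AE_ball_countable)
    show "countable {u\<in>\<rat>. 0 \<le> u \<and> u \<le> t}" by (rule countable_subset[OF _ countable_rat]) auto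
  qed (use lost_files_mono[OF mjp mu d] in auto)
  with AE_space show ?thesis
  proof eventually_elim
    case (elim \<omega>)
    show ?case
    proof
      assume "loss_time \<delta> \<beta> N X \<omega> < ereal t"
      then obtain u where u: "u \<in> \<rat>" "0 \<le> u" "u < t" "\<delta> * \<beta> \<le> real (X u \<omega> 0) / real N"
        using loss_time_less_iff[OF mjp elim(1)] by auto
      then have "X u \<omega> 0 \<le> X t \<omega> 0" using elim(2) by auto
      then have "real (X u \<omega> 0) / real N \<le> real (X t \<omega> 0) / real N" by (intro divide_right_mono) auto
      with u(4) show "\<delta> * \<beta> \<le> real (X t \<omega> 0) / real N" by linarith
    qed
  qed
qed

text \<open>For a constant limit, convergence in probability gives convergence in distribution. The
  event of being too large includes the value \<open>\<infinity>\<close>, so escape of mass to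
  infinity is excluded as well.\<close>

lemma weak_convergence_constant:
  fixes T :: "nat \<Rightarrow> 'w \<Rightarrow> ereal" and \<tau> :: real
  assumes prob: "\<And>N. N \<ge> 1 \<Longrightarrow> prob_space (M N)"
    and meas: "\<And>N. N \<ge> 1 \<Longrightarrow> T N \<in> borel_measurable (M N)"
    and low: "\<And>\<epsilon>. 0 < \<epsilon> \<Longrightarrow> (\<lambda>N. measure (M N) {\<omega>\<in>space (M N). T N \<omega> < ereal (\<tau> - \<epsilon>)}) \<longlonglongrightarrow> 0"
    and high: "\<And>\<epsilon>. 0 < \<epsilon> \<Longrightarrow> (\<lambda>N. measure (M N) {\<omega>\<in>space (M N). ereal (\<tau> + \<epsilon>) < T N \<omega>}) \<longlonglongrightarrow> 0"
  shows "weak_convergence (\<lambda>N. distr (M N) borel (T N)) (return borel (ereal \<tau>))"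
  unfolding weak_convergence_def
proof (intro allI impI)
  fix f :: "ereal \<Rightarrow> real" assume cont: "continuous_on UNIV f" and "bounded (range f)"
  then obtain B where B: "0 < B" "\<And>y. \<bar>f y\<bar> \<le> B" unfolding bounded_pos by auto
  have fm: "f \<in> borel_measurable borel" using cont by (rule borel_measurable_continuous_onI)
  have lim: "integral\<^sup>L (return borel (ereal \<tau>)) f = f (ereal \<tau>)"
    using fm by (intro integral_return) auto
  show "(\<lambda>N. integral\<^sup>L (distr (M N) borel (T N)) f) \<longlonglongrightarrow> integral\<^sup>L (return borel (ereal \<tau>)) f"
    unfolding lim
  proof (rule LIMSEQ_I)
    fix \<eta> :: real assume \<eta>: "0 < \<eta>"
    define U where "U = f -` {f (ereal \<tau>) - \<eta> / 2 <..< f (ereal \<tau>) + \<eta> / 2}"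
    have "open U" unfolding U_def using cont by (intro open_vimage) auto
    moreover have "ereal \<tau> \<in> U" using \<eta> by (simp add: U_def)
    ultimately obtain \<epsilon>0 where \<epsilon>0: "0 < \<epsilon>0" "{ereal \<tau> - \<epsilon>0 <..< ereal \<tau> + \<epsilon>0} \<subseteq> U"
      using ereal_open_cont_interval[of U "ereal \<tau>"] by auto
    \<comment> \<open>The neighbourhood may come with an infinite radius, whereas the hypotheses
      speak of real ones.\<close>
    obtain \<epsilon> where \<epsilon>: "0 < \<epsilon>" "ereal \<epsilon> < \<epsilon>0" using ereal_dense2[OF \<epsilon>0(1)] by auto
    define bad where "bad N = measure (M N) {\<omega>\<in>space (M N). T N \<omega> < ereal (\<tau> - \<epsilon>)}
       + measure (M N) {\<omega>\<in>space (M N). ereal (\<tau> + \<epsilon>) < T N \<omega>}" for N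
    have "bad \<longlonglongrightarrow> 0 + 0" unfolding bad_def by (intro tendsto_add low high \<epsilon>)
    then have "bad \<longlonglongrightarrow> 0" by simp
    \<comment> \<open>On the bad events \<open>f\<close> differs from its limit by at most
      \<open>2 * B\<close>, which contributes less than \<open>\<eta> / 2\<close>; the other half
      covers the rest.\<close>
    then obtain n where n: "\<And>N. n \<le> N \<Longrightarrow> \<bar>bad N\<bar> < \<eta> / (4 * B)"
      using LIMSEQ_D[of bad 0 "\<eta> / (4 * B)"] \<eta> B by auto
    have "norm (integral\<^sup>L (distr (M N) borel (T N)) f - f (ereal \<tau>)) < \<eta>" if N: "max n 1 \<le> N" for N
    proof -
      interpret prob_space "M N" using prob N by auto
      have TN: "T N \<in> borel_measurable (M N)" using meas N by auto
      define A1 where "A1 = {\<omega>\<in>space (M N). T N \<omega> < ereal (\<tau> - \<epsilon>)}"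
      define A2 where "A2 = {\<omega>\<in>space (M N). ereal (\<tau> + \<epsilon>) < T N \<omega>}"
      have A: "A1 \<in> sets (M N)" "A2 \<in> sets (M N)" unfolding A1_def A2_def using TN by measurable
      have fT: "(\<lambda>\<omega>. f (T N \<omega>)) \<in> borel_measurable (M N)" using TN fm by measurable
      have int: "integrable (M N) (\<lambda>\<omega>. f (T N \<omega>))"
        using B by (intro integrable_const_bound[of _ B] fT) auto
      have "integral\<^sup>L (distr (M N) borel (T N)) f - f (ereal \<tau>) = (\<integral>\<omega>. f (T N \<omega>) - f (ereal \<tau>) \<partial>M N)"
        using int by (simp add: integral_distr[OF TN fm] prob_space)
      also have "\<bar>\<dots>\<bar> \<le> (\<integral>\<omega>. \<bar>f (T N \<omega>) - f (ereal \<tau>)\<bar> \<partial>M N)" by (rule integral_abs_bound)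
      also have "\<dots> \<le> (\<integral>\<omega>. \<eta> / 2 + (2 * B * indicator A1 \<omega> + 2 * B * indicator A2 \<omega>) \<partial>M N)"
      proof (rule integral_mono)
        show "integrable (M N) (\<lambda>\<omega>. \<bar>f (T N \<omega>) - f (ereal \<tau>)\<bar>)" using int by auto
        show "integrable (M N) (\<lambda>\<omega>. \<eta> / 2 + (2 * B * indicator A1 \<omega> + 2 * B * indicator A2 \<omega>))"
          using A by (intro Bochner_Integration.integrable_add integrable_const) (auto simp: less_top[symmetric])
        fix \<omega> assume \<omega>: "\<omega> \<in> space (M N)"
        have far: "\<bar>f (T N \<omega>) - f (ereal \<tau>)\<bar> \<le> 2 * B"
          using B(2)[of "T N \<omega>"] B(2)[of "ereal \<tau>"] by linarith
        show "\<bar>f (T N \<omega>) - f (ereal \<tau>)\<bar> \<le> \<eta> / 2 + (2 * B * indicator A1 \<omega> + 2 * B * indicator A2 \<omega>)"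
        proof (cases "\<omega> \<in> A1 \<or> \<omega> \<in> A2")
          case True
          then show ?thesis using far B(1) \<eta> by (auto simp: indicator_def)
        next
          case False
          then have "ereal (\<tau> - \<epsilon>) \<le> T N \<omega>" "T N \<omega> \<le> ereal (\<tau> + \<epsilon>)" using \<omega> by (auto simp: A1_def A2_def)
          moreover have "ereal \<tau> - \<epsilon>0 < ereal (\<tau> - \<epsilon>)" "ereal (\<tau> + \<epsilon>) < ereal \<tau> + \<epsilon>0"
            using \<epsilon> by (cases \<epsilon>0; simp)+
          ultimately have "ereal \<tau> - \<epsilon>0 < T N \<omega>" "T N \<omega> < ereal \<tau> + \<epsilon>0"
            by (auto intro: less_le_trans le_less_trans)
          then have "T N \<omega> \<in> U" using \<epsilon>0(2) by auto
          then have "f (ereal \<tau>) - \<eta> / 2 < f (T N \<omega>)" "f (T N \<omega>) < f (ereal \<tau>) + \<eta> / 2"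
            by (auto simp: U_def)
          then have "\<bar>f (T N \<omega>) - f (ereal \<tau>)\<bar> \<le> \<eta> / 2" by linarith
          then show ?thesis using False by simp
        qed
      qed
      also have "\<dots> = \<eta> / 2 + 2 * B * bad N"
        using A by (simp add: prob_space bad_def A1_def[symmetric] A2_def[symmetric] distrib_left less_top[symmetric])
      also have "\<dots> < \<eta>"
      proof -
        have "bad N < \<eta> / (4 * B)" using n[of N] N by auto
        then have "2 * B * bad N < 2 * B * (\<eta> / (4 * B))" using B(1) by (intro mult_strict_left_mono) auto
        also have "\<dots> = \<eta> / 2" using B(1) by simp
        finally show ?thesis by simp
      qed
      finally show ?thesis by simp
    qed
    then show "\<exists>no. \<forall>N\<ge>no. norm (integral\<^sup>L (distr (M N) borel (T N)) f - f (ereal \<tau>)) < \<eta>" by blast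
  qed
qed

lemma markov_chebyshev:
  fixes g :: "'s \<Rightarrow> real"
  assumes mjp: "markov_jump_process M S q x0 X" and t: "0 \<le> t" and \<eta>: "0 < \<eta>"
  shows "measure M {\<omega>\<in>space M. \<eta> \<le> \<bar>g (X t \<omega>)\<bar>}
    \<le> (\<Sum>y\<in>S. measure M {\<omega>\<in>space M. X t \<omega> = y} * (g y)\<^sup>2) / \<eta>\<^sup>2"
  unfolding markov_event_prob[OF mjp t, of "\<lambda>x. \<eta> \<le> \<bar>g x\<bar>"] sum_divide_distrib times_divide_eq_right[symmetric]
proof (intro sum_mono mult_left_mono measure_nonneg)
  fix y
  show "of_bool (\<eta> \<le> \<bar>g y\<bar>) \<le> (g y)\<^sup>2 / \<eta>\<^sup>2"
  proof (cases "\<eta> \<le> \<bar>g y\<bar>")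
    case True
    then have "\<eta>\<^sup>2 \<le> \<bar>g y\<bar>\<^sup>2" using \<eta> by (intro power_mono) auto
    then show ?thesis using True \<eta> by simp
  qed simp
qed

theorem corollary2:
  fixes lambda \<mu> \<beta> \<gamma> \<delta> \<rho> :: real
    and d :: nat
    and F :: "nat \<Rightarrow> nat"
    and M :: "nat \<Rightarrow> 'w measure"
    and X :: "nat \<Rightarrow> real \<Rightarrow> 'w \<Rightarrow> nat \<Rightarrow> nat"
  assumes "lambda > 0" and "\<mu> > 0" and "d \<ge> 2"
    and "\<beta> > 0" and "\<gamma> \<ge> 0"
    and "(\<lambda>N. (real (F N) - real N * \<beta>) / sqrt (real N)) \<longlonglongrightarrow> \<gamma>"
    and "\<And>N. N \<ge> 1 \<Longrightarrow>
           markov_jump_process (M N) (states d (F N)) (jump_rate lambda \<mu> d N)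
             (initial_state d (F N)) (X N)"
    and "\<rho> = lambda / \<mu>"
    and "0 < \<delta>" and "\<delta> < 1"
    and "lambda > real d * \<beta> * \<mu>"
  shows "weak_convergence
           (\<lambda>N. distr (M N) borel
              (\<lambda>\<omega>. loss_time \<delta> \<beta> N (X N) \<omega> / ereal (real N ^ (d - 1))))
           (return borel
              (ereal (\<rho> ^ (d - 1) / (lambda * fact (d - 1)) *
                 (- (\<rho> / real d) * ln (1 - \<delta>) - \<beta> * \<delta>))))"
proof -
  note mjp = assms(7)
  \<comment> \<open>\<open>b\<close> is the limiting arrival rate at the top queue when nothing is
    lost, below \<open>lambda\<close> by assumption. \<open>L\<close> lies strictly between them,
    leaving room for the convergence of \<open>F N / N\<close>, and \<open>r\<close> is halfway
    between 1 and \<open>lambda / L\<close>.\<close>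
  define b where "b = \<mu> * real d * \<beta>"
  define L where "L = (b + lambda) / 2"
  define r where "r = (1 + lambda / L) / 2"
  have b: "0 < b" "b < lambda" using assms by (auto simp: b_def mult_ac)
  then have L: "b < L" "0 < L" "L < lambda" by (auto simp: L_def)
  then have r: "1 < r" "r * L < lambda" by (auto simp: r_def field_simps)
  \<comment> \<open>Deviations of order \<open>sqrt N\<close> disappear after division by
    \<open>N\<close>.\<close>
  have "(\<lambda>N. \<beta> + (real (F N) - real N * \<beta>) / sqrt (real N) * (1 / sqrt (real N))) \<longlonglongrightarrow> \<beta> + \<gamma> * 0"
    by (intro tendsto_intros assms(6)) real_asymp
  moreover have "\<forall>\<^sub>F N in sequentially. \<beta> + (real (F N) - real N * \<beta>) / sqrt (real N) * (1 / sqrt (real N))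
      = real (F N) / real N"
    using eventually_gt_at_top[of 0] by eventually_elim (simp add: diff_divide_distrib)
  ultimately have F_lim: "(\<lambda>N. real (F N) / real N) \<longlonglongrightarrow> \<beta>"
    by (simp add: filterlim_cong)
  have "\<beta> < L / (\<mu> * real d)" using L(1) assms(2,3) by (simp add: b_def field_simps)
  with F_lim have "\<forall>\<^sub>F N in sequentially. real (F N) / real N < L / (\<mu> * real d)"
    by (rule order_tendstoD(2))
  then obtain N1 where N1: "\<And>N. N1 \<le> N \<Longrightarrow> real (F N) / real N < L / (\<mu> * real d)"
    by (auto simp: eventually_sequentially)
  define N0 where "N0 = max 1 N1"
  define m where "m N t y = measure (M N) {\<omega>\<in>space (M N). X N t \<omega> = y}" for N t y
  note marginal = markov_marginal[OF mjp initial_state_in_states]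
  interpret duplication_loss_limit lambda \<mu> r L d N0 F m \<beta>
  proof unfold_locales
    fix N assume N: "N0 \<le> N"
    have "real (F N) / real N < L / (\<mu> * real d)" using N1[of N] N by (simp add: N0_def)
    then show "\<mu> * real d * real (F N) \<le> L * real N"
      using N assms(2,3) by (simp add: N0_def field_simps)
  next
    fix N y and t :: real assume "N0 \<le> N" "0 \<le> t" "y \<in> states d (F N)"
    then show "((\<lambda>s. m N s y) has_real_derivative
        (\<Sum>z\<in>states d (F N). m N t z * jump_rate lambda \<mu> d N z y)
        - m N t y * (\<Sum>z\<in>states d (F N). jump_rate lambda \<mu> d N y z)) (at t within {0..})"
      unfolding m_def using marginal(2)[of N] by (simp add: N0_def)
  next
    fix N y assume "N0 \<le> N" "y \<in> states d (F N)"
    then show "m N 0 y = of_bool (y = initial_state d (F N))"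
      unfolding m_def using marginal(1)[of N] by (simp add: N0_def)
  qed (use assms r F_lim in \<open>auto simp: N0_def m_def\<close>)
  define \<tau> where "\<tau> = clock (\<delta> * \<beta>)"
  have \<delta>\<beta>: "0 < \<delta> * \<beta>" "\<delta> * \<beta> < \<beta>" using assms by auto
  have \<tau>_eq: "\<tau> = \<rho> ^ (d - 1) / (lambda * fact (d - 1)) * (- (\<rho> / real d) * ln (1 - \<delta>) - \<beta> * \<delta>)"
  proof -
    \<comment> \<open>\<open>coef (d - 1)\<close> carries \<open>lambda\<close> to the power
      \<open>d - 2\<close>; its reciprocal completes \<open>\<rho> ^ (d - 1)\<close> at the price of
      one factor \<open>lambda\<close> in the denominator.\<close>
    obtain e where e: "d - 1 = Suc e" using d by (cases "d - 1") auto
    have "1 / coef (d - 1) = \<rho> ^ (d - 1) / (lambda * fact (d - 1))"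
      unfolding coef_def e assms(8) using assms(1,2) by (simp add: power_divide del: fact_Suc)
    moreover have "\<tau> = 1 / coef (d - 1) * (- (\<rho> / real d) * ln (1 - \<delta>) - \<beta> * \<delta>)"
      using assms(2,4,8) by (simp add: \<tau>_def clock_def mult.commute)
    ultimately show ?thesis by simp
  qed
  have far: "(\<lambda>N. measure (M N) {\<omega>\<in>space (M N). \<eta> \<le> \<bar>real (X N (real N ^ (d - 1) * clock \<theta>) \<omega> 0) / real N - \<theta>\<bar>}) \<longlonglongrightarrow> 0"
    if \<theta>: "0 \<le> \<theta>" "\<theta> < \<beta>" and \<eta>: "0 < \<eta>" for \<theta> \<eta>
  proof (rule tendsto_sandwich[OF _ _ tendsto_const])
    have "(\<lambda>N. mean N (real N ^ (d - 1) * clock \<theta>) (\<lambda>x. (real (x 0) / real N - \<theta>)\<^sup>2) / \<eta>\<^sup>2) \<longlonglongrightarrow> 0 / \<eta>\<^sup>2"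
      using \<eta> by (intro tendsto_intros lost_fraction_concentrates \<theta>) auto
    then show "(\<lambda>N. mean N (real N ^ (d - 1) * clock \<theta>) (\<lambda>x. (real (x 0) / real N - \<theta>)\<^sup>2) / \<eta>\<^sup>2) \<longlonglongrightarrow> 0" by simp
    show "\<forall>\<^sub>F N in sequentially. measure (M N) {\<omega>\<in>space (M N). \<eta> \<le> \<bar>real (X N (real N ^ (d - 1) * clock \<theta>) \<omega> 0) / real N - \<theta>\<bar>}
       \<le> mean N (real N ^ (d - 1) * clock \<theta>) (\<lambda>x. (real (x 0) / real N - \<theta>)\<^sup>2) / \<eta>\<^sup>2"
      using eventually_ge_at_top[of 1]
    proof eventually_elim
      case (elim N)
      have "0 \<le> real N ^ (d - 1) * clock \<theta>" using clock_nonneg[OF \<theta>] by simp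
      from markov_chebyshev[OF mjp[OF elim] this \<eta>, of "\<lambda>x. real (x 0) / real N - \<theta>"]
      show ?case by (simp only: mean_def m_def)
    qed
  qed simp
  have clock_cont: "isCont clock (\<delta> * \<beta>)"
    using clock_deriv[OF \<delta>\<beta>(2), of UNIV] by (rule DERIV_isCont)
  let ?T = "\<lambda>N \<omega>. loss_time \<delta> \<beta> N (X N) \<omega> / ereal (real N ^ (d - 1))"
  show ?thesis unfolding \<tau>_eq[symmetric]
  proof (rule weak_convergence_constant)
    show "prob_space (M N)" if "1 \<le> N" for N
      using mjp[OF that] by (simp add: markov_jump_process_def)
    have meas: "?T N \<in> borel_measurable (M N)" if "1 \<le> N" for N
      using loss_time_measurable[OF mjp[OF that]] by measurable
    show "?T N \<in> borel_measurable (M N)" if "1 \<le> N" for N using meas[OF that] .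
  next
    fix \<epsilon> :: real assume \<epsilon>: "0 < \<epsilon>"
    \<comment> \<open>By continuity some \<theta> slightly below \<open>\<delta> * \<beta>\<close>
      has a clock value above \<open>\<tau> - \<epsilon>\<close>. If the rescaled hitting time is
      below \<open>\<tau> - \<epsilon>\<close>, monotonicity keeps the fraction at rescaled time
      \<open>clock \<theta>\<close> at least \<open>\<delta> * \<beta> - \<theta>\<close> above
      \<theta>, an unlikely event.\<close>
    have "\<forall>\<^sub>F \<theta> in at_left (\<delta> * \<beta>). \<tau> - \<epsilon> < clock \<theta>"
      using clock_cont \<epsilon> unfolding isCont_def \<tau>_def
      by (intro order_tendstoD(1)[OF tendsto_mono[OF at_le]]) auto
    moreover have "\<forall>\<^sub>F \<theta> in at_left (\<delta> * \<beta>). \<theta> \<in> {0<..<\<delta> * \<beta>}"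
      using \<delta>\<beta>(1) by (rule eventually_at_left_real)
    ultimately have "\<forall>\<^sub>F \<theta> in at_left (\<delta> * \<beta>). \<theta> \<in> {0<..<\<delta> * \<beta>} \<and> \<tau> - \<epsilon> < clock \<theta>" by eventually_elim simp
    from eventually_happens'[OF trivial_limit_at_left_real this]
    obtain \<theta> where \<theta>: "0 < \<theta>" "\<theta> < \<delta> * \<beta>" "\<tau> - \<epsilon> < clock \<theta>" by auto
    show "(\<lambda>N. measure (M N) {\<omega>\<in>space (M N). ?T N \<omega> < ereal (\<tau> - \<epsilon>)}) \<longlonglongrightarrow> 0"
    proof (rule tendsto_sandwich[OF _ _ tendsto_const far[of \<theta> "\<delta> * \<beta> - \<theta>"]])
      show "\<forall>\<^sub>F N in sequentially. measure (M N) {\<omega>\<in>space (M N). ?T N \<omega> < ereal (\<tau> - \<epsilon>)}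
        \<le> measure (M N) {\<omega>\<in>space (M N). \<delta> * \<beta> - \<theta> \<le> \<bar>real (X N (real N ^ (d - 1) * clock \<theta>) \<omega> 0) / real N - \<theta>\<bar>}"
        using eventually_ge_at_top[of 1]
      proof eventually_elim
        case (elim N)
        interpret prob_space "M N" using mjp[OF elim] by (simp add: markov_jump_process_def)
        define s where "s = real N ^ (d - 1) * clock \<theta>"
        have s: "0 \<le> s" using clock_nonneg[of \<theta>] \<theta> \<delta>\<beta> by (simp add: s_def)
        have Np: "0 < real N ^ (d - 1)" using elim by simp
        show ?case
        proof (rule finite_measure_mono_AE)
          have "AE \<omega> in M N. loss_time \<delta> \<beta> N (X N) \<omega> < ereal s \<longrightarrow> \<delta> * \<beta> \<le> real (X N s \<omega> 0) / real N"
            using mu d s by (intro loss_time_less_imp_level[OF mjp[OF elim]]) auto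
          then show "AE \<omega> in M N. \<omega> \<in> {\<omega>\<in>space (M N). ?T N \<omega> < ereal (\<tau> - \<epsilon>)} \<longrightarrow>
            \<omega> \<in> {\<omega>\<in>space (M N). \<delta> * \<beta> - \<theta> \<le> \<bar>real (X N (real N ^ (d - 1) * clock \<theta>) \<omega> 0) / real N - \<theta>\<bar>}"
          proof eventually_elim
            case (elim \<omega>)
            show ?case
            proof
              assume \<omega>: "\<omega> \<in> {\<omega>\<in>space (M N). ?T N \<omega> < ereal (\<tau> - \<epsilon>)}"
              then have "loss_time \<delta> \<beta> N (X N) \<omega> < ereal (real N ^ (d - 1)) * ereal (\<tau> - \<epsilon>)"
                using Np by (subst (asm) mem_Collect_eq) (simp add: ereal_divide_less_pos)
              also have "\<dots> \<le> ereal s" using \<theta>(3) Np by (simp add: s_def)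
              finally have "\<delta> * \<beta> \<le> real (X N s \<omega> 0) / real N" using elim by simp
              then show "\<omega> \<in> {\<omega>\<in>space (M N). \<delta> * \<beta> - \<theta> \<le> \<bar>real (X N (real N ^ (d - 1) * clock \<theta>) \<omega> 0) / real N - \<theta>\<bar>}"
                using \<omega> by (simp add: s_def)
            qed
          qed
          show "{\<omega>\<in>space (M N). \<delta> * \<beta> - \<theta> \<le> \<bar>real (X N (real N ^ (d - 1) * clock \<theta>) \<omega> 0) / real N - \<theta>\<bar>} \<in> sets (M N)"
            using markov_event_sets[OF mjp[OF elim] s, of "\<lambda>x. \<delta> * \<beta> - \<theta> \<le> \<bar>real (x 0) / real N - \<theta>\<bar>"]
            by (simp add: s_def)
        qed
      qed
    qed (use \<theta> \<delta>\<beta> in auto)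
  next
    fix \<epsilon> :: real assume \<epsilon>: "0 < \<epsilon>"
    \<comment> \<open>Now \<theta> lies slightly above \<open>\<delta> * \<beta>\<close>. A late
      hitting time says directly that the level is not held at rescaled time
      \<open>clock \<theta>\<close>, so the fraction is at least
      \<open>\<theta> - \<delta> * \<beta>\<close> below \<theta>.\<close>
    have "\<forall>\<^sub>F \<theta> in at_right (\<delta> * \<beta>). clock \<theta> < \<tau> + \<epsilon>"
      using clock_cont \<epsilon> unfolding isCont_def \<tau>_def
      by (intro order_tendstoD(2)[OF tendsto_mono[OF at_le]]) auto
    moreover have "\<forall>\<^sub>F \<theta> in at_right (\<delta> * \<beta>). \<theta> \<in> {\<delta> * \<beta><..<\<beta>}"
      using \<delta>\<beta>(2) by (rule eventually_at_right_real)
    ultimately have "\<forall>\<^sub>F \<theta> in at_right (\<delta> * \<beta>). \<theta> \<in> {\<delta> * \<beta><..<\<beta>} \<and> clock \<theta> < \<tau> + \<epsilon>" by eventually_elim simp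
    from eventually_happens'[OF trivial_limit_at_right_real this]
    obtain \<theta> where \<theta>: "\<delta> * \<beta> < \<theta>" "\<theta> < \<beta>" "clock \<theta> < \<tau> + \<epsilon>" by auto
    show "(\<lambda>N. measure (M N) {\<omega>\<in>space (M N). ereal (\<tau> + \<epsilon>) < ?T N \<omega>}) \<longlonglongrightarrow> 0"
    proof (rule tendsto_sandwich[OF _ _ tendsto_const far[of \<theta> "\<theta> - \<delta> * \<beta>"]])
      show "\<forall>\<^sub>F N in sequentially. measure (M N) {\<omega>\<in>space (M N). ereal (\<tau> + \<epsilon>) < ?T N \<omega>}
        \<le> measure (M N) {\<omega>\<in>space (M N). \<theta> - \<delta> * \<beta> \<le> \<bar>real (X N (real N ^ (d - 1) * clock \<theta>) \<omega> 0) / real N - \<theta>\<bar>}"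
        using eventually_ge_at_top[of 1]
      proof eventually_elim
        case (elim N)
        interpret prob_space "M N" using mjp[OF elim] by (simp add: markov_jump_process_def)
        define s where "s = real N ^ (d - 1) * clock \<theta>"
        have s: "0 \<le> s" using clock_nonneg[of \<theta>] \<theta> \<delta>\<beta> by (simp add: s_def)
        have Np: "0 < real N ^ (d - 1)" using elim by simp
        show ?case
        proof (rule finite_measure_mono)
          show "{\<omega>\<in>space (M N). ereal (\<tau> + \<epsilon>) < ?T N \<omega>} \<subseteq>
            {\<omega>\<in>space (M N). \<theta> - \<delta> * \<beta> \<le> \<bar>real (X N (real N ^ (d - 1) * clock \<theta>) \<omega> 0) / real N - \<theta>\<bar>}"
          proof (intro subsetI)
            fix \<omega> assume \<omega>: "\<omega> \<in> {\<omega>\<in>space (M N). ereal (\<tau> + \<epsilon>) < ?T N \<omega>}"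
            have "ereal s \<le> ereal (real N ^ (d - 1)) * ereal (\<tau> + \<epsilon>)" using \<theta>(3) Np by (simp add: s_def)
            also have "\<dots> < loss_time \<delta> \<beta> N (X N) \<omega>"
              using \<omega> Np by (subst (asm) mem_Collect_eq) (simp add: ereal_less_divide_pos)
            finally have "ereal s < loss_time \<delta> \<beta> N (X N) \<omega>" .
            moreover have "loss_time \<delta> \<beta> N (X N) \<omega> \<le> ereal s" if "\<delta> * \<beta> \<le> real (X N s \<omega> 0) / real N"
              unfolding loss_time_def using that s by (intro Inf_lower) auto
            ultimately have "\<not> \<delta> * \<beta> \<le> real (X N s \<omega> 0) / real N" by force
            then show "\<omega> \<in> {\<omega>\<in>space (M N). \<theta> - \<delta> * \<beta> \<le> \<bar>real (X N (real N ^ (d - 1) * clock \<theta>) \<omega> 0) / real N - \<theta>\<bar>}"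
              using \<omega> by (simp add: s_def)
          qed
          show "{\<omega>\<in>space (M N). \<theta> - \<delta> * \<beta> \<le> \<bar>real (X N (real N ^ (d - 1) * clock \<theta>) \<omega> 0) / real N - \<theta>\<bar>} \<in> sets (M N)"
            using markov_event_sets[OF mjp[OF elim] s, of "\<lambda>x. \<theta> - \<delta> * \<beta> \<le> \<bar>real (x 0) / real N - \<theta>\<bar>"]
            by (simp add: s_def)
        qed
      qed
    qed (use \<theta> \<delta>\<beta> in auto)
  qed
qed

end
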